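(* Every supercharacter of $U$ is a superclass function. Moreover, every superclass function on $U$ is a linear combination of supercharacters; hence the supercharacters of $U$ form a basis for the complex vector space $\operatorname{scf}(U)$ consisting of all superclass functions on $U$.
   Context: Let $p$ be an odd prime, $q=p^{e}$ ($e\ge 1$), $\mathbb{F}_q$ the field with $q$ elements, $\mathbb{F}_q^{\times}=\mathbb{F}_q\setminus\{0\}$, and $n\ge 1$. Let $G$ be one of $Sp_{2n}(q)$, $O_{2n}(q)$, $O_{2n+1}(q)$; put $m=2n$ in the first two cases and $m=2n+1$ in the third. $U_m(q)$ is the group of unipotent upper-triangular $m\times m$ matrices over $\mathbb{F}_q$, and $U=G\cap U_m(q)$. Explicitly, with $J$ the $n\times n$ matrix with $1$'s on the anti-diagonal and $0$'s elsewhere, $U$ consists of all block matrices $\begin{pmatrix} x & xv & xw\\ 0 & I_r & -v^{T}J\\ 0&0&Jx^{-T}J\end{pmatrix}$ with $x\in U_n(q)$, $v$ an $n\times r$ matrix, $w$ an $n\times n$ matrix over $\mathbb{F}_q$, where: $r=0$ and $Jw^T-wJ=0$ if $G=Sp_{2n}(q)$; $r=0$ and $Jw^T+wJ=0$ if $G=O_{2n}(q)$; $r=1$ and $Jw^T+wJ=-vv^T$ if $G=O_{2n+1}(q)$. Indexing. Rows and columns of $m\times m$ matrices are indexed by $1\prec 2\prec\cdots\prec n\prec 0\prec -n\prec\cdots\prec -2\prec -1$ (index $0$ present only if $G=O_{2n+1}(q)$); $e_{i,j}$ denotes a matrix unit. Roots. $\varepsilon_1,\dots,\varepsilon_n$ are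 formal independent symbols; $\Phi=\{\varepsilon_i\pm\varepsilon_j:1\le i<j\le n\}\cup\Phi'$ with $\Phi'=\{2\varepsilon_i:1\le i\le n\}$ if $G=Sp_{2n}(q)$, $\Phi'=\emptyset$ if $G=O_{2n}(q)$, $\Phi'=\{\varepsilon_i:1\le i\le n\}$ if $G=O_{2n+1}(q)$. For $\alpha\in\Phi$ let $\mathcal{E}(\alpha)$ be: $\{(i,j),(-j,-i)\}$ if $\alpha=\varepsilon_i-\varepsilon_j$; $\{(i,-j),(j,-i)\}$ if $\alpha=\varepsilon_i+\varepsilon_j$ ($i<j$); $\{(i,-i)\}$ if $\alpha=2\varepsilon_i$; $\{(i,0),(0,-i)\}$ if $\alpha=\varepsilon_i$. For $\Psi\subseteq\Phi$, $\mathcal{E}(\Psi)=\bigcup_{\alpha\in\Psi}\mathcal{E}(\alpha)$. Each $\mathcal{E}(\alpha)$ contains exactly one entry $(i,j)$ with $1\le i\le n$ and $i\prec j\preceq -i$; it is called the positive entry of $\alpha$. Basic pairs. $D\subseteq\Phi$ is basic if $\mathcal{E}(D)$ contains at most one entry from each row and at most one from each column. A basic pair for $U$ is $(D,\phi)$ with $D\subseteq\Phi$ basic (possibly empty) and $\phi:D\to\mathbb{F}_q^\times$ a map. Superclasses. Let $e_\alpha$ be: $e_{i,j}-e_{-j,-i}$ if $\alpha=\varepsilon_i-\varepsilon_j$; $e_{i,-j}+e_{j,-i}$ if $\alpha=\varepsilon_i+\varepsilon_j$ and $G=Sp_{2n}(q)$; $e_{i,-j}-e_{j,-i}$ if $\alpha=\varepsilon_i+\varepsilon_j$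 and $G$ is orthogonal; $e_{i,-i}$ if $\alpha=2\varepsilon_i$; $e_{i,0}-e_{0,-i}$ if $\alpha=\varepsilon_i$. Put $e_{D,\phi}=\sum_{\alpha\in D}\phi(\alpha)e_\alpha$, $V_{D,\phi}=U_m(q)\,e_{D,\phi}\,U_m(q)$ and $K_{D,\phi}=\{x\in U: x-1\in V_{D,\phi}\}$ (so $K_{D,\phi}=\{1\}$ if $D=\emptyset$). The sets $K_{D,\phi}$ are the superclasses of $U$. A function $\eta:U\to\mathbb{C}$ is a superclass function if it is constant on each superclass. Supercharacters. Fix a nontrivial linear character $\vartheta:\mathbb{F}_q\to\mathbb{C}^\times$ of the additive group of $\mathbb{F}_q$. Define subgroups $U_\alpha\le U$: if $\alpha=\varepsilon_i-\varepsilon_j$, $U_\alpha=\{x\in U:x_{i,k}=0,\ i<k<j\}$; if $\alpha=\varepsilon_i+\varepsilon_j$ ($i<j$), $U_\alpha=\{x\in U:x_{i,k}=x_{j,l}=0,\ i<k\le n,\ j\prec l\preceq 0\}$ (when the index $0$ is absent, $l$ runs over $j<l\le n$); if $\alpha=2\varepsilon_i$ or $\alpha=\varepsilon_i$, $U_\alpha=\{x\in U:x_{i,k}=0,\ i<k\le n\}$. For $r\in\mathbb{F}_q^\times$, $\lambda_{\alpha,r}(x)=\vartheta(r x_{i,j})$, with $(i,j)$ the positive entry of $\alpha$, is a linear character of $U_\alpha$; the elementary character is the induced character $\xi_{\alpha,r}=(\lambda_{\alpha,r})^U$. The supercharacter of a basic pair is $\xi_{D,\phi}=\prod_{\alpha\in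 D}\xi_{\alpha,\phi(\alpha)}$ (the trivial character $1_U$ if $D=\emptyset$). *)

theory Defs
  imports
    "Jordan_Normal_Form.Matrix"
    "HOL-Library.FuncSet"
    "HOL-Library.Function_Algebras"
begin

section \<open>Linear algebra of complex-valued functions, induced class functions\<close>

global_interpretation cfun: vector_space "\<lambda>(c::complex) (f::'b \<Rightarrow> complex) x. c * f x"
  by unfold_locales (auto simp: fun_eq_iff algebra_simps)

definition cfun_basis :: "('b \<Rightarrow> complex) set \<Rightarrow> ('b \<Rightarrow> complex) set \<Rightarrow> bool" where
  "cfun_basis B V \<longleftrightarrow> cfun.independent B \<and> cfun.span B = V"

text \<open>Functions on a group \<open>G\<close> are represented by functions on the ambient type that vanish
  outside \<open>carrier G\<close>.  The induced function is given by the Frobenius formula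
  \<open>f^G(g) = |H|^{-1} \<Sum>_{x \<in> G, x^{-1} g x \<in> H} f(x^{-1} g x)\<close>.\<close>

definition induced :: "('b, 'c) monoid_scheme \<Rightarrow> 'b set \<Rightarrow> ('b \<Rightarrow> complex) \<Rightarrow> 'b \<Rightarrow> complex" where
  "induced G H f g =
     (if g \<in> carrier G
      then (\<Sum>x \<in> {x \<in> carrier G. inv\<^bsub>G\<^esub> x \<otimes>\<^bsub>G\<^esub> g \<otimes>\<^bsub>G\<^esub> x \<in> H}.
              f (inv\<^bsub>G\<^esub> x \<otimes>\<^bsub>G\<^esub> g \<otimes>\<^bsub>G\<^esub> x)) / of_nat (card H)
      else 0)"

definition nontrivial_additive_character :: "('a::ab_group_add \<Rightarrow> complex) \<Rightarrow> bool" where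
  "nontrivial_additive_character \<theta> \<longleftrightarrow>
     (\<forall>a. \<theta> a \<noteq> 0) \<and> (\<forall>a b. \<theta> (a + b) = \<theta> a * \<theta> b) \<and> (\<exists>a. \<theta> a \<noteq> 1)"


section \<open>The groups\<close>

text \<open>\<open>Sp\<close>, \<open>O_even\<close>, \<open>O_odd\<close> stand for \<open>Sp\<^sub>2\<^sub>n(q)\<close>, \<open>O\<^sub>2\<^sub>n(q)\<close>, \<open>O\<^sub>2\<^sub>n\<^sub>+\<^sub>1(q)\<close>.\<close>

datatype group_type = Sp | O_even | O_odd

definition mid :: "group_type \<Rightarrow> nat" where
  "mid G = (if G = O_odd then 1 else 0)"

definition dimn :: "group_type \<Rightarrow> nat \<Rightarrow> nat" where
  "dimn G n = 2 * n + mid G"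

definition unitriangular :: "nat \<Rightarrow> 'a::field mat set" where
  "unitriangular k = {x \<in> carrier_mat k k. upper_triangular x \<and> (\<forall>i<k. x $$ (i, i) = 1)}"

definition antidiag :: "nat \<Rightarrow> 'a::field mat" where
  "antidiag n = mat n n (\<lambda>(i, j). if i + j + 1 = n then 1 else 0)"

text \<open>The matrix with block rows \<open>(x, xv, xw)\<close>, \<open>(0, I\<^sub>r, -v\<^sup>T J)\<close>, \<open>(0, 0, J y\<^sup>T J)\<close>,
  where \<open>v\<close> is \<open>n \<times> r\<close>; the argument \<open>y\<close> is to be the inverse of \<open>x\<close>.  For \<open>r = 0\<close> the middle
  block row and column are empty.\<close>

definition block_form ::
  "nat \<Rightarrow> nat \<Rightarrow> 'a::field mat \<Rightarrow> 'a mat \<Rightarrow> 'a mat \<Rightarrow> 'a mat \<Rightarrow> 'a mat" where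
  "block_form n r x y v w =
     four_block_mat
       (four_block_mat x (x * v) (0\<^sub>m r n) (1\<^sub>m r))
       (x * w @\<^sub>r - (transpose_mat v * antidiag n))
       (0\<^sub>m n (n + r))
       (antidiag n * transpose_mat y * antidiag n)"

fun block_condition :: "group_type \<Rightarrow> nat \<Rightarrow> 'a::field mat \<Rightarrow> 'a mat \<Rightarrow> bool" where
  "block_condition Sp n v w \<longleftrightarrow> antidiag n * transpose_mat w - w * antidiag n = 0\<^sub>m n n"
| "block_condition O_even n v w \<longleftrightarrow> antidiag n * transpose_mat w + w * antidiag n = 0\<^sub>m n n"
| "block_condition O_odd n v w \<longleftrightarrow>
     antidiag n * transpose_mat w + w * antidiag n = - (v * transpose_mat v)"

definition U_set :: "group_type \<Rightarrow> nat \<Rightarrow> 'a::field mat set" where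
  "U_set G n =
     {block_form n (mid G) x y v w | x y v w.
        x \<in> unitriangular n \<and> y \<in> carrier_mat n n \<and> inverts_mat x y \<and> inverts_mat y x \<and>
        v \<in> carrier_mat n (mid G) \<and> w \<in> carrier_mat n n \<and> block_condition G n v w}"

definition U_group :: "group_type \<Rightarrow> nat \<Rightarrow> 'a::field mat monoid" where
  "U_group G n = \<lparr>carrier = U_set G n, monoid.mult = (*), one = 1\<^sub>m (dimn G n)\<rparr>"


section \<open>Indexing, roots and basic pairs\<close>

text \<open>Rows and columns carry the labels \<open>1, \<dots>, n, 0, -n, \<dots>, -1\<close> in this order (\<open>0\<close> only for
  \<open>O_odd\<close>); \<open>pos\<close> is the 0-based position of a label, by which library matrices are indexed.\<close>

definition labels :: "group_type \<Rightarrow> nat \<Rightarrow> int set" where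
  "labels G n = {i. - int n \<le> i \<and> i \<le> int n \<and> (i = 0 \<longrightarrow> G = O_odd)}"

definition pos :: "group_type \<Rightarrow> nat \<Rightarrow> int \<Rightarrow> nat" where
  "pos G n i = (if i > 0 then nat (i - 1) else if i = 0 then n else nat (int (dimn G n) + i))"

definition prec :: "group_type \<Rightarrow> nat \<Rightarrow> int \<Rightarrow> int \<Rightarrow> bool" where
  "prec G n i j \<longleftrightarrow> pos G n i < pos G n j"

definition entry :: "group_type \<Rightarrow> nat \<Rightarrow> 'a mat \<Rightarrow> int \<Rightarrow> int \<Rightarrow> 'a" where
  "entry G n x i j = x $$ (pos G n i, pos G n j)"

definition matrix_unit :: "group_type \<Rightarrow> nat \<Rightarrow> int \<Rightarrow> int \<Rightarrow> 'a::field mat" where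
  "matrix_unit G n i j =
     mat (dimn G n) (dimn G n) (\<lambda>(k, l). if k = pos G n i \<and> l = pos G n j then 1 else 0)"

text \<open>The formal roots: \<open>Minus i j\<close>, \<open>Plus i j\<close>, \<open>Twice i\<close>, \<open>Single i\<close> stand for
  \<open>\<epsilon>\<^sub>i - \<epsilon>\<^sub>j\<close>, \<open>\<epsilon>\<^sub>i + \<epsilon>\<^sub>j\<close>, \<open>2\<epsilon>\<^sub>i\<close>, \<open>\<epsilon>\<^sub>i\<close>.\<close>

datatype root = Minus int int | Plus int int | Twice int | Single int

fun roots' :: "group_type \<Rightarrow> nat \<Rightarrow> root set" where
  "roots' Sp n = {Twice i | i. 1 \<le> i \<and> i \<le> int n}"
| "roots' O_even n = {}"
| "roots' O_odd n = {Single i | i. 1 \<le> i \<and> i \<le> int n}"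

definition roots :: "group_type \<Rightarrow> nat \<Rightarrow> root set" where
  "roots G n =
     {Minus i j | i j. 1 \<le> i \<and> i < j \<and> j \<le> int n} \<union>
     {Plus i j | i j. 1 \<le> i \<and> i < j \<and> j \<le> int n} \<union> roots' G n"

fun entries :: "root \<Rightarrow> (int \<times> int) set" where
  "entries (Minus i j) = {(i, j), (-j, -i)}"
| "entries (Plus i j) = {(i, -j), (j, -i)}"
| "entries (Twice i) = {(i, -i)}"
| "entries (Single i) = {(i, 0), (0, -i)}"

definition positive_entry :: "group_type \<Rightarrow> nat \<Rightarrow> root \<Rightarrow> int \<times> int" where
  "positive_entry G n \<alpha> =
     (THE (i, j). (i, j) \<in> entries \<alpha> \<and> 1 \<le> i \<and> i \<le> int n \<and>
                  prec G n i j \<and> (prec G n j (-i) \<or> j = -i))"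

lemma positive_entry_simps:
  "1 \<le> i \<Longrightarrow> i < j \<Longrightarrow> j \<le> int n \<Longrightarrow> positive_entry G n (Minus i j) = (i, j)"
  "1 \<le> i \<Longrightarrow> i < j \<Longrightarrow> j \<le> int n \<Longrightarrow> positive_entry G n (Plus i j) = (i, -j)"
  "1 \<le> i \<Longrightarrow> i \<le> int n \<Longrightarrow> positive_entry G n (Twice i) = (i, -i)"
  "1 \<le> i \<Longrightarrow> i \<le> int n \<Longrightarrow> positive_entry O_odd n (Single i) = (i, 0)"
  unfolding positive_entry_def
  by (rule the_equality; auto simp: prec_def pos_def dimn_def mid_def split: if_splits)+

definition entries_of :: "root set \<Rightarrow> (int \<times> int) set" where
  "entries_of \<Psi> = (\<Union>\<alpha>\<in>\<Psi>. entries \<alpha>)"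

definition basic :: "group_type \<Rightarrow> nat \<Rightarrow> root set \<Rightarrow> bool" where
  "basic G n D \<longleftrightarrow> D \<subseteq> roots G n \<and>
     (\<forall>i j j'. (i, j) \<in> entries_of D \<and> (i, j') \<in> entries_of D \<longrightarrow> j = j') \<and>
     (\<forall>i i' j. (i, j) \<in> entries_of D \<and> (i', j) \<in> entries_of D \<longrightarrow> i = i')"

definition basic_pair :: "group_type \<Rightarrow> nat \<Rightarrow> root set \<Rightarrow> (root \<Rightarrow> 'a::field) \<Rightarrow> bool" where
  "basic_pair G n D \<phi> \<longleftrightarrow> basic G n D \<and> \<phi> \<in> D \<rightarrow>\<^sub>E (UNIV - {0})"


section \<open>Superclasses\<close>

fun root_matrix :: "group_type \<Rightarrow> nat \<Rightarrow> root \<Rightarrow> 'a::field mat" where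
  "root_matrix G n (Minus i j) = matrix_unit G n i j - matrix_unit G n (-j) (-i)"
| "root_matrix G n (Plus i j) =
     (if G = Sp then matrix_unit G n i (-j) + matrix_unit G n j (-i)
      else matrix_unit G n i (-j) - matrix_unit G n j (-i))"
| "root_matrix G n (Twice i) = matrix_unit G n i (-i)"
| "root_matrix G n (Single i) = matrix_unit G n i 0 - matrix_unit G n 0 (-i)"

text \<open>The sum \<open>\<Sum>_{\<alpha> \<in> D} \<phi>(\<alpha>) e_\<alpha>\<close> is taken entrywise, since the type of matrices of all sizes
  has no zero.\<close>

definition e_mat :: "group_type \<Rightarrow> nat \<Rightarrow> root set \<Rightarrow> (root \<Rightarrow> 'a::field) \<Rightarrow> 'a mat" where
  "e_mat G n D \<phi> = mat (dimn G n) (dimn G n)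
     (\<lambda>(k, l). \<Sum>\<alpha>\<in>D. \<phi> \<alpha> * root_matrix G n \<alpha> $$ (k, l))"

definition V_set :: "group_type \<Rightarrow> nat \<Rightarrow> root set \<Rightarrow> (root \<Rightarrow> 'a::field) \<Rightarrow> 'a mat set" where
  "V_set G n D \<phi> = {a * e_mat G n D \<phi> * b | a b.
     a \<in> unitriangular (dimn G n) \<and> b \<in> unitriangular (dimn G n)}"

definition superclass :: "group_type \<Rightarrow> nat \<Rightarrow> root set \<Rightarrow> (root \<Rightarrow> 'a::field) \<Rightarrow> 'a mat set" where
  "superclass G n D \<phi> = {x \<in> U_set G n. x - 1\<^sub>m (dimn G n) \<in> V_set G n D \<phi>}"

definition scf :: "group_type \<Rightarrow> nat \<Rightarrow> ('a::field mat \<Rightarrow> complex) set" where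
  "scf G n = {\<eta>. (\<forall>x. x \<notin> U_set G n \<longrightarrow> \<eta> x = 0) \<and>
     (\<forall>D \<phi>. basic_pair G n D \<phi> \<longrightarrow>
        (\<forall>x \<in> superclass G n D \<phi>. \<forall>y \<in> superclass G n D \<phi>. \<eta> x = \<eta> y))}"


section \<open>Supercharacters\<close>

text \<open>For \<open>Plus i j\<close>, the labels \<open>l\<close> with \<open>j \<prec> l \<preceq> 0\<close> are the labels \<open>l \<ge> 0\<close> with \<open>j \<prec> l\<close>; this
  also covers the groups without label \<open>0\<close>.\<close>

fun U_root :: "group_type \<Rightarrow> nat \<Rightarrow> root \<Rightarrow> 'a::field mat set" where
  "U_root G n (Minus i j) = {x \<in> U_set G n. \<forall>k. i < k \<and> k < j \<longrightarrow> entry G n x i k = 0}"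
| "U_root G n (Plus i j) = {x \<in> U_set G n.
     (\<forall>k. i < k \<and> k \<le> int n \<longrightarrow> entry G n x i k = 0) \<and>
     (\<forall>l \<in> labels G n. prec G n j l \<and> l \<ge> 0 \<longrightarrow> entry G n x j l = 0)}"
| "U_root G n (Twice i) =
     {x \<in> U_set G n. \<forall>k. i < k \<and> k \<le> int n \<longrightarrow> entry G n x i k = 0}"
| "U_root G n (Single i) =
     {x \<in> U_set G n. \<forall>k. i < k \<and> k \<le> int n \<longrightarrow> entry G n x i k = 0}"

definition root_character ::
  "group_type \<Rightarrow> nat \<Rightarrow> ('a::field \<Rightarrow> complex) \<Rightarrow> root \<Rightarrow> 'a \<Rightarrow> 'a mat \<Rightarrow> complex" where
  "root_character G n \<theta> \<alpha> r x = (case positive_entry G n \<alpha> of (i, j) \<Rightarrow> \<theta> (r * entry G n x i j))"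

definition elementary_character ::
  "group_type \<Rightarrow> nat \<Rightarrow> ('a::field \<Rightarrow> complex) \<Rightarrow> root \<Rightarrow> 'a \<Rightarrow> 'a mat \<Rightarrow> complex" where
  "elementary_character G n \<theta> \<alpha> r =
     induced (U_group G n) (U_root G n \<alpha>) (root_character G n \<theta> \<alpha> r)"

definition supercharacter ::
  "group_type \<Rightarrow> nat \<Rightarrow> ('a::field \<Rightarrow> complex) \<Rightarrow> root set \<Rightarrow> (root \<Rightarrow> 'a) \<Rightarrow> 'a mat \<Rightarrow> complex" where
  "supercharacter G n \<theta> D \<phi> x =
     (if x \<in> U_set G n then \<Prod>\<alpha>\<in>D. elementary_character G n \<theta> \<alpha> (\<phi> \<alpha>) x else 0)"

definition supercharacters ::
  "group_type \<Rightarrow> nat \<Rightarrow> ('a::field \<Rightarrow> complex) \<Rightarrow> ('a mat \<Rightarrow> complex) set" where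
  "supercharacters G n \<theta> = {supercharacter G n \<theta> D \<phi> | D \<phi>. basic_pair G n D \<phi>}"

end

(*
  Let Omega be the Gram matrix of the form defining G, and eps = 1 for Sp, eps = -1 for the orthogonal
  groups.  The Cayley transform x |-> b(x) = 2 (x - 1) (x + 1)^(-1) Omega identifies U with the
  eps-symmetric matrices b such that b_ij = 0 unless (i, j) lies strictly above the anti-diagonal, and
  it turns conjugation by y in U into the congruence b |-> y b y^T.  Congruence makes sense for all of
  U_m(q), and each orbit of U_m(q) contains exactly one matrix with at most one nonzero entry in every
  row and column; these normal forms are the matrices e_{D,phi} Omega, so the superclasses are the
  orbits.

  An elementary character is, up to a constant, the sum over g in U_m(q) of
  theta(r (g b(x) g^T)_{kl}): the sum over a coset of a subgroup determined by rows k and l of g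
  reproduces the Frobenius formula for the induced character.  Since the roots of a basic set use
  disjoint sets of rows, which vary independently in U_m(q), the product of these sums is again a
  single sum over U_m(q), visibly constant on orbits.

  Averaging Fourier inversion of the delta function at e_{D,phi} Omega over U_m(q), and reducing the
  dual variable A to normal form by A |-> g^T A g, expresses the indicator function of each superclass
  by supercharacters.  Linear independence follows because both families are indexed by basic pairs.
*)
theory Submission
  imports Defs
begin

section \<open>Unitriangular matrices\<close>

text \<open>Membership in U is a quadratic condition; the Cayley transform makes it the linear
  condition of being eps-symmetric, so that additive characters of a matrix space become available.
  Odd characteristic is spent on this, on clearing a diagonal entry of a symmetric form, and on
  projecting a matrix to its eps-symmetric part. One obstacle is that superclasses come from
  two-sided orbits u e v with independent u and v, whereas only congruence is compatible with U.
  Both relations weaken to u E = E' w with u upper and w lower unitriangular, and monomial matrices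
  related in this weak sense are already equal; hence both kinds of orbit agree on U, and distinct
  superclasses are disjoint. The other obstacle is that the Frobenius formula sees only conjugates
  by U. The constraints defining \<open>U_root\<close> concern segments of two rows that can be
  prescribed freely in U, so every coset of the corresponding subgroup of U_m(q) meets U. Along this
  subgroup the relevant entry of the form is affine in the group element, so its character sum
  either has constant terms or vanishes.\<close>

lemma finite_carrier_mat:
  "finite (carrier_mat r c :: 'a::finite mat set)"
proof -
  have "carrier_mat r c \<subseteq> mat r c ` (PiE ({..<r} \<times> {..<c}) (\<lambda>_. UNIV :: 'a set))"
  proof
    fix A :: "'a mat" assume A: "A \<in> carrier_mat r c"
    have "A = mat r c (restrict (\<lambda>ij. A $$ ij) ({..<r} \<times> {..<c}))"
      using A by (intro eq_matI) auto
    thus "A \<in> mat r c ` (PiE ({..<r} \<times> {..<c}) (\<lambda>_. UNIV :: 'a set))" by fastforce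
  qed
  thus ?thesis by (rule finite_subset) (auto intro!: finite_PiE)
qed

lemma mat_mult_entry:
  "A \<in> carrier_mat a m \<Longrightarrow> B \<in> carrier_mat m b \<Longrightarrow> i < a \<Longrightarrow> j < b \<Longrightarrow>
    (A * B) $$ (i, j) = (\<Sum>s<m. A $$ (i, s) * B $$ (s, j))"
  by (simp add: scalar_prod_def atLeast0LessThan)

text \<open>With all dimensions instantiated to \<open>m\<close>, the inner dimension in the carrier
  premises of the product rules is not a schematic variable that the simplifier has to
  guess.\<close>

lemmas square_mat_simps = mult_carrier_mat[of _ m m _ m] assoc_mult_mat[of _ m m _ m _ m]
  transpose_mult[of _ m m _ m] for m

lemma unitriangularI:
  "x \<in> carrier_mat m m \<Longrightarrow> (\<And>i j. j < i \<Longrightarrow> i < m \<Longrightarrow> x $$ (i, j) = 0) \<Longrightarrow>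
    (\<And>i. i < m \<Longrightarrow> x $$ (i, i) = 1) \<Longrightarrow> x \<in> unitriangular m"
  by (auto simp: unitriangular_def)

lemma unitriangularD:
  assumes "x \<in> unitriangular m"
  shows "x \<in> carrier_mat m m" "\<And>i j. j < i \<Longrightarrow> i < m \<Longrightarrow> x $$ (i, j) = 0"
    "\<And>i. i < m \<Longrightarrow> x $$ (i, i) = 1"
  using assms by (auto simp: unitriangular_def elim!: upper_triangularD)

lemma finite_unitriangular: "finite (unitriangular m :: 'a::{field,finite} mat set)"
  by (rule finite_subset[OF _ finite_carrier_mat[of m m]]) (auto simp: unitriangular_def)

lemma one_unitriangular: "1\<^sub>m m \<in> unitriangular m"
  by (auto intro: unitriangularI)

lemma unitriangular_mult_entry:
  assumes "x \<in> unitriangular m" "B \<in> carrier_mat m b" "i < m" "j < b"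
  shows "(x * B) $$ (i, j) = B $$ (i, j) + (\<Sum>s\<in>{i<..<m}. x $$ (i, s) * B $$ (s, j))"
proof -
  have "(x * B) $$ (i, j) = (\<Sum>s<m. x $$ (i, s) * B $$ (s, j))"
    using mat_mult_entry unitriangularD(1) assms by blast
  also have "\<dots> = (\<Sum>s\<in>insert i {i<..<m}. x $$ (i, s) * B $$ (s, j))"
    using assms by (intro sum.mono_neutral_right) (auto simp: unitriangularD)
  finally show ?thesis using assms by (simp add: unitriangularD)
qed

lemma mult_unitriangular_entry:
  assumes "x \<in> unitriangular m" "B \<in> carrier_mat b m" "i < b" "j < m"
  shows "(B * x) $$ (i, j) = B $$ (i, j) + (\<Sum>s<j. B $$ (i, s) * x $$ (s, j))"
proof -
  have "(B * x) $$ (i, j) = (\<Sum>s<m. B $$ (i, s) * x $$ (s, j))"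
    using mat_mult_entry unitriangularD(1) assms by blast
  also have "\<dots> = (\<Sum>s\<in>insert j {..<j}. B $$ (i, s) * x $$ (s, j))"
    using assms by (intro sum.mono_neutral_right) (auto simp: unitriangularD)
  finally show ?thesis using assms by (simp add: unitriangularD)
qed

lemma mult_unitriangular:
  assumes x: "x \<in> unitriangular m" and y: "y \<in> unitriangular m"
  shows "x * y \<in> unitriangular m"
proof (rule unitriangularI)
  note [simp] = unitriangularD[OF x] unitriangularD[OF y]
  show "x * y \<in> carrier_mat m m" by (meson mult_carrier_mat unitriangularD(1) x y)
  fix i assume i: "i < m"
  show "(x * y) $$ (i, i) = 1"
    unfolding unitriangular_mult_entry[OF x unitriangularD(1)[OF y] i i] using i by simp
  fix j assume j: "j < i"
  hence jm: "j < m" using i by simp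
  show "(x * y) $$ (i, j) = 0"
    unfolding unitriangular_mult_entry[OF x unitriangularD(1)[OF y] i jm] using i j by simp
qed

text \<open>Back substitution: row \<open>i\<close> of \<open>x * B\<close> is row \<open>i\<close>
  of \<open>B\<close> plus a combination of lower rows, so the rows of \<open>B\<close> are
  recovered from the bottom upwards.\<close>

lemma unitriangular_left_cancel:
  assumes x: "x \<in> unitriangular m" and B: "B \<in> carrier_mat m b" "C \<in> carrier_mat m b"
    and eq: "x * B = x * C"
  shows "B = C"
proof -
  have *: "B $$ (i, j) = C $$ (i, j)" if "i < m" "j < b" for i j
    using that
  proof (induction "m - i" arbitrary: i rule: less_induct)
    case less
    have "(x * B) $$ (i, j) = (x * C) $$ (i, j)" using eq by simp
    moreover have "(\<Sum>s\<in>{i<..<m}. x $$ (i, s) * B $$ (s, j)) = (\<Sum>s\<in>{i<..<m}. x $$ (i, s) * C $$ (s, j))"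
      using less by (intro sum.cong) auto
    ultimately show ?case
      using unitriangular_mult_entry[OF x B(1) less(2,3)] unitriangular_mult_entry[OF x B(2) less(2,3)]
      by simp
  qed
  show ?thesis by (rule eq_matI) (use * B in auto)
qed

text \<open>Left multiplication by \<open>x\<close> maps the finite set of unitriangular matrices
  injectively, hence surjectively, to itself and so reaches the identity.\<close>

lemma unitriangular_inverse:
  fixes x :: "'a::{field,finite} mat"
  assumes x: "x \<in> unitriangular m"
  obtains y where "y \<in> unitriangular m" "x * y = 1\<^sub>m m" "y * x = 1\<^sub>m m"
proof -
  have "inj_on ((*) x) (unitriangular m)"
    by (intro inj_onI) (meson unitriangularD(1) unitriangular_left_cancel x)
  moreover have "(*) x ` unitriangular m \<subseteq> unitriangular m" using mult_unitriangular x by blast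
  ultimately have "(*) x ` unitriangular m = unitriangular m"
    by (intro endo_inj_surj finite_unitriangular)
  then obtain y where y: "y \<in> unitriangular m" "x * y = 1\<^sub>m m"
    using one_unitriangular by (metis imageE)
  note c = unitriangularD(1)[OF x] unitriangularD(1)[OF y(1)]
  have "x * (y * x) = x * 1\<^sub>m m"
    using c y(2) by (metis assoc_mult_mat left_mult_one_mat right_mult_one_mat)
  hence "y * x = 1\<^sub>m m"
    using unitriangular_left_cancel[OF x _ _] c by (metis mult_carrier_mat one_carrier_mat)
  thus ?thesis using that y by blast
qed

lemma zero_suffix_left_mult:
  assumes x: "x \<in> unitriangular m" and B: "B \<in> carrier_mat m b"
    and z: "\<And>i. i < m \<Longrightarrow> i \<ge> c \<Longrightarrow> B $$ (i, j) = 0" and j: "j < b" and i: "i < m" "i \<ge> c"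
  shows "(x * B) $$ (i, j) = 0"
  using i z by (subst unitriangular_mult_entry[OF x B _ j]) auto

lemma zero_prefix_right_mult:
  assumes x: "x \<in> unitriangular m" and B: "B \<in> carrier_mat b m"
    and z: "\<And>j. j < c \<Longrightarrow> B $$ (i, j) = 0" and j: "j < c" "j < m" and i: "i < b"
  shows "(B * x) $$ (i, j) = 0"
  using j z by (subst mult_unitriangular_entry[OF x B i]) (auto intro!: sum.neutral)

text \<open>Right multiplication by \<open>x\<close> only adds earlier columns to later ones, and so
  does its inverse. The leading zeros of a row are therefore an invariant; this carries vanishing
  conditions from a group element to its Cayley transform and describes the cosets of a row
  group.\<close>

lemma zero_prefix_right_mult_iff:
  fixes x :: "'a::{field,finite} mat"
  assumes x: "x \<in> unitriangular m" and B: "B \<in> carrier_mat b m" and i: "i < b" and c: "c \<le> m"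
  shows "(\<forall>j<c. (B * x) $$ (i, j) = 0) \<longleftrightarrow> (\<forall>j<c. B $$ (i, j) = 0)"
proof
  assume L: "\<forall>j<c. (B * x) $$ (i, j) = 0"
  obtain y where y: "y \<in> unitriangular m" "x * y = 1\<^sub>m m" using unitriangular_inverse[OF x] by blast
  note cs = unitriangularD(1)[OF x] unitriangularD(1)[OF y(1)]
  have "B = (B * x) * y" using B cs y by simp
  moreover have "(B * x * y) $$ (i, j) = 0" if "j < c" for j
    by (rule zero_prefix_right_mult[OF y(1), where c = c]) (use that L B cs i c in auto)
  ultimately show "\<forall>j<c. B $$ (i, j) = 0" by metis
next
  assume "\<forall>j<c. B $$ (i, j) = 0"
  thus "\<forall>j<c. (B * x) $$ (i, j) = 0"
    using zero_prefix_right_mult[OF x B, of c i] i c by auto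
qed

lemma sum_unitriangular_shift:
  fixes u :: "'a::{field,finite} mat"
  assumes u: "u \<in> unitriangular m"
  shows "(\<Sum>g\<in>unitriangular m. f (g * u)) = (\<Sum>g\<in>unitriangular m. f g)"
proof (rule sum.reindex_bij_betw)
  obtain y where y: "y \<in> unitriangular m" "u * y = 1\<^sub>m m" "y * u = 1\<^sub>m m"
    using unitriangular_inverse[OF u] by blast
  have c: "g * u * y = g" "g * y * u = g" if "g \<in> unitriangular m" for g
    using unitriangularD(1)[OF that] unitriangularD(1)[OF u] unitriangularD(1)[OF y(1)] y(2,3)
    by (simp_all add: assoc_mult_mat[of _ m m _ m _ m])
  show "bij_betw (\<lambda>g. g * u) (unitriangular m) (unitriangular m)"
    by (rule bij_betwI[where g = "\<lambda>g. g * y"]) (use u y c in \<open>auto simp: mult_unitriangular\<close>)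
qed

section \<open>Normal forms under congruence\<close>

text \<open>Zero rows and columns are allowed: these are weighted partial permutation
  matrices.\<close>

definition monomial :: "nat \<Rightarrow> 'a::zero mat \<Rightarrow> bool" where
  "monomial m A \<longleftrightarrow>
     (\<forall>i<m. \<forall>j<m. \<forall>j'<m. A $$ (i, j) \<noteq> 0 \<longrightarrow> A $$ (i, j') \<noteq> 0 \<longrightarrow> j = j') \<and>
     (\<forall>j<m. \<forall>i<m. \<forall>i'<m. A $$ (i, j) \<noteq> 0 \<longrightarrow> A $$ (i', j) \<noteq> 0 \<longrightarrow> i = i')"

definition eps_symmetric :: "nat \<Rightarrow> 'a::field \<Rightarrow> 'a mat \<Rightarrow> bool" where
  "eps_symmetric m \<epsilon> A \<longleftrightarrow> A \<in> carrier_mat m m \<and> (\<forall>i<m. \<forall>j<m. A $$ (j, i) = \<epsilon> * A $$ (i, j))"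

text \<open>Only rows \<open>i\<close> and \<open>j\<close> of \<open>g\<close> enter. The
  independence of the roots of a basic set rests on this.\<close>

lemma congruence_entry:
  fixes g :: "'a::field mat"
  assumes "g \<in> carrier_mat m m" "A \<in> carrier_mat m m" "i < m" "j < m"
  shows "(g * A * g\<^sup>T) $$ (i, j) =
    (\<Sum>a<m. g $$ (i, a) * (\<Sum>b<m. g $$ (j, b) * A $$ (a, b)))"
proof -
  have "(g * (A * g\<^sup>T)) $$ (i, j) = (\<Sum>a<m. g $$ (i, a) * (A * g\<^sup>T) $$ (a, j))"
    using assms by (intro mat_mult_entry) auto
  also have "\<dots> = (\<Sum>a<m. g $$ (i, a) * (\<Sum>b<m. g $$ (j, b) * A $$ (a, b)))"
  proof (intro sum.cong refl arg_cong2[of _ _ _ _ "(*)"])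
    fix a assume "a \<in> {..<m}"
    thus "(A * g\<^sup>T) $$ (a, j) = (\<Sum>b<m. g $$ (j, b) * A $$ (a, b))"
      using assms by (subst mat_mult_entry[of _ m m _ m]) (auto intro!: sum.cong simp: mult.commute)
  qed
  finally show ?thesis using assms by (simp add: assoc_mult_mat[of _ m m _ m _ m])
qed

lemma eps_symmetric_congruence:
  fixes g :: "'a::field mat"
  assumes g: "g \<in> carrier_mat m m" and A: "eps_symmetric m \<epsilon> A"
  shows "eps_symmetric m \<epsilon> (g * A * g\<^sup>T)"
proof -
  have Ac: "A \<in> carrier_mat m m" using A by (simp add: eps_symmetric_def)
  have "(g * A * g\<^sup>T) $$ (j, i) = \<epsilon> * (g * A * g\<^sup>T) $$ (i, j)"
    if ij: "i < m" "j < m" for i j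
  proof -
    have "(g * A * g\<^sup>T) $$ (j, i) = (\<Sum>a<m. \<Sum>b<m. g $$ (j, a) * (g $$ (i, b) * A $$ (a, b)))"
      unfolding congruence_entry[OF g Ac ij(2,1)] by (simp add: sum_distrib_left)
    also have "\<dots> = (\<Sum>b<m. \<Sum>a<m. \<epsilon> * (g $$ (i, b) * (g $$ (j, a) * A $$ (b, a))))"
    proof (subst sum.swap, intro sum.cong refl)
      fix a b assume "a \<in> {..<m}" "b \<in> {..<m}"
      hence "A $$ (a, b) = \<epsilon> * A $$ (b, a)" using A unfolding eps_symmetric_def by blast
      thus "g $$ (j, a) * (g $$ (i, b) * A $$ (a, b)) = \<epsilon> * (g $$ (i, b) * (g $$ (j, a) * A $$ (b, a)))"
        by simp
    qed
    also have "\<dots> = \<epsilon> * (g * A * g\<^sup>T) $$ (i, j)"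
      unfolding congruence_entry[OF g Ac ij] by (simp add: sum_distrib_left)
    finally show ?thesis .
  qed
  thus ?thesis unfolding eps_symmetric_def using g Ac by (meson mult_carrier_mat transpose_carrier_mat)
qed

text \<open>The index \<open>k\<close> has been split off: the form couples it to at most one index
  \<open>l\<close>, possibly \<open>k\<close> itself, and couples \<open>l\<close> to nothing but
  \<open>k\<close>. An index with zero row counts as isolated, with \<open>l = k\<close>. Including
  row \<open>l\<close> in the condition makes isolation pass from an index to its partner.\<close>

definition isolated :: "nat \<Rightarrow> 'a::zero mat \<Rightarrow> nat \<Rightarrow> bool" where
  "isolated m A k \<longleftrightarrow>
     (\<exists>l<m. (\<forall>j<m. j \<noteq> l \<longrightarrow> A $$ (k, j) = 0) \<and> (\<forall>j<m. j \<noteq> k \<longrightarrow> A $$ (l, j) = 0))"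

lemma isolated_partner:
  assumes "isolated m A i" "j < m" "A $$ (i, j) \<noteq> 0" "i < m"
  shows "isolated m A j"
proof -
  obtain l where l: "l < m" "\<And>j. j < m \<Longrightarrow> j \<noteq> l \<Longrightarrow> A $$ (i, j) = 0"
    "\<And>j. j < m \<Longrightarrow> j \<noteq> i \<Longrightarrow> A $$ (l, j) = 0"
    using assms(1) unfolding isolated_def by blast
  hence "l = j" using assms by blast
  thus ?thesis using l assms(4) unfolding isolated_def by blast
qed

text \<open>Isolation is visible in the rows of an index and of its partner. Both indices are
  isolated, so a change of matrix that fixes all isolated rows preserves it.\<close>

lemma isolated_transfer:
  assumes i: "isolated m A i" "i < m"
    and eq: "\<And>i j. isolated m A i \<Longrightarrow> i < m \<Longrightarrow> j < m \<Longrightarrow> A' $$ (i, j) = A $$ (i, j)"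
  shows "isolated m A' i"
proof (cases "\<exists>j<m. A $$ (i, j) \<noteq> 0")
  case True
  then obtain j where j: "j < m" "A $$ (i, j) \<noteq> 0" by blast
  have jo: "isolated m A j" using isolated_partner[OF i(1) j i(2)] .
  obtain l where l: "l < m" "\<And>j. j < m \<Longrightarrow> j \<noteq> l \<Longrightarrow> A $$ (i, j) = 0"
    "\<And>j. j < m \<Longrightarrow> j \<noteq> i \<Longrightarrow> A $$ (l, j) = 0"
    using i(1) unfolding isolated_def by blast
  hence "l = j" using j by blast
  thus ?thesis using l eq[OF i] eq[OF jo j(1)] unfolding isolated_def by (intro exI[of _ j]) auto
next
  case False
  thus ?thesis using i eq unfolding isolated_def by (intro exI[of _ i]) auto
qed

lemma isolated_zero:
  assumes "eps_symmetric m \<epsilon> A" "isolated m A i" "\<not> isolated m A k" "i < m" "k < m"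
  shows "A $$ (i, k) = 0" "A $$ (k, i) = 0"
proof -
  show *: "A $$ (i, k) = 0" using isolated_partner assms by metis
  have "A $$ (k, i) = \<epsilon> * A $$ (i, k)" using assms unfolding eps_symmetric_def by blast
  thus "A $$ (k, i) = 0" using * by simp
qed

lemma all_isolated_imp_monomial:
  assumes sym: "eps_symmetric m \<epsilon> A" and iso: "\<And>k. k < m \<Longrightarrow> isolated m A k"
  shows "monomial m A"
proof -
  have row: "j = j'" if "i < m" "j < m" "j' < m" "A $$ (i, j) \<noteq> 0" "A $$ (i, j') \<noteq> 0" for i j j'
    using iso[OF that(1)] that unfolding isolated_def by metis
  have "A $$ (j, i) \<noteq> 0" if "i < m" "j < m" "A $$ (i, j) \<noteq> 0" for i j
  proof -
    have "A $$ (i, j) = \<epsilon> * A $$ (j, i)" using sym that unfolding eps_symmetric_def by blast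
    thus ?thesis using that(3) by force
  qed
  note sw = this
  show ?thesis unfolding monomial_def
  proof (intro conjI allI impI)
    fix i j j' assume "i < m" "j < m" "j' < m" "A $$ (i, j) \<noteq> 0" "A $$ (i, j') \<noteq> 0"
    thus "j = j'" by (rule row)
  next
    fix j i i' assume a: "j < m" "i < m" "i' < m" "A $$ (i, j) \<noteq> 0" "A $$ (i', j) \<noteq> 0"
    show "i = i'" using row[OF a(1-3) sw[OF a(2,1,4)] sw[OF a(3,1,5)]] .
  qed
qed

section \<open>Clearing rows and columns with a pivot\<close>

lemma sum_three_terms:
  fixes f :: "nat \<Rightarrow> 'a::field"
  assumes "i < m" "k < m" "l < m"
  shows "(\<Sum>s<m. ((if s = i then 1 else 0) + (if s = k then a else 0) + (if s = l then b else 0)) * f s)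
    = f i + a * f k + b * f l"
  using assms by (simp add: distrib_right sum.distrib if_distrib[of "\<lambda>c. c * _"] sum.delta cong: if_cong)

text \<open>Here \<open>g\<close> is the identity plus the vector \<alpha> in column
  \<open>k\<close> and \<beta> in column \<open>l\<close>. It adds multiples of rows
  \<open>k\<close> and \<open>l\<close> to all rows and does the same to columns; the support
  conditions on \<alpha> and \<beta> say that \<open>g\<close> is upper unitriangular.\<close>

lemma two_column_congruence:
  fixes A :: "'a::field mat"
  assumes A: "A \<in> carrier_mat m m" and kl: "k < m" "l < m"
    and al: "\<And>i. i < m \<Longrightarrow> \<alpha> i \<noteq> 0 \<Longrightarrow> i < k" and be: "\<And>i. i < m \<Longrightarrow> \<beta> i \<noteq> 0 \<Longrightarrow> i < l"
  shows "\<exists>g\<in>unitriangular m. \<forall>i<m. \<forall>j<m. (g * A * g\<^sup>T) $$ (i, j) =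
       (A $$ (i, j) + \<alpha> j * A $$ (i, k) + \<beta> j * A $$ (i, l))
       + \<alpha> i * (A $$ (k, j) + \<alpha> j * A $$ (k, k) + \<beta> j * A $$ (k, l))
       + \<beta> i * (A $$ (l, j) + \<alpha> j * A $$ (l, k) + \<beta> j * A $$ (l, l))"
proof (intro bexI allI impI)
  let ?g = "mat m m (\<lambda>(i, s). (if s = i then 1 else 0) + (if s = k then \<alpha> i else 0) + (if s = l then \<beta> i else 0))"
  have g: "?g \<in> carrier_mat m m" by simp
  show "?g \<in> unitriangular m"
    by (rule unitriangularI) (use al be in force)+
  fix i j assume ij: "i < m" "j < m"
  show "(?g * A * ?g\<^sup>T) $$ (i, j) =
       (A $$ (i, j) + \<alpha> j * A $$ (i, k) + \<beta> j * A $$ (i, l))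
       + \<alpha> i * (A $$ (k, j) + \<alpha> j * A $$ (k, k) + \<beta> j * A $$ (k, l))
       + \<beta> i * (A $$ (l, j) + \<alpha> j * A $$ (l, k) + \<beta> j * A $$ (l, l))"
  proof -
    have e: "?g $$ (i, s) = (if s = i then 1 else 0) + (if s = k then \<alpha> i else 0) + (if s = l then \<beta> i else 0)"
      if "i < m" "s < m" for i s using that by simp
    have "(\<Sum>b<m. ?g $$ (j, b) * A $$ (a, b)) = A $$ (a, j) + \<alpha> j * A $$ (a, k) + \<beta> j * A $$ (a, l)" for a
      using ij kl by (subst sum_three_terms[symmetric, of j m k l]) (auto simp: e intro!: sum.cong)
    thus ?thesis
      unfolding congruence_entry[OF g A ij]
      using ij kl by (subst sum_three_terms[symmetric, of i m k l]) (auto simp: e intro!: sum.cong)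
  qed
qed

text \<open>Symmetric elimination at the last non-isolated index \<open>k\<close>, with
  \<open>l\<close> the last non-zero column of its row. If \<open>l = k\<close> the pivot is
  one-dimensional; otherwise it is the plane spanned by \<open>k\<close> and \<open>l\<close>, on
  which the form has to be made hyperbolic. Both maximality choices keep the elimination upper
  triangular: multiples of row \<open>k\<close> are added only to rows before \<open>k\<close>, and
  multiples of row \<open>l\<close> only to rows before \<open>l\<close>.\<close>

lemma isolate_one_more:
  fixes A :: "'a::field mat"
  assumes two: "(2::'a) \<noteq> 0" and eps: "\<epsilon> = 1 \<or> \<epsilon> = -1" and sym: "eps_symmetric m \<epsilon> A"
    and k: "k < m" "\<not> isolated m A k" and kmax: "\<And>j. j < m \<Longrightarrow> j > k \<Longrightarrow> isolated m A j"
  obtains g where "g \<in> unitriangular m" "isolated m (g * A * g\<^sup>T) k"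
    "\<And>i. i < m \<Longrightarrow> isolated m A i \<Longrightarrow> isolated m (g * A * g\<^sup>T) i"
proof -
  have Ac: "A \<in> carrier_mat m m" and sA: "\<And>i j. i < m \<Longrightarrow> j < m \<Longrightarrow> A $$ (j, i) = \<epsilon> * A $$ (i, j)"
    using sym unfolding eps_symmetric_def by blast+
  let ?S = "{j. j < m \<and> A $$ (k, j) \<noteq> 0}"
  have "?S \<noteq> {}" using k unfolding isolated_def by blast
  define l where "l = Max ?S"
  have l: "l < m" "A $$ (k, l) \<noteq> 0" and lmax: "\<And>j. j < m \<Longrightarrow> j > l \<Longrightarrow> A $$ (k, j) = 0"
  proof -
    have fin: "finite ?S" by simp
    show "l < m" "A $$ (k, l) \<noteq> 0" using Max_in[OF fin \<open>?S \<noteq> {}\<close>] by (simp_all add: l_def)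
    show "A $$ (k, j) = 0" if "j < m" "j > l" for j
    proof (rule ccontr)
      assume "A $$ (k, j) \<noteq> 0"
      hence "j \<in> ?S" using that(1) by blast
      from Max_ge[OF fin this] that(2) show False by (simp add: l_def)
    qed
  qed
  have lk0: "A $$ (l, k) \<noteq> 0" using sA[OF k(1) l(1)] l(2) eps by auto
  have nl: "\<not> isolated m A l" using isolated_partner[OF _ k(1) lk0 l(1)] k(2) by blast
  have lk: "l \<le> k" using kmax[OF l(1)] nl by (cases "l \<le> k") auto
  \<comment> \<open>Isolated indices have zero entries against \<open>k\<close> and
    \<open>l\<close>, so the operations below leave their rows unchanged.\<close>
  have z: "A $$ (i, k) = 0" "A $$ (k, i) = 0" "A $$ (i, l) = 0" "A $$ (l, i) = 0"
    if "i < m" "isolated m A i" for i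
    using isolated_zero[OF sym that(2) k(2) that(1) k(1)] isolated_zero[OF sym that(2) nl that(1) l(1)]
    by auto
  have ki: "i < k" if "i < m" "\<not> isolated m A i" "i \<noteq> k" for i
    using kmax[of i] that by (cases i k rule: linorder_cases) auto
  show ?thesis
  proof (cases "l = k")
    case True
    \<comment> \<open>One-dimensional pivot: these multiples of row \<open>k\<close> clear the rest
      of that row and column.\<close>
    define \<alpha> where "\<alpha> j = (if j = k then 0 else - A $$ (k, j) / A $$ (k, k))" for j
    have "\<alpha> i \<noteq> 0 \<Longrightarrow> i < k" if "i < m" for i
      using ki[of i] z(2)[of i] that by (auto simp: \<alpha>_def split: if_splits)
    then obtain g where g: "g \<in> unitriangular m"
      and ge0: "\<forall>i<m. \<forall>j<m. (g * A * g\<^sup>T) $$ (i, j) =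
       (A $$ (i, j) + \<alpha> j * A $$ (i, k)) + \<alpha> i * (A $$ (k, j) + \<alpha> j * A $$ (k, k))"
      using two_column_congruence[OF Ac k(1) k(1), of \<alpha> "\<lambda>_. 0"] by auto
    note ge = ge0[rule_format]
    show ?thesis
    proof (rule that[OF g])
      have "(g * A * g\<^sup>T) $$ (k, j) = 0" if "j < m" "j \<noteq> k" for j
        using that k True l by (simp add: ge \<alpha>_def)
      thus "isolated m (g * A * g\<^sup>T) k" using k unfolding isolated_def by blast
      have "(g * A * g\<^sup>T) $$ (i, j) = A $$ (i, j)"
        if "isolated m A i" "i < m" "j < m" for i j
        using that k z by (simp add: ge \<alpha>_def)
      thus "isolated m (g * A * g\<^sup>T) i" if "isolated m A i" "i < m" for i
        using isolated_transfer[of m A i] that by blast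
    qed
  next
    case False
    hence lk': "l < k" using lk by simp
    have kk: "A $$ (k, k) = 0" using lmax[OF k(1) lk'] .
    \<comment> \<open>\<beta> clears row \<open>k\<close> and can be fixed before \<alpha>, because
      \<open>A $$ (k, k) = 0\<close> prevents \<alpha> from acting on row \<open>k\<close>. Then
      \<alpha> clears row \<open>l\<close>, taking the effect of \<beta> into account.\<close>
    define \<beta> where "\<beta> j = (if j = k \<or> j = l then 0 else - A $$ (k, j) / A $$ (k, l))" for j
    \<comment> \<open>At \<open>l\<close> the diagonal entry changes by
      \<open>\<alpha> l * (A $$ (l, k) + A $$ (k, l))\<close>. In the symmetric case this is twice
      one term, whence the 2 in the denominator; in the skew case the diagonal entry is already zero
      and so is \<open>\<alpha> l\<close>.\<close>
    define \<alpha> where "\<alpha> j = (if j = k then 0 else if j = l then - A $$ (l, l) / (2 * A $$ (k, l))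
      else - (A $$ (l, j) + \<beta> j * A $$ (l, l)) / A $$ (l, k))" for j
    have be: "\<beta> i \<noteq> 0 \<Longrightarrow> i < l" if "i < m" for i
      using lmax[of i] that by (cases i l rule: linorder_cases) (auto simp: \<beta>_def split: if_splits)
    have al0: "\<alpha> i = 0" "\<beta> i = 0" if "i < m" "isolated m A i" for i
      using z[OF that] that k nl by (auto simp: \<alpha>_def \<beta>_def)
    have al: "\<alpha> i \<noteq> 0 \<Longrightarrow> i < k" if "i < m" for i
      using al0(1)[of i] ki[of i] that by (cases "i = k") (auto simp: \<alpha>_def)
    obtain g where g: "g \<in> unitriangular m"
      and ge0: "\<forall>i<m. \<forall>j<m. (g * A * g\<^sup>T) $$ (i, j) =
       (A $$ (i, j) + \<alpha> j * A $$ (i, k) + \<beta> j * A $$ (i, l))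
       + \<alpha> i * (A $$ (k, j) + \<alpha> j * A $$ (k, k) + \<beta> j * A $$ (k, l))
       + \<beta> i * (A $$ (l, j) + \<alpha> j * A $$ (l, k) + \<beta> j * A $$ (l, l))"
      using two_column_congruence[OF Ac k(1) l(1), where \<alpha> = \<alpha> and \<beta> = \<beta>, OF al be] by blast
    note ge = ge0[rule_format]
    have ab: "\<alpha> k = 0" "\<beta> k = 0" "\<beta> l = 0" by (auto simp: \<alpha>_def \<beta>_def)
    have Ckj: "A $$ (k, j) + \<alpha> j * A $$ (k, k) + \<beta> j * A $$ (k, l) = 0" if "j < m" "j \<noteq> l" for j
      using that kk l by (cases "j = k") (auto simp: \<beta>_def)
    show ?thesis
    proof (rule that[OF g])
      have rk: "(g * A * g\<^sup>T) $$ (k, j) = 0" if "j < m" "j \<noteq> l" for j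
        using that k Ckj by (simp add: ge ab)
      have rl: "(g * A * g\<^sup>T) $$ (l, j) = 0" if j: "j < m" "j \<noteq> k" for j
      proof (cases "j = l")
        case True
        have ll: "A $$ (l, l) = \<epsilon> * A $$ (l, l)" and lkk: "A $$ (l, k) = \<epsilon> * A $$ (k, l)"
          using sA l k by blast+
        have neg: "c = 0" if "c = - c" for c :: 'a
          using that two by (metis add.right_inverse mult_2 mult_eq_0_iff)
        have "A $$ (l, l) = 0 \<or> A $$ (l, k) = A $$ (k, l)"
          using eps
        proof
          assume "\<epsilon> = -1"
          with ll have "A $$ (l, l) = - A $$ (l, l)" by (metis mult_minus1)
          thus ?thesis using neg by blast
        qed (use lkk in simp)
        moreover have "2 * \<alpha> l * A $$ (k, l) = - A $$ (l, l)" "A $$ (l, l) = 0 \<Longrightarrow> \<alpha> l = 0"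
          using two l lk' by (simp_all add: \<alpha>_def field_simps)
        ultimately show ?thesis using l k True by (auto simp: ge ab kk algebra_simps)
      next
        case False
        hence "A $$ (l, j) + \<alpha> j * A $$ (l, k) + \<beta> j * A $$ (l, l) = 0"
          using j lk0 by (simp add: \<alpha>_def)
        thus ?thesis using Ckj[OF j(1) False] j l by (simp add: ge ab)
      qed
      show "isolated m (g * A * g\<^sup>T) k"
        unfolding isolated_def using rk rl l by blast
      have "(g * A * g\<^sup>T) $$ (i, j) = A $$ (i, j)"
        if "isolated m A i" "i < m" "j < m" for i j
        using that z al0 by (simp add: ge)
      thus "isolated m (g * A * g\<^sup>T) i" if "isolated m A i" "i < m" for i
        using isolated_transfer[of m A i] that by blast
    qed
  qed
qed

text \<open>Each pivot isolates one more index and keeps those already isolated, so the number of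
  non-isolated indices is the induction measure.\<close>

lemma congruent_to_monomial:
  fixes A :: "'a::field mat"
  assumes two: "(2::'a) \<noteq> 0" and eps: "\<epsilon> = 1 \<or> \<epsilon> = -1" and "eps_symmetric m \<epsilon> A"
  shows "\<exists>g\<in>unitriangular m. monomial m (g * A * g\<^sup>T)"
  using assms(3)
proof (induction "card {k. k < m \<and> \<not> isolated m A k}" arbitrary: A rule: less_induct)
  case less
  let ?N = "{k. k < m \<and> \<not> isolated m A k}"
  have Ac: "A \<in> carrier_mat m m" using less.prems by (simp add: eps_symmetric_def)
  show ?case
  proof (cases "?N = {}")
    case True
    hence "monomial m A" by (intro all_isolated_imp_monomial[OF less.prems]) auto
    thus ?thesis using Ac by (intro bexI[of _ "1\<^sub>m m"]) (auto simp: one_unitriangular)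
  next
    case False
    define k where "k = Max ?N"
    have k: "k < m" "\<not> isolated m A k" using Max_in[OF _ False] unfolding k_def by auto
    have "isolated m A j" if "j < m" "j > k" for j
    proof (rule ccontr)
      assume "\<not> isolated m A j"
      hence "j \<le> k" unfolding k_def using that by (intro Max_ge) auto
      thus False using that by simp
    qed
    then obtain g where g: "g \<in> unitriangular m" "isolated m (g * A * g\<^sup>T) k"
      "\<And>i. i < m \<Longrightarrow> isolated m A i \<Longrightarrow> isolated m (g * A * g\<^sup>T) i"
      using isolate_one_more[OF two eps less.prems k] by blast
    note gc = unitriangularD(1)[OF g(1)]
    have "{j. j < m \<and> \<not> isolated m (g * A * g\<^sup>T) j} \<subset> ?N" using g k by blast
    hence "card {j. j < m \<and> \<not> isolated m (g * A * g\<^sup>T) j} < card ?N"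
      by (intro psubset_card_mono) auto
    from less.hyps[OF this eps_symmetric_congruence[OF gc less.prems]]
    obtain h where h: "h \<in> unitriangular m"
      "monomial m (h * (g * A * g\<^sup>T) * h\<^sup>T)" by blast
    have "h * (g * A * g\<^sup>T) * h\<^sup>T = (h * g) * A * (h * g)\<^sup>T"
      using gc unitriangularD(1)[OF h(1)] Ac
      by (simp add: transpose_mult[of _ m m _ m] assoc_mult_mat[of _ m m _ m _ m])
    thus ?thesis using h mult_unitriangular[OF h(1) g(1)] by metis
  qed
qed

text \<open>Coefficient matrices of additive characters transform contragrediently to the forms, so
  they need a normal form of their own.\<close>

lemma dual_congruent_to_monomial:
  fixes A :: "'a::field mat"
  assumes two: "(2::'a) \<noteq> 0" and eps: "\<epsilon> = 1 \<or> \<epsilon> = -1" and A: "eps_symmetric m \<epsilon> A"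
  shows "\<exists>g\<in>unitriangular m. monomial m (g\<^sup>T * A * g)"
proof -
  \<comment> \<open>Reversing the order of the index set exchanges \<open>g\<close> and its transpose.\<close>
  define rv :: "'a mat \<Rightarrow> 'a mat" where "rv X = mat m m (\<lambda>(i, j). X $$ (m - 1 - i, m - 1 - j))" for X
  have Ac: "A \<in> carrier_mat m m" using A by (simp add: eps_symmetric_def)
  have "A $$ (m - 1 - j, m - 1 - i) = \<epsilon> * A $$ (m - 1 - i, m - 1 - j)" if "i < m" "j < m" for i j
  proof -
    have "m - 1 - i < m" "m - 1 - j < m" using that by auto
    thus ?thesis using A unfolding eps_symmetric_def by blast
  qed
  note sA = this
  have "rv A $$ (j, i) = \<epsilon> * rv A $$ (i, j)" if "i < m" "j < m" for i j
    unfolding rv_def index_mat(1)[OF that] index_mat(1)[OF that(2,1)] prod.case using sA[OF that] .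
  moreover have "rv A \<in> carrier_mat m m" by (simp add: rv_def)
  ultimately have "eps_symmetric m \<epsilon> (rv A)" unfolding eps_symmetric_def by blast
  then obtain g where g: "g \<in> unitriangular m" "monomial m (g * rv A * g\<^sup>T)"
    using congruent_to_monomial[OF two eps] by blast
  note gc = unitriangularD(1)[OF g(1)]
  define h where "h = (rv g)\<^sup>T"
  have h: "h \<in> unitriangular m"
    by (rule unitriangularI) (auto simp: h_def rv_def unitriangularD[OF g(1)])
  have e: "(h\<^sup>T * A * h) $$ (i, j) = (g * rv A * g\<^sup>T) $$ (m - 1 - i, m - 1 - j)"
    if "i < m" "j < m" for i j
  proof -
    have "(h\<^sup>T * A * h) $$ (i, j) =
      (\<Sum>a<m. g $$ (m - 1 - i, m - 1 - a) * (\<Sum>b<m. g $$ (m - 1 - j, m - 1 - b) * A $$ (a, b)))"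
    proof -
      have th: "h\<^sup>T $$ (i, a) = g $$ (m - 1 - i, m - 1 - a)" if "i < m" "a < m" for i a
        using that by (simp add: h_def rv_def)
      have "(h\<^sup>T * A * h) $$ (i, j) =
        (\<Sum>a<m. h\<^sup>T $$ (i, a) * (\<Sum>b<m. h\<^sup>T $$ (j, b) * A $$ (a, b)))"
        using congruence_entry[of "h\<^sup>T" m A i j] that Ac unitriangularD(1)[OF h] by simp
      also have "\<dots> = (\<Sum>a<m. g $$ (m - 1 - i, m - 1 - a) * (\<Sum>b<m. g $$ (m - 1 - j, m - 1 - b) * A $$ (a, b)))"
        by (intro sum.cong refl arg_cong2[of _ _ _ _ "(*)"]) (use that in \<open>simp_all only: th lessThan_iff\<close>)
      finally show ?thesis .
    qed
    also have "\<dots> = (\<Sum>a<m. g $$ (m - 1 - i, a) * (\<Sum>b<m. g $$ (m - 1 - j, m - 1 - b) * A $$ (m - 1 - a, b)))"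
      by (rule sum.reindex_bij_witness[of _ "\<lambda>s. m - 1 - s" "\<lambda>s. m - 1 - s"]) auto
    also have "\<dots> = (\<Sum>a<m. g $$ (m - 1 - i, a) * (\<Sum>b<m. g $$ (m - 1 - j, b) * A $$ (m - 1 - a, m - 1 - b)))"
    proof -
      have "(\<Sum>b<m. g $$ (m - 1 - j, m - 1 - b) * A $$ (m - 1 - a, b)) =
        (\<Sum>b<m. g $$ (m - 1 - j, b) * A $$ (m - 1 - a, m - 1 - b))" for a
        by (rule sum.reindex_bij_witness[of _ "\<lambda>s. m - 1 - s" "\<lambda>s. m - 1 - s"]) auto
      thus ?thesis by simp
    qed
    also have "\<dots> = (g * rv A * g\<^sup>T) $$ (m - 1 - i, m - 1 - j)"
      using congruence_entry[OF gc, of "rv A" "m - 1 - i" "m - 1 - j"] that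
      by (auto simp: rv_def intro!: sum.cong)
    finally show ?thesis .
  qed
  have inj: "i = j" if "i < m" "j < m" "m - 1 - i = m - 1 - j" for i j using that by linarith
  have lt: "m - 1 - i < m" if "i < m" for i using that by linarith
  have "monomial m (h\<^sup>T * A * h)"
    unfolding monomial_def
  proof (intro conjI allI impI)
    fix i j j' assume a: "i < m" "j < m" "j' < m"
      "(h\<^sup>T * A * h) $$ (i, j) \<noteq> 0" "(h\<^sup>T * A * h) $$ (i, j') \<noteq> 0"
    thus "j = j'"
      using g(2)[unfolded monomial_def, THEN conjunct1, rule_format,
          OF lt[OF a(1)] lt[OF a(2)] lt[OF a(3)]] inj[OF a(2,3)] by (simp add: e)
  next
    fix j i i' assume a: "j < m" "i < m" "i' < m"
      "(h\<^sup>T * A * h) $$ (i, j) \<noteq> 0" "(h\<^sup>T * A * h) $$ (i', j) \<noteq> 0"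
    thus "i = i'"
      using g(2)[unfolded monomial_def, THEN conjunct2, rule_format,
          OF lt[OF a(1)] lt[OF a(2)] lt[OF a(3)]] inj[OF a(2,3)] by (simp add: e)
  qed
  thus ?thesis using h by blast
qed

text \<open>A Bruhat-type uniqueness. Let M be the common value of both products. The lowest
  non-zero entry of a column of M sits where \<open>E\<close> has its entry, and the last non-zero
  entry of a row of M sits where \<open>E'\<close> has its entry. An entry of \<open>E\<close> at
  (s, j) thus forces an entry of \<open>E'\<close> in row s at a column t with t \<ge> j, and that
  one forces an entry of \<open>E\<close> in column t at a row s' with s' \<ge> s. The equation with
  independent \<open>u\<close> and \<open>w\<close> covers congruence as well as two-sided
  multiplication.\<close>

lemma monomial_unique:
  fixes E :: "'a::field mat"
  assumes u: "u \<in> unitriangular m" and w: "w\<^sup>T \<in> unitriangular m"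
    and E: "E \<in> carrier_mat m m" "monomial m E" and E': "E' \<in> carrier_mat m m" "monomial m E'"
    and eq: "u * E = E' * w"
  shows "E = E'"
proof -
  note rE = E(2)[unfolded monomial_def, THEN conjunct1, rule_format]
    and cE = E(2)[unfolded monomial_def, THEN conjunct2, rule_format]
    and rE' = E'(2)[unfolded monomial_def, THEN conjunct1, rule_format]
    and cE' = E'(2)[unfolded monomial_def, THEN conjunct2, rule_format]
  have wc: "w \<in> carrier_mat m m" using unitriangularD(1)[OF w] by simp
  define M where "M = u * E"
  have M1: "M $$ (i, j) = E $$ (i, j) + (\<Sum>s\<in>{i<..<m}. u $$ (i, s) * E $$ (s, j))"
    if "i < m" "j < m" for i j
    unfolding M_def using unitriangular_mult_entry[OF u E(1) that] .
  have M2: "M $$ (i, j) = E' $$ (i, j) + (\<Sum>s\<in>{j<..<m}. w $$ (s, j) * E' $$ (i, s))"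
    if "i < m" "j < m" for i j
  proof -
    have "M = (w\<^sup>T * E'\<^sup>T)\<^sup>T"
      using wc E' by (simp add: M_def eq transpose_mult[of _ m m _ m])
    hence "M $$ (i, j) = (w\<^sup>T * E'\<^sup>T) $$ (j, i)" using that wc E' by simp
    also have "\<dots> = E'\<^sup>T $$ (j, i) + (\<Sum>s\<in>{j<..<m}. w\<^sup>T $$ (j, s) * E'\<^sup>T $$ (s, i))"
      using that E' by (intro unitriangular_mult_entry[OF w]) auto
    finally show ?thesis using that E'(1) wc by (auto intro!: sum.cong)
  qed
  have a: "M $$ (s, j) = E $$ (s, j)" if "s < m" "j < m" "E $$ (s, j) \<noteq> 0" for s j
  proof -
    have "E $$ (x, j) = 0" if "s < x" "x < m" for x
      using cE[of j s x] that \<open>s < m\<close> \<open>j < m\<close> \<open>E $$ (s, j) \<noteq> 0\<close> by auto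
    thus ?thesis using that by (simp add: M1)
  qed
  have a': "M $$ (s, j) = E' $$ (s, j)" if "s < m" "j < m" "E' $$ (s, j) \<noteq> 0" for s j
  proof -
    have "E' $$ (s, x) = 0" if "j < x" "x < m" for x
      using rE'[of s j x] that \<open>s < m\<close> \<open>j < m\<close> \<open>E' $$ (s, j) \<noteq> 0\<close> by auto
    thus ?thesis using that by (simp add: M2)
  qed
  have b: "\<exists>t\<ge>j. t < m \<and> E' $$ (s, t) \<noteq> 0" if "s < m" "j < m" "E $$ (s, j) \<noteq> 0" for s j
  proof (rule ccontr)
    assume "\<not> ?thesis"
    hence "M $$ (s, j) = 0" using that by (auto simp: M2 intro!: sum.neutral)
    thus False using a that by simp
  qed
  have b': "\<exists>s'\<ge>s. s' < m \<and> E $$ (s', t) \<noteq> 0" if "s < m" "t < m" "E' $$ (s, t) \<noteq> 0" for s t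
  proof (rule ccontr)
    assume "\<not> ?thesis"
    hence "M $$ (s, t) = 0" using that by (auto simp: M1 intro!: sum.neutral)
    thus False using a' that by simp
  qed
  \<comment> \<open>The chase moves weakly down and to the right, so it ends. If t differs from j,
    the induction hypothesis at (s', t) gives s' = s by uniqueness in the columns of
    \<open>E'\<close>, and then row s of \<open>E\<close> has two entries.\<close>
  have c: "E' $$ (s, j) \<noteq> 0" if "s < m" "j < m" "E $$ (s, j) \<noteq> 0" for s j
    using that
  proof (induction "2 * m - (s + j)" arbitrary: s j rule: less_induct)
    case less
    obtain t where t: "t \<ge> j" "t < m" "E' $$ (s, t) \<noteq> 0" using b[OF less.prems] by blast
    obtain s' where s': "s' \<ge> s" "s' < m" "E $$ (s', t) \<noteq> 0" using b'[OF less.prems(1) t(2,3)] by blast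
    show ?case
    proof (cases "t = j")
      case False
      hence "E' $$ (s', t) \<noteq> 0" using less s' t by (intro less.hyps) auto
      hence "s' = s" using cE' s' t less.prems by blast
      thus ?thesis using rE[OF less.prems(1,2) t(2)] s' less.prems False by auto
    qed (use t in simp)
  qed
  have d: "E $$ (s, t) \<noteq> 0" if "s < m" "t < m" "E' $$ (s, t) \<noteq> 0" for s t
    using b'[OF that] c cE'[OF that(2) that(1)] that by metis
  have "E $$ (s, t) = E' $$ (s, t)" if "s < m" "t < m" for s t
    using a[OF that] a'[OF that] c[OF that] d[OF that] by metis
  thus ?thesis using E(1) E'(1) by (intro eq_matI) auto
qed

section \<open>The groups as isometry groups\<close>

definition form_sign :: "group_type \<Rightarrow> nat \<Rightarrow> nat \<Rightarrow> 'a::field" where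
  "form_sign G n i = (if G = Sp \<and> n \<le> i then -1 else 1)"

text \<open>With J the anti-diagonal matrix, this has upper right block J and lower left block -J
  for \<open>Sp\<close>; for the orthogonal groups it is the anti-diagonal matrix of size
  \<open>dimn G n\<close>.\<close>

definition gram :: "group_type \<Rightarrow> nat \<Rightarrow> 'a::field mat" where
  "gram G n = mat (dimn G n) (dimn G n) (\<lambda>(i, j). if i + j + 1 = dimn G n then form_sign G n i else 0)"

text \<open>Minus the symmetry sign of the Gram matrix Omega, see \<open>gram_transpose\<close>: a
  Cayley transform a satisfies a Omega = - Omega a^T, so a Omega is symmetric when Omega is
  alternating, and conversely.\<close>

definition form_eps :: "group_type \<Rightarrow> 'a::field" where
  "form_eps G = (if G = Sp then 1 else -1)"

lemma form_eps_cases: "form_eps G = (1::'a::field) \<or> form_eps G = (-1::'a::field)"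
  by (simp add: form_eps_def)

lemma form_sign_square: "form_sign G n i * form_sign G n i = 1"
  by (simp add: form_sign_def)

lemma mid_cases: "mid G = 0 \<or> mid G = 1" "mid G = 1 \<longleftrightarrow> G = O_odd" "mid G = Suc 0 \<longleftrightarrow> G = O_odd"
  by (auto simp: mid_def)

lemma form_sign_bar:
  assumes "i < dimn G n"
  shows "form_sign G n (dimn G n - 1 - i) = - form_eps G * (form_sign G n i :: 'a::field)"
  using assms by (cases G) (auto simp: form_sign_def form_eps_def dimn_def mid_def)

lemma gram_carrier [simp]: "gram G n \<in> carrier_mat (dimn G n) (dimn G n)"
  by (simp add: gram_def)

lemma gram_dim [simp]: "dim_row (gram G n) = dimn G n" "dim_col (gram G n) = dimn G n"
  by (simp_all add: gram_def)

lemma gram_entry: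
  "i < dimn G n \<Longrightarrow> j < dimn G n \<Longrightarrow>
    gram G n $$ (i, j) = (if j = dimn G n - 1 - i then form_sign G n i else 0)"
  by (auto simp: gram_def)

lemma gram_transpose: "(gram G n)\<^sup>T = - form_eps G \<cdot>\<^sub>m (gram G n :: 'a::field mat)"
proof (rule eq_matI, goal_cases)
  case (1 i j)
  hence ij: "i < dimn G n" "j < dimn G n" by (simp_all add: gram_def)
  have "gram G n $$ (j, i) = - form_eps G * (gram G n $$ (i, j) :: 'a)"
  proof (cases "j = dimn G n - 1 - i")
    case True
    hence "i = dimn G n - 1 - j" using ij by auto
    thus ?thesis using ij True form_sign_bar[OF ij(1), where ?'a = 'a] by (simp add: gram_entry)
  next
    case False
    hence "i \<noteq> dimn G n - 1 - j" using ij by auto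
    thus ?thesis using ij False by (simp add: gram_entry del: diff_diff_left)
  qed
  thus ?case using ij by simp
qed (simp_all add: gram_def)

lemma mult_gram_entry:
  fixes A :: "'a::field mat"
  assumes A: "A \<in> carrier_mat b (dimn G n)" and ij: "i < b" "j < dimn G n"
  shows "(A * gram G n) $$ (i, j) = A $$ (i, dimn G n - 1 - j) * form_sign G n (dimn G n - 1 - j)"
proof -
  have "(A * gram G n) $$ (i, j) = (\<Sum>s<dimn G n. A $$ (i, s) * gram G n $$ (s, j))"
    by (rule mat_mult_entry[OF A gram_carrier ij])
  also have "\<dots> = (\<Sum>s<dimn G n. if s = dimn G n - 1 - j then A $$ (i, s) * form_sign G n s else 0)"
    using ij by (intro sum.cong refl) (auto simp: gram_entry)
  finally show ?thesis using ij by (simp add: sum.delta)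
qed

lemma gram_congruence_entry:
  fixes z :: "'a::field mat"
  assumes z: "z \<in> carrier_mat (dimn G n) (dimn G n)" and ij: "i < dimn G n" "j < dimn G n"
  shows "(z * gram G n * z\<^sup>T) $$ (i, j) =
    (\<Sum>a<dimn G n. z $$ (i, a) * (form_sign G n a * z $$ (j, dimn G n - 1 - a)))"
proof -
  have "(\<Sum>b<dimn G n. z $$ (j, b) * gram G n $$ (a, b)) = form_sign G n a * z $$ (j, dimn G n - 1 - a)"
    if "a < dimn G n" for a
  proof -
    have "(\<Sum>b<dimn G n. z $$ (j, b) * gram G n $$ (a, b)) =
      (\<Sum>b<dimn G n. if b = dimn G n - 1 - a then z $$ (j, b) * form_sign G n a else 0)"
      using that by (intro sum.cong refl) (auto simp: gram_entry)
    thus ?thesis using that by (simp add: sum.delta)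
  qed
  thus ?thesis unfolding congruence_entry[OF z gram_carrier ij] by (intro sum.cong refl) auto
qed

text \<open>The last block is summed through the mirror index, which is how the Gram matrix pairs
  positions.\<close>

lemma sum_dimn_split:
  fixes f :: "nat \<Rightarrow> 'a::comm_monoid_add"
  shows "(\<Sum>a<dimn G n. f a) = (\<Sum>t<n. f t) + (\<Sum>u<mid G. f (n + u)) + (\<Sum>t<n. f (dimn G n - 1 - t))"
proof -
  have "{..<dimn G n} = {..<n} \<union> ((+) n ` {..<mid G} \<union> (\<lambda>t. dimn G n - 1 - t) ` {..<n})"
    (is "_ = _ \<union> (?B \<union> ?C)")
  proof (intro equalityI subsetI)
    fix a assume a: "a \<in> {..<dimn G n}"
    consider "a < n" | "n \<le> a" "a < n + mid G" | "n + mid G \<le> a" by linarith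
    thus "a \<in> {..<n} \<union> (?B \<union> ?C)"
    proof cases
      case 2
      hence "a = n + (a - n)" "a - n < mid G" by auto
      thus ?thesis by blast
    next
      case 3
      hence "a = dimn G n - 1 - (dimn G n - 1 - a)" "dimn G n - 1 - a < n"
        using a by (auto simp: dimn_def)
      thus ?thesis by blast
    qed simp
  qed (auto simp: dimn_def)
  moreover have "(\<Sum>a\<in>?B. f a) = (\<Sum>u<mid G. f (n + u))" by (subst sum.reindex) auto
  moreover have "(\<Sum>a\<in>?C. f a) = (\<Sum>t<n. f (dimn G n - 1 - t))"
    by (subst sum.reindex) (auto intro!: inj_onI simp: dimn_def)
  moreover have "{..<n} \<inter> (?B \<union> ?C) = {}" "?B \<inter> ?C = {}" by (auto simp: dimn_def)
  ultimately show ?thesis by (simp add: sum.union_disjoint add.assoc)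
qed

text \<open>The blocks of \<open>z\<close>, where right multiplication by the anti-diagonal matrix has been used to
  index columns of the last block column, and rows of the last block row, by their mirror images.\<close>

definition block_x :: "nat \<Rightarrow> 'a mat \<Rightarrow> 'a mat" where
  "block_x n z = mat n n (\<lambda>(i, t). z $$ (i, t))"
definition block_w :: "group_type \<Rightarrow> nat \<Rightarrow> 'a mat \<Rightarrow> 'a mat" where
  "block_w G n z = mat n n (\<lambda>(i, t). z $$ (i, dimn G n - 1 - t))"
definition block_c :: "group_type \<Rightarrow> nat \<Rightarrow> 'a mat \<Rightarrow> 'a mat" where
  "block_c G n z = mat n (mid G) (\<lambda>(i, u). z $$ (i, n + u))"
definition block_y :: "group_type \<Rightarrow> nat \<Rightarrow> 'a mat \<Rightarrow> 'a mat" where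
  "block_y G n z = mat n n (\<lambda>(t, b). z $$ (dimn G n - 1 - b, dimn G n - 1 - t))"
definition block_d :: "group_type \<Rightarrow> nat \<Rightarrow> 'a::field mat \<Rightarrow> 'a mat" where
  "block_d G n z = mat n (mid G) (\<lambda>(t, u). - z $$ (n + u, dimn G n - 1 - t))"

lemma block_carrier:
  "block_x n z \<in> carrier_mat n n" "block_w G n z \<in> carrier_mat n n"
  "block_c G n z \<in> carrier_mat n (mid G)" "block_y G n z \<in> carrier_mat n n"
  "block_d G n z \<in> carrier_mat n (mid G)"
  by (simp_all add: block_x_def block_w_def block_c_def block_y_def block_d_def)

lemma block_x_unitriangular:
  "z \<in> unitriangular (dimn G n) \<Longrightarrow> block_x n z \<in> unitriangular n"
  by (rule unitriangularI) (auto simp: block_x_def unitriangularD dimn_def)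

text \<open>Triangularity leaves three blocks of z Omega z^T to compare: the first block row against
  the last, middle and first block columns gives the three conditions in this order. The remaining
  blocks follow from the symmetry of Omega or hold for every unitriangular matrix.\<close>

lemma isometry_iff_blocks:
  fixes z :: "'a::field mat"
  assumes z: "z \<in> unitriangular (dimn G n)"
  defines "X \<equiv> block_x n z" and "N \<equiv> block_w G n z" and "C \<equiv> block_c G n z"
    and "Y \<equiv> block_y G n z" and "D \<equiv> block_d G n z"
  shows "z * gram G n * z\<^sup>T = gram G n \<longleftrightarrow>
    X * Y = 1\<^sub>m n \<and> C = X * D \<and>
    X * N\<^sup>T + (- form_eps G) \<cdot>\<^sub>m (N * X\<^sup>T) + C * C\<^sup>T = 0\<^sub>m n n"
proof -
  let ?m = "dimn G n" and ?r = "mid G"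
  note zD = unitriangularD[OF z]
  define P where "P i j = (\<Sum>a<?m. z $$ (i, a) * (form_sign G n a * z $$ (j, ?m - 1 - a)))" for i j
  have low: "z $$ (i, j) = 0" if "j < i" "i < ?m" for i j using zD that by blast
  have Psplit: "P i j = (\<Sum>t<n. z $$ (i, t) * z $$ (j, ?m - 1 - t)) + (\<Sum>u<?r. z $$ (i, n + u) * z $$ (j, n + u))
      + (- form_eps G) * (\<Sum>t<n. z $$ (i, ?m - 1 - t) * z $$ (j, t))" for i j
  proof -
    have "(\<Sum>t<n. z $$ (i, t) * (form_sign G n t * z $$ (j, ?m - 1 - t))) = (\<Sum>t<n. z $$ (i, t) * z $$ (j, ?m - 1 - t))"
      by (intro sum.cong) (auto simp: form_sign_def)
    moreover have "(\<Sum>u<?r. z $$ (i, n + u) * (form_sign G n (n + u) * z $$ (j, ?m - 1 - (n + u)))) =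
      (\<Sum>u<?r. z $$ (i, n + u) * z $$ (j, n + u))"
      by (intro sum.cong) (auto simp: form_sign_def mid_def dimn_def split: if_splits)
    moreover have "(\<Sum>t<n. z $$ (i, ?m - 1 - t) * (form_sign G n (?m - 1 - t) * z $$ (j, ?m - 1 - (?m - 1 - t))))
      = (- form_eps G) * (\<Sum>t<n. z $$ (i, ?m - 1 - t) * z $$ (j, t))"
    proof -
      have "form_sign G n (?m - 1 - t) = - form_eps G * (1::'a)" "?m - 1 - (?m - 1 - t) = t" if "t < n" for t
        using that form_sign_bar[of t G n, where ?'a = 'a] by (auto simp: form_sign_def dimn_def)
      thus ?thesis by (simp add: sum_distrib_left mult_ac)
    qed
    ultimately show ?thesis unfolding P_def by (subst sum_dimn_split) simp
  qed
  have P11: "P i j = (X * N\<^sup>T + (- form_eps G) \<cdot>\<^sub>m (N * X\<^sup>T) + C * C\<^sup>T) $$ (i, j)"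
    if ij: "i < n" "j < n" for i j
  proof -
    have "(X * N\<^sup>T) $$ (i, j) = (\<Sum>t<n. z $$ (i, t) * z $$ (j, ?m - 1 - t))"
      using ij by (subst mat_mult_entry[of _ n n _ n]) (auto simp: X_def N_def block_x_def block_w_def)
    moreover have "(N * X\<^sup>T) $$ (i, j) = (\<Sum>t<n. z $$ (i, ?m - 1 - t) * z $$ (j, t))"
      using ij by (subst mat_mult_entry[of _ n n _ n]) (auto simp: X_def N_def block_x_def block_w_def)
    moreover have "(C * C\<^sup>T) $$ (i, j) = (\<Sum>u<?r. z $$ (i, n + u) * z $$ (j, n + u))"
      using ij by (subst mat_mult_entry[of _ n ?r _ n]) (auto simp: C_def block_c_def)
    moreover have "X \<in> carrier_mat n n" "N \<in> carrier_mat n n" "C \<in> carrier_mat n ?r"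
      by (simp_all add: X_def N_def C_def block_carrier)
    ultimately show ?thesis unfolding Psplit using ij
      by (simp del: index_mult_mat(1))
  qed
  have P13: "P i (?m - 1 - b) = (X * Y) $$ (i, b)" if ib: "i < n" "b < n" for i b
  proof -
    have "(X * Y) $$ (i, b) = (\<Sum>t<n. z $$ (i, t) * z $$ (?m - 1 - b, ?m - 1 - t))"
      using ib by (subst mat_mult_entry[of _ n n _ n]) (auto simp: X_def Y_def block_x_def block_y_def)
    moreover have "z $$ (?m - 1 - b, n + u) = 0" if "u < ?r" for u
      using ib that by (intro low) (auto simp: dimn_def)
    moreover have "z $$ (?m - 1 - b, t) = 0" if "t < n" for t
      using ib that by (intro low) (auto simp: dimn_def)
    ultimately show ?thesis unfolding Psplit by simp
  qed
  have P12: "P i (n + u) = C $$ (i, u) - (X * D) $$ (i, u)" if iu: "i < n" "u < ?r" for i u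
  proof -
    have "(X * D) $$ (i, u) = (\<Sum>t<n. z $$ (i, t) * - z $$ (n + u, ?m - 1 - t))"
      using iu by (subst mat_mult_entry[of _ n n _ ?r]) (auto simp: X_def D_def block_x_def block_d_def)
    moreover have "z $$ (n + u, t) = 0" if "t < n" for t
      using iu that by (intro low) (auto simp: dimn_def)
    moreover have "?r = 1" "u = 0" using iu by (auto simp: mid_def split: if_splits)
    moreover have "z $$ (n + 0, n + 0) = 1" using iu zD by (auto simp: dimn_def)
    ultimately show ?thesis unfolding Psplit using iu by (simp add: C_def block_c_def sum_negf)
  qed
  \<comment> \<open>From row \<open>n\<close> on, the first \<open>n\<close> columns vanish, and
    only the single middle column, if there is one, contributes.\<close>
  have P22: "P i j = gram G n $$ (i, j)" if ij: "n \<le> i" "i < ?m" "n \<le> j" "j < ?m" for i j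
  proof -
    have a: "z $$ (i, t) = 0" "z $$ (j, t) = 0" if "t < n" for t using low that ij by auto
    have "(\<Sum>u<?r. z $$ (i, n + u) * z $$ (j, n + u)) = gram G n $$ (i, j)"
    proof (cases "?r = 1")
      case True
      hence "z $$ (i, n) * z $$ (j, n) = (if i = n \<and> j = n then 1 else 0)"
        using low[of n i] low[of n j] zD(3)[of n] ij by auto
      thus ?thesis using True ij by (auto simp: gram_entry form_sign_def mid_def dimn_def split: if_splits)
    next
      case False
      thus ?thesis using ij mid_cases(1)[of G] by (auto simp: gram_entry dimn_def)
    qed
    thus ?thesis unfolding Psplit using a by simp
  qed
  have Pe: "P i j = (z * gram G n * z\<^sup>T) $$ (i, j)" if "i < ?m" "j < ?m" for i j
    using gram_congruence_entry[OF zD(1) that] by (simp add: P_def)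
  have sym: "P j i = - form_eps G * P i j" if "i < ?m" "j < ?m" for i j
  proof -
    have "(z * gram G n * z\<^sup>T)\<^sup>T = - form_eps G \<cdot>\<^sub>m (z * gram G n * z\<^sup>T)"
      using zD(1)
      by (simp add: mult_carrier_mat[of _ ?m ?m _ ?m] transpose_mult[of _ ?m ?m _ ?m] gram_transpose assoc_mult_mat[of _ ?m ?m _ ?m _ ?m]
          mult_smult_distrib[of _ ?m ?m _ ?m] mult_smult_assoc_mat[of _ ?m ?m _ ?m])
    hence "(z * gram G n * z\<^sup>T)\<^sup>T $$ (i, j) = (- form_eps G \<cdot>\<^sub>m (z * gram G n * z\<^sup>T)) $$ (i, j)"
      by simp
    thus ?thesis using that zD(1)
      by (simp add: Pe del: index_mult_mat(1))
  qed
  have gsym: "gram G n $$ (j, i) = - form_eps G * (gram G n $$ (i, j) :: 'a)" if "i < ?m" "j < ?m" for i j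
  proof -
    have "(gram G n)\<^sup>T $$ (i, j) = (- form_eps G \<cdot>\<^sub>m (gram G n :: 'a mat)) $$ (i, j)"
      by (simp add: gram_transpose)
    thus ?thesis using that by simp
  qed
  have XC: "X \<in> carrier_mat n n" "N \<in> carrier_mat n n" "C \<in> carrier_mat n ?r" "Y \<in> carrier_mat n n"
      "D \<in> carrier_mat n ?r"
    by (simp_all add: X_def N_def C_def Y_def D_def block_carrier)
  have g11: "gram G n $$ (i, j) = (0::'a)" if "i < n" "j < n + ?r" for i j
    using that by (auto simp: gram_entry dimn_def)
  have g13: "gram G n $$ (i, ?m - 1 - b) = (if i = b then 1 else (0::'a))" if "i < n" "b < n" for i b
    using that by (auto simp: gram_entry dimn_def form_sign_def)
  show ?thesis
  proof
    assume iso: "z * gram G n * z\<^sup>T = gram G n"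
    hence Pg: "P i j = gram G n $$ (i, j)" if "i < ?m" "j < ?m" for i j using Pe[OF that] by simp
    have "X * Y = 1\<^sub>m n"
      by (rule eq_matI) (use P13 Pg g13 XC in \<open>auto simp: dimn_def simp del: index_mult_mat(1)\<close>)
    moreover have "C = X * D"
    proof (rule eq_matI, goal_cases)
      case (1 i u)
      hence iu: "i < n" "u < ?r" using XC by auto
      hence "P i (n + u) = 0" using Pg[of i "n + u"] g11[of i "n + u"] by (auto simp: dimn_def)
      thus ?case using P12[OF iu] by simp
    qed (use XC in auto)
    moreover have "X * N\<^sup>T + (- form_eps G) \<cdot>\<^sub>m (N * X\<^sup>T) + C * C\<^sup>T = 0\<^sub>m n n"
    proof (rule eq_matI, goal_cases)
      case (1 i j)
      hence ij: "i < n" "j < n" by auto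
      hence "P i j = 0" using Pg[of i j] g11[of i j] by (auto simp: dimn_def)
      thus ?case unfolding P11[OF ij] using ij by simp
    qed (use XC in auto)
    ultimately show "X * Y = 1\<^sub>m n \<and> C = X * D \<and>
      X * N\<^sup>T + (- form_eps G) \<cdot>\<^sub>m (N * X\<^sup>T) + C * C\<^sup>T = 0\<^sub>m n n" by blast
  next
    assume R: "X * Y = 1\<^sub>m n \<and> C = X * D \<and>
      X * N\<^sup>T + (- form_eps G) \<cdot>\<^sub>m (N * X\<^sup>T) + C * C\<^sup>T = 0\<^sub>m n n"
    have up: "P i j = gram G n $$ (i, j)" if ij: "i < n" "j < ?m" for i j
    proof -
      consider "j < n" | u where "j = n + u" "u < ?r" | b where "j = ?m - 1 - b" "b < n"
      proof -
        have "j < n \<or> (j = n + (j - n) \<and> j - n < ?r) \<or> (j = ?m - 1 - (?m - 1 - j) \<and> ?m - 1 - j < n)"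
          using ij by (auto simp: dimn_def)
        thus ?thesis using that by blast
      qed
      thus ?thesis
      proof cases
        case 1
        show ?thesis unfolding P11[OF ij(1) 1] R[THEN conjunct2, THEN conjunct2] using g11[of i j] ij 1 by simp
      next
        case 2
        show ?thesis using P12[OF ij(1) 2(2)] R g11[of i j] ij 2 by simp
      next
        case 3
        show ?thesis using P13[OF ij(1) 3(2)] R g13[OF ij(1) 3(2)] ij 3 by simp
      qed
    qed
    have all: "P i j = gram G n $$ (i, j)" if ij: "i < ?m" "j < ?m" for i j
    proof -
      consider "i < n" | "j < n" | "n \<le> i" "n \<le> j" by linarith
      thus ?thesis
      proof cases
        case 2
        show ?thesis unfolding sym[OF ij(2,1)] gsym[OF ij(2,1)] up[OF 2 ij(1)] ..
      qed (use up P22 ij in auto)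
    qed
    show "z * gram G n * z\<^sup>T = gram G n"
    proof (rule eq_matI, goal_cases)
      case (1 i j)
      hence "i < ?m" "j < ?m" by (simp_all add: gram_def)
      thus ?case using all Pe by metis
    qed (use zD(1) in auto)
  qed
qed

section \<open>The block parametrisation of U\<close>

lemma antidiag_carrier [simp]: "antidiag n \<in> carrier_mat n n"
  by (simp add: antidiag_def)

lemma antidiag_dim [simp]: "dim_row (antidiag n) = n" "dim_col (antidiag n) = n"
  by (simp_all add: antidiag_def)

lemma antidiag_transpose: "(antidiag n)\<^sup>T = antidiag n"
  by (rule eq_matI) (auto simp: antidiag_def)

lemma mult_antidiag_entry:
  fixes A :: "'a::field mat"
  assumes A: "A \<in> carrier_mat b n" and ij: "i < b" "j < n"
  shows "(A * antidiag n) $$ (i, j) = A $$ (i, n - 1 - j)"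
proof -
  have "(A * antidiag n) $$ (i, j) = (\<Sum>s<n. A $$ (i, s) * antidiag n $$ (s, j))"
    by (rule mat_mult_entry[OF A antidiag_carrier ij])
  also have "\<dots> = (\<Sum>s<n. if s = n - 1 - j then A $$ (i, s) else 0)"
    using ij by (intro sum.cong refl) (auto simp: antidiag_def)
  finally show ?thesis using ij by (simp add: sum.delta)
qed

lemma antidiag_mult_entry:
  fixes A :: "'a::field mat"
  assumes A: "A \<in> carrier_mat n b" and ij: "i < n" "j < b"
  shows "(antidiag n * A) $$ (i, j) = A $$ (n - 1 - i, j)"
proof -
  have "antidiag n * A = (A\<^sup>T * antidiag n)\<^sup>T"
    using A by (simp add: transpose_mult[of _ b n _ n] antidiag_transpose)
  thus ?thesis using mult_antidiag_entry[of "A\<^sup>T" b n j i] A ij by simp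
qed

lemma antidiag_square: "antidiag n * antidiag n = (1\<^sub>m n :: 'a::field mat)"
proof (rule eq_matI, goal_cases)
  case (1 i j)
  hence "(antidiag n * antidiag n) $$ (i, j) = (antidiag n $$ (i, n - 1 - j) :: 'a)"
    using mult_antidiag_entry[OF antidiag_carrier] by simp
  thus ?case using 1 by (auto simp: antidiag_def)
qed (simp_all add: antidiag_def)

lemma block_form_carrier:
  assumes "x \<in> carrier_mat n n" "y \<in> carrier_mat n n"
  shows "block_form n r x y v w \<in> carrier_mat (2 * n + r) (2 * n + r)"
proof -
  have "four_block_mat x (x * v) (0\<^sub>m r n) (1\<^sub>m r) \<in> carrier_mat (n + r) (n + r)"
    using assms by auto
  moreover have "antidiag n * y\<^sup>T * antidiag n \<in> carrier_mat n n"
    using assms by (simp add: mult_carrier_mat[of _ n n _ n])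
  ultimately have "block_form n r x y v w \<in> carrier_mat ((n + r) + n) ((n + r) + n)"
    unfolding block_form_def by (rule four_block_carrier_mat)
  moreover have "(n + r) + n = 2 * n + r" by simp
  ultimately show ?thesis by metis
qed

lemma block_form_entry:
  fixes x y v w :: "'a::field mat"
  assumes x: "x \<in> carrier_mat n n" and y: "y \<in> carrier_mat n n" and v: "v \<in> carrier_mat n r"
    and w: "w \<in> carrier_mat n n"
  defines "z \<equiv> block_form n r x y v w" and "m \<equiv> 2 * n + r"
  shows "\<And>i j. i < n \<Longrightarrow> j < n \<Longrightarrow> z $$ (i, j) = x $$ (i, j)"
    and "\<And>i u. i < n \<Longrightarrow> u < r \<Longrightarrow> z $$ (i, n + u) = (x * v) $$ (i, u)"
    and "\<And>i t. i < n \<Longrightarrow> t < n \<Longrightarrow> z $$ (i, m - 1 - t) = (x * (w * antidiag n)) $$ (i, t)"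
    and "\<And>u j. u < r \<Longrightarrow> j < n \<Longrightarrow> z $$ (n + u, j) = 0"
    and "\<And>u u'. u < r \<Longrightarrow> u' < r \<Longrightarrow> z $$ (n + u, n + u') = (if u = u' then 1 else 0)"
    and "\<And>u t. u < r \<Longrightarrow> t < n \<Longrightarrow> z $$ (n + u, m - 1 - t) = - v $$ (t, u)"
    and "\<And>b j. b < n \<Longrightarrow> j < n + r \<Longrightarrow> z $$ (m - 1 - b, j) = 0"
    and "\<And>b t. b < n \<Longrightarrow> t < n \<Longrightarrow> z $$ (m - 1 - b, m - 1 - t) = y $$ (t, b)"
proof -
  let ?J = "antidiag n :: 'a mat"
  have J: "?J \<in> carrier_mat n n" by (rule antidiag_carrier)
  let ?P = "four_block_mat x (x * v) (0\<^sub>m r n) (1\<^sub>m r)"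
  let ?Q = "x * w @\<^sub>r - (v\<^sup>T * ?J)"
  let ?D = "?J * y\<^sup>T * ?J"
  have P: "?P \<in> carrier_mat (n + r) (n + r)" using x v by auto
  have xw: "x * w \<in> carrier_mat n n" using x w by simp
  have vJ: "v\<^sup>T * ?J \<in> carrier_mat r n" using v J by simp
  have Q: "?Q \<in> carrier_mat (n + r) n" using xw vJ by (intro carrier_append_rows) auto
  have D: "?D \<in> carrier_mat n n" using y J by (simp add: mult_carrier_mat[of _ n n _ n])
  have z0: "z $$ (i, j) = (if i < n + r then if j < n + r then ?P $$ (i, j) else ?Q $$ (i, j - (n + r))
      else if j < n + r then 0\<^sub>m n (n + r) $$ (i - (n + r), j) else ?D $$ (i - (n + r), j - (n + r)))"
    if "i < m" "j < m" for i j
    unfolding z_def block_form_def using that P D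
    by (subst index_mat_four_block(1)) (auto simp: m_def simp del: index_mat_four_block)
  have P0: "?P $$ (i, j) = (if i < n then if j < n then x $$ (i, j) else (x * v) $$ (i, j - n)
      else if j < n then 0\<^sub>m r n $$ (i - n, j) else 1\<^sub>m r $$ (i - n, j - n))"
    if "i < n + r" "j < n + r" for i j
    using that x v by (subst index_mat_four_block(1)) (auto simp del: index_mult_mat(1))
  have Q0: "?Q $$ (i, t) = (if i < n then (x * w) $$ (i, t) else - (v\<^sup>T * ?J) $$ (i - n, t))"
    if "i < n + r" "t < n" for i t
    unfolding append_rows_def using that xw vJ x w v J
    by (subst index_mat_four_block(1)) (auto simp del: index_mult_mat(1))
  show "z $$ (i, j) = x $$ (i, j)" if "i < n" "j < n" for i j
    using that by (subst z0) (auto simp: m_def P0)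
  show "z $$ (i, n + u) = (x * v) $$ (i, u)" if "i < n" "u < r" for i u
    using that by (subst z0) (auto simp: m_def P0 simp del: index_mult_mat(1) index_mat_four_block)
  show "z $$ (i, m - 1 - t) = (x * (w * ?J)) $$ (i, t)" if it: "i < n" "t < n" for i t
  proof -
    have "z $$ (i, m - 1 - t) = ?Q $$ (i, n - 1 - t)"
      using it by (subst z0) (auto simp: m_def simp del: index_mult_mat(1) index_mat_four_block)
    also have "\<dots> = (x * w) $$ (i, n - 1 - t)" using it by (subst Q0) auto
    also have "\<dots> = (x * w * ?J) $$ (i, t)" using mult_antidiag_entry[OF xw it] by simp
    finally show ?thesis using x w J by simp
  qed
  show "z $$ (n + u, j) = 0" if "u < r" "j < n" for u j
    using that by (subst z0) (auto simp: m_def P0 simp del: index_mult_mat(1) index_mat_four_block)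
  show "z $$ (n + u, n + u') = (if u = u' then 1 else 0)" if "u < r" "u' < r" for u u'
    using that by (subst z0) (auto simp: m_def P0 simp del: index_mult_mat(1) index_mat_four_block)
  show "z $$ (n + u, m - 1 - t) = - v $$ (t, u)" if ut: "u < r" "t < n" for u t
  proof -
    have "z $$ (n + u, m - 1 - t) = ?Q $$ (n + u, n - 1 - t)"
      using ut by (subst z0) (auto simp: m_def simp del: index_mult_mat(1) index_mat_four_block)
    also have "\<dots> = - (v\<^sup>T * ?J) $$ (u, n - 1 - t)" using ut by (subst Q0) auto
    also have "(v\<^sup>T * ?J) $$ (u, n - 1 - t) = v\<^sup>T $$ (u, n - 1 - (n - 1 - t))"
      using ut v by (intro mult_antidiag_entry) auto
    finally show ?thesis using ut v by simp
  qed
  show "z $$ (m - 1 - b, j) = 0" if "b < n" "j < n + r" for b j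
    using that by (subst z0) (auto simp: m_def simp del: index_mult_mat(1) index_mat_four_block)
  show "z $$ (m - 1 - b, m - 1 - t) = y $$ (t, b)" if bt: "b < n" "t < n" for b t
  proof -
    have "z $$ (m - 1 - b, m - 1 - t) = ?D $$ (n - 1 - b, n - 1 - t)"
      using bt by (subst z0) (auto simp: m_def simp del: index_mult_mat(1) index_mat_four_block)
    also have "\<dots> = (?J * y\<^sup>T) $$ (n - 1 - b, n - 1 - (n - 1 - t))"
      using bt y J by (intro mult_antidiag_entry) auto
    also have "\<dots> = y\<^sup>T $$ (n - 1 - (n - 1 - b), n - 1 - (n - 1 - t))"
      using bt y by (intro antidiag_mult_entry) auto
    finally show ?thesis using bt y by simp
  qed
qed

lemma dimn_index_cases:
  assumes "i < dimn G n"
  obtains "i < n" | u where "i = n + u" "u < mid G" | b where "i = dimn G n - 1 - b" "b < n"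
proof -
  have "i < n \<or> (i = n + (i - n) \<and> i - n < mid G) \<or> (i = dimn G n - 1 - (dimn G n - 1 - i) \<and> dimn G n - 1 - i < n)"
    using assms by (auto simp: dimn_def)
  thus ?thesis using that by blast
qed

lemma inverts_mat_iff:
  "x \<in> carrier_mat n n \<Longrightarrow> inverts_mat x y \<longleftrightarrow> x * y = 1\<^sub>m n"
  by (simp add: inverts_mat_def)

lemma unitriangular_right_inverse:
  fixes x :: "'a::{field,finite} mat"
  assumes x: "x \<in> unitriangular m" and y: "y \<in> carrier_mat m m" and xy: "x * y = 1\<^sub>m m"
  shows "y \<in> unitriangular m" "y * x = 1\<^sub>m m"
proof -
  obtain y' where y': "y' \<in> unitriangular m" "x * y' = 1\<^sub>m m" "y' * x = 1\<^sub>m m"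
    using unitriangular_inverse[OF x] by blast
  have "y = y'" using unitriangular_left_cancel[OF x y] y' xy unitriangularD(1) by metis
  thus "y \<in> unitriangular m" "y * x = 1\<^sub>m m" using y' by auto
qed

text \<open>The parameters can be read back from the blocks, so that
  \<open>isometry_iff_blocks\<close> becomes a condition on them. The last diagonal block is
  unitriangular because the inverse of \<open>x\<close> is.\<close>

lemma block_form_properties:
  fixes x y v w :: "'a::{field,finite} mat"
  assumes x: "x \<in> unitriangular n" and y: "y \<in> carrier_mat n n" "x * y = 1\<^sub>m n"
    and v: "v \<in> carrier_mat n (mid G)" and w: "w \<in> carrier_mat n n"
  defines "z \<equiv> block_form n (mid G) x y v w"
  shows "z \<in> unitriangular (dimn G n)"
    "block_x n z = x" "block_y G n z = y" "block_d G n z = v" "block_c G n z = x * v"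
    "block_w G n z = x * (w * antidiag n)"
proof -
  note xc = unitriangularD(1)[OF x]
  note be = block_form_entry[OF xc y(1) v w, folded z_def, folded dimn_def]
  have yU: "y \<in> unitriangular n" using unitriangular_right_inverse[OF x y] by blast
  have zc: "z \<in> carrier_mat (dimn G n) (dimn G n)"
    unfolding z_def dimn_def by (rule block_form_carrier[OF xc y(1)])
  show "z \<in> unitriangular (dimn G n)"
  proof (rule unitriangularI[OF zc])
    fix i assume i: "i < dimn G n"
    show "z $$ (i, i) = 1"
      using i by (cases rule: dimn_index_cases) (auto simp del: diff_diff_left One_nat_def simp: be unitriangularD[OF x] unitriangularD[OF yU])
    fix j assume j: "j < i"
    show "z $$ (i, j) = 0"
      using i
    proof (cases rule: dimn_index_cases)
      case 1
      thus ?thesis using j by (simp add: be unitriangularD[OF x])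
    next
      case (2 u)
      hence "u = 0" "j < n" using j by (auto simp: mid_def split: if_splits)
      thus ?thesis using 2(1) be(4)[OF 2(2) \<open>j < n\<close>] by simp
    next
      case (3 b)
      show ?thesis
      proof (cases "j < n + mid G")
        case False
        hence "j = dimn G n - 1 - (dimn G n - 1 - j)" "dimn G n - 1 - j < n" "b < dimn G n - 1 - j"
          using 3 j i by (auto simp: dimn_def)
        thus ?thesis using be(8)[OF 3(2), of "dimn G n - 1 - j"] unitriangularD(2)[OF yU, of b "dimn G n - 1 - j"] 3
          by simp
      qed (use 3 be in simp)
    qed
  qed
  show "block_x n z = x" by (rule eq_matI) (use be xc in \<open>auto simp: block_x_def\<close>)
  show "block_y G n z = y" by (rule eq_matI) (use be y in \<open>auto simp: block_y_def\<close>)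
  show "block_d G n z = v" by (rule eq_matI) (use be v in \<open>auto simp: block_d_def\<close>)
  show "block_c G n z = x * v"
    by (rule eq_matI) (use be xc v in \<open>auto simp: block_c_def simp del: index_mult_mat(1)\<close>)
  show "block_w G n z = x * (w * antidiag n)"
    by (rule eq_matI) (use be xc w in \<open>auto simp: block_w_def antidiag_def simp del: index_mult_mat(1)\<close>)
qed

text \<open>With K = w J the three defining conditions merge into K^T - eps K + v v^T = 0, the
  product v v^T being zero when \<open>v\<close> has no columns.\<close>

lemma block_condition_iff:
  fixes v w :: "'a::field mat"
  assumes v: "v \<in> carrier_mat n (mid G)" and w: "w \<in> carrier_mat n n"
  shows "block_condition G n v w \<longleftrightarrow>
    (w * antidiag n)\<^sup>T + (- form_eps G) \<cdot>\<^sub>m (w * antidiag n) + v * v\<^sup>T = 0\<^sub>m n n"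
proof -
  let ?K = "w * antidiag n"
  have K: "?K \<in> carrier_mat n n" using w by simp
  have KT: "antidiag n * w\<^sup>T = ?K\<^sup>T"
    using w by (simp add: transpose_mult[of _ n n _ n] antidiag_transpose)
  have vv: "v * v\<^sup>T \<in> carrier_mat n n" using v by simp
  have vv0: "v * v\<^sup>T = 0\<^sub>m n n" if "mid G = 0"
    using v that by (intro eq_matI) (auto simp: scalar_prod_def)
  note [simp del] = index_mult_mat(1)
  have e: "block_condition G n v w \<longleftrightarrow>
    (\<forall>i<n. \<forall>j<n. ?K $$ (j, i) + (- form_eps G) * ?K $$ (i, j) + (v * v\<^sup>T) $$ (i, j) = 0)"
  proof (cases G)
    case Sp
    have "block_condition G n v w \<longleftrightarrow> (\<forall>i<n. \<forall>j<n. ?K $$ (j, i) - ?K $$ (i, j) = 0)"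
      using K w by (auto simp: Sp KT mat_eq_iff)
    thus ?thesis using vv0 by (simp add: Sp form_eps_def mid_def)
  next
    case O_even
    have "block_condition G n v w \<longleftrightarrow> (\<forall>i<n. \<forall>j<n. ?K $$ (j, i) + ?K $$ (i, j) = 0)"
      using K w by (auto simp: O_even KT mat_eq_iff)
    thus ?thesis using vv0 by (simp add: O_even form_eps_def mid_def)
  next
    case O_odd
    have "block_condition G n v w \<longleftrightarrow>
      (\<forall>i<n. \<forall>j<n. ?K $$ (j, i) + ?K $$ (i, j) = - (v * v\<^sup>T) $$ (i, j))"
      using K vv v w by (auto simp: O_odd KT mat_eq_iff)
    thus ?thesis by (simp add: O_odd form_eps_def eq_neg_iff_add_eq_0)
  qed
  let ?M = "?K\<^sup>T + (- form_eps G) \<cdot>\<^sub>m ?K + v * v\<^sup>T"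
  have M: "?M \<in> carrier_mat n n" using K vv by simp
  have "?M $$ (i, j) = ?K $$ (j, i) + (- form_eps G) * ?K $$ (i, j) + (v * v\<^sup>T) $$ (i, j)"
    if "i < n" "j < n" for i j
    using that w v by simp
  thus ?thesis unfolding e using carrier_matD[OF M] by (simp add: mat_eq_iff del: assoc_add_mat)
qed

lemma unitriangular_sandwich_zero:
  fixes x :: "'a::{field,finite} mat"
  assumes x: "x \<in> unitriangular n" and A: "A \<in> carrier_mat n n"
  shows "x * A * x\<^sup>T = 0\<^sub>m n n \<longleftrightarrow> A = 0\<^sub>m n n"
proof
  assume L: "x * A * x\<^sup>T = 0\<^sub>m n n"
  obtain y where y: "y \<in> unitriangular n" "x * y = 1\<^sub>m n" "y * x = 1\<^sub>m n"
    using unitriangular_inverse[OF x] by blast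
  note c = unitriangularD(1)[OF x] unitriangularD(1)[OF y(1)]
  have "y * (x * A * x\<^sup>T) * y\<^sup>T = (y * x) * A * (y * x)\<^sup>T"
    using c A by (simp add: transpose_mult[of _ n n _ n] assoc_mult_mat[of _ n n _ n _ n])
  also have "\<dots> = A" using A y by simp
  finally show "A = 0\<^sub>m n n" using L c by simp
qed (use unitriangularD(1)[OF x] A in simp)

text \<open>After the substitutions N = x K and C = x v, where K = w J, the last condition of
  \<open>isometry_iff_blocks\<close> becomes x (K^T - eps K + v v^T) x^T = 0. The unitriangular
  factors cancel, and what remains is the block condition.\<close>

lemma U_set_iff:
  "z \<in> U_set G n \<longleftrightarrow>
    z \<in> unitriangular (dimn G n) \<and> z * gram G n * z\<^sup>T = (gram G n :: 'a::{field,finite} mat)"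
proof -
  let ?J = "antidiag n :: 'a mat"
  have key: "x * (x * K)\<^sup>T + (- form_eps G) \<cdot>\<^sub>m (x * K * x\<^sup>T) + (x * v) * (x * v)\<^sup>T
    = x * (K\<^sup>T + (- form_eps G) \<cdot>\<^sub>m K + v * v\<^sup>T) * x\<^sup>T"
    if "x \<in> carrier_mat n n" "K \<in> carrier_mat n n" "v \<in> carrier_mat n (mid G)" for x K v :: "'a mat"
  proof -
    let ?r = "mid G"
    have 1: "x * v * (x * v)\<^sup>T = x * (v * v\<^sup>T) * x\<^sup>T"
    proof -
      have t: "v\<^sup>T * x\<^sup>T \<in> carrier_mat ?r n" using that by simp
      show ?thesis
        using that t assoc_mult_mat[OF that(1,3) t] assoc_mult_mat[of v n ?r "v\<^sup>T" n "x\<^sup>T" n]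
          assoc_mult_mat[of x n n "v * v\<^sup>T" n "x\<^sup>T" n]
        by (simp add: transpose_mult[of _ n n _ ?r])
    qed
    have 2: "x * (x * K)\<^sup>T = x * K\<^sup>T * x\<^sup>T"
      using that by (simp add: transpose_mult[of _ n n _ n] assoc_mult_mat[of _ n n _ n _ n])
    have vv: "v * v\<^sup>T \<in> carrier_mat n n" using that by simp
    have sK: "(- form_eps G) \<cdot>\<^sub>m K \<in> carrier_mat n n" "K\<^sup>T \<in> carrier_mat n n" using that by auto
    have vv': "x * (v * v\<^sup>T) * x\<^sup>T \<in> carrier_mat n n"
      using that vv by (simp add: mult_carrier_mat[of _ n n _ n])
    show ?thesis unfolding 1 2 using that vv vv' sK
      by (simp add: assoc_add_mat[of _ n n] mult_carrier_mat[of _ n n _ n] mult_add_distrib_mat[of _ n n _ n] add_mult_distrib_mat[of _ n n _ _ n]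
          mult_smult_distrib[of _ n n _ n] mult_smult_assoc_mat[of _ n n _ n])
  qed
  show ?thesis
  proof
    assume "z \<in> U_set G n"
    then obtain x y v w where z: "z = block_form n (mid G) x y v w"
      and x: "x \<in> unitriangular n" and y: "y \<in> carrier_mat n n" "inverts_mat x y"
      and v: "v \<in> carrier_mat n (mid G)" and w: "w \<in> carrier_mat n n" and bc: "block_condition G n v w"
      unfolding U_set_def by blast
    note xc = unitriangularD(1)[OF x]
    have xy: "x * y = 1\<^sub>m n" using y inverts_mat_iff[OF xc] by blast
    note bp = block_form_properties[OF x y(1) xy v w, folded z]
    have K: "w * ?J \<in> carrier_mat n n" using w by simp
    have "z * gram G n * z\<^sup>T = gram G n"
      unfolding isometry_iff_blocks[OF bp(1)] bp(2-) key[OF xc K v]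
      using xy bc[unfolded block_condition_iff[OF v w]] xc by simp
    thus "z \<in> unitriangular (dimn G n) \<and> z * gram G n * z\<^sup>T = gram G n" using bp(1) by blast
  next
    assume R: "z \<in> unitriangular (dimn G n) \<and> z * gram G n * z\<^sup>T = gram G n"
    define x y v where "x = block_x n z" and "y = block_y G n z" and "v = block_d G n z"
    \<comment> \<open>Solves x w J = N, because J is an involution and \<open>y\<close> is the
      inverse of \<open>x\<close>.\<close>
    define w where "w = y * block_w G n z * ?J"
    have x: "x \<in> unitriangular n" using R block_x_unitriangular x_def by blast
    note xc = unitriangularD(1)[OF x]
    have y: "y \<in> carrier_mat n n" and v: "v \<in> carrier_mat n (mid G)" by (simp_all add: y_def v_def block_carrier)
    have N: "block_w G n z \<in> carrier_mat n n" by (rule block_carrier)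
    have w: "w \<in> carrier_mat n n" unfolding w_def using y N by (simp add: mult_carrier_mat[of _ n n _ n])
    have I: "x * y = 1\<^sub>m n" "block_c G n z = x * v"
      "x * (block_w G n z)\<^sup>T + (- form_eps G) \<cdot>\<^sub>m (block_w G n z * x\<^sup>T)
        + block_c G n z * (block_c G n z)\<^sup>T = 0\<^sub>m n n"
      unfolding x_def y_def v_def using R isometry_iff_blocks[of z G n] by blast+
    have yx: "y * x = 1\<^sub>m n" using unitriangular_right_inverse(2)[OF x y I(1)] .
    have wJ: "w * ?J = y * block_w G n z"
      unfolding w_def using y N
      by (simp add: assoc_mult_mat[of _ n n _ n _ n] antidiag_square)
    have N': "block_w G n z = x * (w * ?J)"
      unfolding wJ using xc y N I(1) assoc_mult_mat[OF xc y N] by simp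
    have K: "w * ?J \<in> carrier_mat n n" using w by simp
    have T: "(w * ?J)\<^sup>T + (- form_eps G) \<cdot>\<^sub>m (w * ?J) + v * v\<^sup>T \<in> carrier_mat n n"
      using K v by simp
    have bc: "block_condition G n v w"
      unfolding block_condition_iff[OF v w]
      using I(3)[unfolded N' I(2) key[OF xc K v]] unitriangular_sandwich_zero[OF x T] by blast
    have "z = block_form n (mid G) x y v w"
    proof (rule eq_matI, goal_cases)
      case (1 i j)
      let ?z' = "block_form n (mid G) x y v w"
      note be = block_form_entry[OF xc y v w, folded dimn_def]
      note zD = unitriangularD[of z "dimn G n", OF R[THEN conjunct1]]
      have z'U: "?z' \<in> unitriangular (dimn G n)" by (rule block_form_properties(1)[OF x y I(1) v w])
      note z'D = unitriangularD[OF z'U]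
      have ij: "i < dimn G n" "j < dimn G n" using 1 z'D(1) by auto
      have Ce: "z $$ (i, n + u) = (x * v) $$ (i, u)" if "i < n" "u < mid G" for i u
        using I(2)[symmetric] that by (simp add: block_c_def)
      have Ne: "z $$ (i, dimn G n - 1 - t) = (x * (w * ?J)) $$ (i, t)" if "i < n" "t < n" for i t
        using N'[symmetric] that by (simp add: block_w_def)
      show ?case
        using ij(1)
      proof (cases rule: dimn_index_cases)
        case 1
        from ij(2) show ?thesis
          by (cases rule: dimn_index_cases)
            (use 1 be Ce Ne in \<open>auto simp: x_def block_x_def simp del: index_mult_mat(1)\<close>)
      next
        case (2 u)
        have u: "u = 0" using 2 by (auto simp: mid_def split: if_splits)
        from ij(2) show ?thesis
        proof (cases rule: dimn_index_cases)
          case 1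
          thus ?thesis using zD(2)[of j i] z'D(2)[of j i] 2 ij by simp
        next
          case (2 u')
          hence "u' = 0" by (auto simp: mid_def split: if_splits)
          thus ?thesis using zD(3)[OF ij(1)] z'D(3)[OF ij(1)] 2 \<open>i = n + u\<close> u by simp
        next
          case (3 t)
          thus ?thesis using be(6)[OF 2(2) 3(2)] 2 by (simp add: v_def block_d_def)
        qed
      next
        case (3 b)
        from ij(2) show ?thesis
        proof (cases rule: dimn_index_cases)
          case 1
          thus ?thesis using zD(2)[of j i] z'D(2)[of j i] 3 ij by (simp add: dimn_def)
        next
          case (2 u)
          hence "j < i" using 3 by (simp add: dimn_def)
          thus ?thesis using zD(2)[of j i] z'D(2)[of j i] ij by simp
        next
          case (3 t)
          thus ?thesis using be(8)[OF \<open>b < n\<close> 3(2)] \<open>i = dimn G n - 1 - b\<close> \<open>b < n\<close>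
            by (simp add: y_def block_y_def)
        qed
      qed
    qed (use R unitriangularD(1)[of z] block_form_carrier[OF xc y, of "mid G" v w] in \<open>auto simp: dimn_def\<close>)
    moreover have "inverts_mat x y" "inverts_mat y x" using I(1) yx xc y by (simp_all add: inverts_mat_iff)
    ultimately show "z \<in> U_set G n" unfolding U_set_def using x y v w bc by blast
  qed
qed

text \<open>Of the parameters of U, \<open>x\<close> and \<open>v\<close> are free and only
  \<open>w\<close> is constrained. Hence the first \<open>n\<close> rows can be prescribed up to
  column \<open>n + mid G\<close>, which is all that the conditions defining \<open>U_root\<close>
  test.\<close>

lemma U_set_matches_upper_left:
  fixes g :: "'a::{field,finite} mat"
  assumes two: "(2::'a) \<noteq> 0" and g: "g \<in> unitriangular (dimn G n)"
  obtains z where "z \<in> U_set G n" "\<And>i c. i < n \<Longrightarrow> c < n + mid G \<Longrightarrow> z $$ (i, c) = g $$ (i, c)"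
proof -
  let ?J = "antidiag n :: 'a mat"
  define x where "x = block_x n g"
  have x: "x \<in> unitriangular n" using block_x_unitriangular[OF g] x_def by simp
  obtain y where y: "y \<in> unitriangular n" "x * y = 1\<^sub>m n" "y * x = 1\<^sub>m n"
    using unitriangular_inverse[OF x] by blast
  note xc = unitriangularD(1)[OF x] and yc = unitriangularD(1)[OF y(1)]
  define v where "v = y * block_c G n g"
  have C: "block_c G n g \<in> carrier_mat n (mid G)" by (rule block_carrier)
  have v: "v \<in> carrier_mat n (mid G)" unfolding v_def using yc C by simp
  \<comment> \<open>The symmetric solution of K^T + K = - v v^T, with K = w J; it is zero when there
    is no middle column.\<close>
  define w where "w = ((- 1 / 2) \<cdot>\<^sub>m (v * v\<^sup>T)) * ?J"
  have vv: "v * v\<^sup>T \<in> carrier_mat n n" using v by simp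
  have w: "w \<in> carrier_mat n n" unfolding w_def using vv by (simp add: mult_carrier_mat[of _ n n _ n])
  have wJ: "w * ?J = (- 1 / 2) \<cdot>\<^sub>m (v * v\<^sup>T)"
    unfolding w_def using vv right_mult_one_mat[of "(- 1 / 2) \<cdot>\<^sub>m (v * v\<^sup>T)" n n]
    by (simp add: assoc_mult_mat[of _ n n _ n _ n] antidiag_square)
  have vvT: "(v * v\<^sup>T) $$ (j, i) = (v * v\<^sup>T) $$ (i, j)" if "i < n" "j < n" for i j
    using that v by (simp add: comm_scalar_prod[of _ "mid G"])
  have vv0: "v * v\<^sup>T = 0\<^sub>m n n" if "mid G = 0"
    using v that by (intro eq_matI) (auto simp: scalar_prod_def)
  have bc: "block_condition G n v w"
    unfolding block_condition_iff[OF v w] wJ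
  proof (rule eq_matI, goal_cases)
    case (1 i j)
    show ?case
    proof (cases "mid G = 0")
      case False
      hence "form_eps G = (-1::'a)" by (auto simp: form_eps_def mid_def split: if_splits)
      thus ?thesis using 1 v vv vvT[of i j] two by (simp del: index_mult_mat(1) add: field_simps)
    qed (use 1 vv0 in simp)
  qed (use vv in auto)
  define z where "z = block_form n (mid G) x y v w"
  have "inverts_mat x y" "inverts_mat y x" using xc yc y by (simp_all add: inverts_mat_iff)
  hence "z \<in> U_set G n" unfolding U_set_def z_def using x yc v w bc by blast
  moreover have "z $$ (i, c) = g $$ (i, c)" if ic: "i < n" "c < n + mid G" for i c
  proof (cases "c < n")
    case True
    thus ?thesis unfolding z_def using block_form_entry(1)[OF xc yc v w ic(1) True] ic
      by (simp add: x_def block_x_def)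
  next
    case False
    then obtain u where u: "c = n + u" "u < mid G" using ic by (metis le_add_diff_inverse nat_add_left_cancel_less not_le)
    have "x * v = block_c G n g"
      unfolding v_def using xc yc C y(2) assoc_mult_mat[OF xc yc C] by simp
    thus ?thesis unfolding z_def u(1) using block_form_entry(2)[OF xc yc v w ic(1) u(2)] ic u
      by (simp add: block_c_def)
  qed
  ultimately show ?thesis using that by blast
qed

section \<open>The Cayley transform\<close>

lemma gram_orthogonal:
  "gram G n * (gram G n)\<^sup>T = (1\<^sub>m (dimn G n) :: 'a::field mat)"
  "(gram G n)\<^sup>T * gram G n = (1\<^sub>m (dimn G n) :: 'a::field mat)"
proof -
  let ?m = "dimn G n"
  have "(A * gram G n * (gram G n)\<^sup>T) = A" if A: "A \<in> carrier_mat ?m ?m" for A :: "'a mat"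
  proof (rule eq_matI, goal_cases)
    case (1 i j)
    hence ij: "i < ?m" "j < ?m" using A by auto
    have bj: "?m - 1 - j < ?m" "?m - 1 - (?m - 1 - j) = j" using ij by auto
    have AO: "A * gram G n \<in> carrier_mat ?m ?m" using A by (simp add: mult_carrier_mat[of _ ?m ?m _ ?m])
    have "(A * gram G n * (gram G n)\<^sup>T) $$ (i, j) =
      - form_eps G * (A * gram G n * gram G n) $$ (i, j)"
      using A ij AO by (simp add: gram_transpose mult_smult_distrib[of _ ?m ?m _ ?m] del: index_mult_mat(1))
    also have "\<dots> = (- form_eps G * form_sign G n (?m - 1 - j)) * (A $$ (i, j) * form_sign G n j)"
      using mult_gram_entry[OF AO ij] mult_gram_entry[OF A ij(1) bj(1)] bj(2)
      by (simp del: index_mult_mat(1) diff_diff_left)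
    also have "\<dots> = A $$ (i, j)"
    proof -
      have "form_eps G * form_eps G = (1::'a)" by (simp add: form_eps_def)
      hence "(- form_eps G * form_sign G n (?m - 1 - j)) * (A $$ (i, j) * form_sign G n j)
        = (form_sign G n j * form_sign G n j) * A $$ (i, j)"
        unfolding form_sign_bar[OF ij(2)] by (simp add: mult_ac)
      thus ?thesis by (simp add: form_sign_square)
    qed
    finally show ?case .
  qed (use A in auto)
  from this[of "1\<^sub>m ?m"] show 1: "gram G n * (gram G n)\<^sup>T = (1\<^sub>m ?m :: 'a mat)" by simp
  show "(gram G n)\<^sup>T * gram G n = (1\<^sub>m ?m :: 'a mat)"
    using 1 by (simp add: gram_transpose mult_smult_distrib[of _ ?m ?m _ ?m] mult_smult_assoc_mat[of _ ?m ?m _ ?m])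
qed

lemma gram_conj_entry:
  fixes A :: "'a::field mat"
  assumes A: "A \<in> carrier_mat (dimn G n) (dimn G n)" and ij: "i < dimn G n" "j < dimn G n"
  shows "(gram G n * A * (gram G n)\<^sup>T) $$ (i, j) =
    form_sign G n i * A $$ (dimn G n - 1 - i, dimn G n - 1 - j) * form_sign G n j"
proof -
  let ?m = "dimn G n"
  have b: "?m - 1 - i < ?m" "?m - 1 - j < ?m" using ij by auto
  have s: "(\<Sum>b<?m. gram G n $$ (i, b) * f b) = form_sign G n i * f (?m - 1 - i)" if "i < ?m" for i and f :: "nat \<Rightarrow> 'a"
  proof -
    have "(\<Sum>b<?m. gram G n $$ (i, b) * f b) = (\<Sum>b<?m. if b = ?m - 1 - i then form_sign G n i * f b else 0)"
      using that by (intro sum.cong refl) (auto simp: gram_entry)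
    thus ?thesis using that by (simp add: sum.delta)
  qed
  show ?thesis
    unfolding congruence_entry[OF gram_carrier A ij] s[OF ij(1)] s[OF ij(2)] by (simp add: mult_ac)
qed

text \<open>Conjugation by an anti-diagonal matrix reverses the order of the index set and so
  exchanges lower and upper unitriangular matrices. On the diagonal the signs occur squared.\<close>

lemma gram_conj_unitriangular:
  fixes v :: "'a::field mat"
  assumes v: "v\<^sup>T \<in> unitriangular (dimn G n)"
  shows "gram G n * v * (gram G n)\<^sup>T \<in> unitriangular (dimn G n)"
proof (rule unitriangularI, goal_cases)
  let ?m = "dimn G n"
  have vc: "v \<in> carrier_mat ?m ?m" using unitriangularD(1)[OF v] by simp
  have vT: "v $$ (j, i) = v\<^sup>T $$ (i, j)" if "i < ?m" "j < ?m" for i j using vc that by simp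
  {
    case 1
    show ?case using vc by (simp add: mult_carrier_mat[of _ ?m ?m _ ?m])
  next
    case (2 i j)
    hence ij: "i < ?m" "j < ?m" by auto
    have b: "?m - 1 - i < ?m - 1 - j" "?m - 1 - j < ?m" "?m - 1 - i < ?m" using 2 by auto
    have "v $$ (?m - 1 - i, ?m - 1 - j) = 0"
      using unitriangularD(2)[OF v b(1,2)] vT[OF b(2,3)] by simp
    thus ?case unfolding gram_conj_entry[OF vc ij] by simp
  next
    case (3 i)
    have b: "?m - 1 - i < ?m" using 3 by auto
    have "v $$ (?m - 1 - i, ?m - 1 - i) = 1"
      using unitriangularD(3)[OF v b] vT[OF b b] by simp
    thus ?case unfolding gram_conj_entry[OF vc 3 3] by (simp add: form_sign_square)
  }
qed

text \<open>\<open>cayley G n x\<close> is the Cayley transform \<open>2 (x - 1) (x + 1)\<^sup>-\<^sup>1\<close> of \<open>x\<close> times the Gram matrix.\<close>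

definition halfsum :: "nat \<Rightarrow> 'a::field mat \<Rightarrow> 'a mat" where
  "halfsum m x = (1 / 2) \<cdot>\<^sub>m (x + 1\<^sub>m m)"

definition cayley :: "group_type \<Rightarrow> nat \<Rightarrow> 'a::field mat \<Rightarrow> 'a mat" where
  "cayley G n x = (THE b. b \<in> carrier_mat (dimn G n) (dimn G n) \<and>
     halfsum (dimn G n) x * b = (x - 1\<^sub>m (dimn G n)) * gram G n)"

text \<open>The diagonal of x + 1 is constantly 2. Halving it keeps the calculation inside the
  unitriangular group and accounts for the factor 2 of the Cayley transform.\<close>

lemma halfsum_unitriangular:
  assumes "(2::'a::field) \<noteq> 0" "x \<in> unitriangular m"
  shows "halfsum m x \<in> (unitriangular m :: 'a mat set)"
  by (rule unitriangularI) (use assms unitriangularD[OF assms(2)] in \<open>auto simp: halfsum_def\<close>)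

context
  fixes G :: group_type and n m :: nat
  assumes m: "m = dimn G n"
begin

private lemma gram_m [simp]: "gram G n \<in> carrier_mat m m"
  by (simp add: m)

private lemmas square_simps =
  mult_carrier_mat[of _ m m _ m] assoc_mult_mat[of _ m m _ m _ m]
  add_mult_distrib_mat[of _ m m _ _ m] mult_add_distrib_mat[of _ m m _ m]
  minus_mult_distrib_mat[of _ m m _ _ m] mult_minus_distrib_mat[of _ m m _ m]
  mult_smult_distrib[of _ m m _ m] mult_smult_assoc_mat[of _ m m _ m]
  left_mult_one_mat[of _ m m] right_mult_one_mat[of _ m m]
  transpose_mult[of _ m m _ m] transpose_add[of _ m m] transpose_minus[of _ m m]

text \<open>The defining equation is a unitriangular linear system and has exactly one solution. The
  third part is how Cayley transforms are recognised below.\<close>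

lemma cayley_props:
  fixes x :: "'a::{field,finite} mat"
  assumes two: "(2::'a) \<noteq> 0" and x: "x \<in> unitriangular m"
  shows "cayley G n x \<in> carrier_mat m m" "halfsum m x * cayley G n x = (x - 1\<^sub>m m) * gram G n"
    and "\<And>b. b \<in> carrier_mat m m \<Longrightarrow> halfsum m x * b = (x - 1\<^sub>m m) * gram G n \<Longrightarrow> cayley G n x = b"
proof -
  let ?K = "halfsum m x"
  have K: "?K \<in> unitriangular m" by (rule halfsum_unitriangular[OF two x])
  obtain L where L: "L \<in> unitriangular m" "?K * L = 1\<^sub>m m" using unitriangular_inverse[OF K] by blast
  note c = unitriangularD(1)[OF K] unitriangularD(1)[OF L(1)] unitriangularD(1)[OF x]
  let ?N = "(x - 1\<^sub>m m) * gram G n"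
  have N: "?N \<in> carrier_mat m m" using c by (simp add: mult_carrier_mat[of _ m m _ m] minus_carrier_mat)
  have "?K * (L * ?N) = ?N"
    using assoc_mult_mat[OF c(1,2) N] L(2) N by simp
  hence ex: "L * ?N \<in> carrier_mat m m \<and> ?K * (L * ?N) = ?N"
    using c N by (simp add: mult_carrier_mat[of _ m m _ m])
  have uniq: "b = b'" if "b \<in> carrier_mat m m" "?K * b = ?N" "b' \<in> carrier_mat m m" "?K * b' = ?N" for b b'
    using unitriangular_left_cancel[OF K that(1,3)] that by simp
  have "\<exists>!b. b \<in> carrier_mat m m \<and> ?K * b = ?N" using ex uniq by blast
  from theI'[OF this]
  show 1: "cayley G n x \<in> carrier_mat m m" "?K * cayley G n x = ?N"
    unfolding cayley_def m by blast+
  show "cayley G n x = b" if "b \<in> carrier_mat m m" "?K * b = ?N" for b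
    using uniq[OF 1 that] .
qed

text \<open>x - 1 is strictly upper triangular and Omega reverses its columns, so their product
  lives strictly above the anti-diagonal. The unitriangular factor on the left only adds lower rows
  to higher ones and creates nothing outside this region.\<close>

lemma cayley_support:
  fixes x :: "'a::{field,finite} mat"
  assumes two: "(2::'a) \<noteq> 0" and x: "x \<in> unitriangular m"
    and ij: "i < m" "j < m" "m \<le> i + j + 1"
  shows "cayley G n x $$ (i, j) = 0"
proof -
  let ?K = "halfsum m x" and ?N = "(x - 1\<^sub>m m) * gram G n"
  have K: "?K \<in> unitriangular m" by (rule halfsum_unitriangular[OF two x])
  obtain L where L: "L \<in> unitriangular m" "L * ?K = 1\<^sub>m m" using unitriangular_inverse[OF K] by blast
  note c = unitriangularD(1)[OF K] unitriangularD(1)[OF L(1)] unitriangularD(1)[OF x]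
  note cp = cayley_props[OF two x]
  have N: "?N \<in> carrier_mat m m" using c by (simp add: mult_carrier_mat[of _ m m _ m] minus_carrier_mat)
  have "cayley G n x = (L * ?K) * cayley G n x" using L(2) cp(1) by simp
  also have "\<dots> = L * ?N" using assoc_mult_mat[OF c(2,1) cp(1)] cp(2) by simp
  finally have e: "cayley G n x = L * ?N" .
  have xc: "x - 1\<^sub>m m \<in> carrier_mat m m" using c by (simp add: minus_carrier_mat)
  have "?N $$ (s, j) = 0" if "s < m" "m - 1 - j \<le> s" for s
  proof -
    have "(x - 1\<^sub>m m) $$ (s, m - 1 - j) = 0"
      using that ij c unitriangularD[OF x] by (cases "s = m - 1 - j") auto
    thus ?thesis using mult_gram_entry[of "x - 1\<^sub>m m" m G n s j] xc that ij by (simp add: m)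
  qed
  thus ?thesis unfolding e using zero_suffix_left_mult[OF L(1) N _ ij(2,1), of "m - 1 - j"] ij by simp
qed

text \<open>For K = (x + 1)/2 the relation x Omega x^T = Omega gives K b K^T = (x Omega - Omega
  x^T)/2. The right-hand side is eps-symmetric by \<open>gram_transpose\<close>, and K can be
  cancelled.\<close>

lemma cayley_eps_symmetric:
  fixes x :: "'a::{field,finite} mat"
  assumes two: "(2::'a) \<noteq> 0" and xU: "x \<in> U_set G n"
  shows "eps_symmetric m (form_eps G) (cayley G n x)"
proof -
  have x: "x \<in> unitriangular m" and iso: "x * gram G n * x\<^sup>T = gram G n"
    using xU by (simp_all add: U_set_iff m)
  let ?K = "halfsum m x" and ?b = "cayley G n x" and ?O = "gram G n :: 'a mat" and ?e = "form_eps G :: 'a"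
  have K: "?K \<in> unitriangular m" by (rule halfsum_unitriangular[OF two x])
  note c = unitriangularD(1)[OF K] unitriangularD(1)[OF x]
  note cp = cayley_props[OF two x]
  define Y where "Y = x * ?O - ?O * x\<^sup>T"
  have Y: "Y \<in> carrier_mat m m" unfolding Y_def using c by (simp add: square_simps minus_carrier_mat)
  have iso': "x * (?O * x\<^sup>T) = ?O" using iso c by (simp add: square_simps)
  have "?K * ?b * ?K\<^sup>T = (x - 1\<^sub>m m) * ?O * ?K\<^sup>T" by (simp add: cp(2))
  also have "\<dots> = (1 / 2) \<cdot>\<^sub>m Y"
  proof -
    have "?K\<^sup>T = (1 / 2) \<cdot>\<^sub>m (x\<^sup>T + 1\<^sub>m m)"
      using c by (auto simp: halfsum_def)
    moreover have "(x - 1\<^sub>m m) * ?O * (x\<^sup>T + 1\<^sub>m m) = Y"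
    proof -
      have "(x - 1\<^sub>m m) * ?O = x * ?O - ?O" using c by (simp add: square_simps)
      moreover have xO: "x * ?O - ?O \<in> carrier_mat m m" using c by (simp add: square_simps minus_carrier_mat)
      have "(x * ?O - ?O) * (x\<^sup>T + 1\<^sub>m m) = (x * ?O - ?O) * x\<^sup>T + (x * ?O - ?O)"
        using c xO by (simp add: mult_add_distrib_mat[of _ m m _ m] right_mult_one_mat[of _ m m])
      moreover have "(x * ?O - ?O) * x\<^sup>T = ?O - ?O * x\<^sup>T"
        using c iso' by (simp add: square_simps)
      moreover have "?O - ?O * x\<^sup>T + (x * ?O - ?O) = Y"
        unfolding Y_def using c by (intro eq_matI) (auto simp del: index_mult_mat(1) simp: m)
      ultimately show ?thesis by simp
    qed
    ultimately show ?thesis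
      using c by (simp add: mult_smult_distrib[of _ m m _ m] mult_carrier_mat[of _ m m _ m] minus_carrier_mat)
  qed
  finally have KbK: "?K * ?b * ?K\<^sup>T = (1 / 2) \<cdot>\<^sub>m Y" .
  have YT: "Y\<^sup>T = ?e \<cdot>\<^sub>m Y"
  proof -
    have "Y\<^sup>T = ?O\<^sup>T * x\<^sup>T - x * ?O\<^sup>T"
      unfolding Y_def using c by (simp add: square_simps)
    also have "\<dots> = ?e \<cdot>\<^sub>m Y"
      unfolding Y_def gram_transpose using c
      by (simp add: square_simps) (intro eq_matI; auto simp del: index_mult_mat(1) simp: algebra_simps m)
    finally show ?thesis .
  qed
  have KbKc: "?K * ?b * ?K\<^sup>T \<in> carrier_mat m m" using c cp(1) by (simp add: square_simps)
  have "?K * ?b\<^sup>T * ?K\<^sup>T = (?K * ?b * ?K\<^sup>T)\<^sup>T"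
    using c cp(1) by (simp add: square_simps)
  also have "\<dots> = ?e \<cdot>\<^sub>m (?K * ?b * ?K\<^sup>T)"
  proof -
    have "((1 / 2) \<cdot>\<^sub>m Y)\<^sup>T = (1 / 2) \<cdot>\<^sub>m Y\<^sup>T" by auto
    also have "\<dots> = ?e \<cdot>\<^sub>m ((1 / 2) \<cdot>\<^sub>m Y)" unfolding YT by (intro eq_matI) auto
    finally show ?thesis unfolding KbK .
  qed
  also have "\<dots> = ?K * (?e \<cdot>\<^sub>m ?b) * ?K\<^sup>T"
    using c cp(1) by (simp add: square_simps)
  finally have E: "?K * ?b\<^sup>T * ?K\<^sup>T = ?K * (?e \<cdot>\<^sub>m ?b) * ?K\<^sup>T" .
  let ?D = "?b\<^sup>T - ?e \<cdot>\<^sub>m ?b"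
  have D: "?D \<in> carrier_mat m m" using cp(1) by (simp add: minus_carrier_mat)
  have "?K * ?D * ?K\<^sup>T = ?K * ?b\<^sup>T * ?K\<^sup>T - ?K * (?e \<cdot>\<^sub>m ?b) * ?K\<^sup>T"
    using c cp(1) by (simp add: mult_carrier_mat[of _ m m _ m]
       minus_mult_distrib_mat[of _ m m _ _ m] mult_minus_distrib_mat[of _ m m _ m])
  also have "\<dots> = 0\<^sub>m m m"
    unfolding E using c cp(1)
    by (intro minus_r_inv_mat) (simp add: mult_carrier_mat[of _ m m _ m])
  finally have D0: "?D = 0\<^sub>m m m" using unitriangular_sandwich_zero[OF K D] by simp
  have "?b $$ (j, i) = ?e * ?b $$ (i, j)" if "i < m" "j < m" for i j
  proof -
    have "?D $$ (i, j) = 0" using D0 that by simp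
    thus ?thesis using that cp(1) by simp
  qed
  thus ?thesis unfolding eps_symmetric_def using cp(1) by blast
qed

text \<open>An isometry y satisfies y^(-1) Omega = Omega y^T, which turns the right factor of the
  conjugation into a transpose.\<close>

lemma cayley_conj:
  fixes x :: "'a::{field,finite} mat"
  assumes two: "(2::'a) \<noteq> 0" and x: "x \<in> unitriangular m"
    and yU: "y \<in> U_set G n" and y': "y' \<in> unitriangular m" "y * y' = 1\<^sub>m m" "y' * y = 1\<^sub>m m"
  shows "cayley G n (y * x * y') = y * cayley G n x * y\<^sup>T"
proof -
  have y: "y \<in> unitriangular m" and iso: "y * gram G n * y\<^sup>T = gram G n"
    using yU by (simp_all add: U_set_iff m)
  let ?K = "halfsum m x" and ?b = "cayley G n x" and ?O = "gram G n :: 'a mat"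
  have K: "?K \<in> unitriangular m" by (rule halfsum_unitriangular[OF two x])
  note c = unitriangularD(1)[OF K] unitriangularD(1)[OF x] unitriangularD(1)[OF y] unitriangularD(1)[OF y'(1)]
  note cp = cayley_props[OF two x]
  have z: "y * x * y' \<in> unitriangular m" using mult_unitriangular x y y' by blast
  have cancel: "y' * (y * A) = A" if "A \<in> carrier_mat m m" for A
    using assoc_mult_mat[OF c(4,3) that] y'(3) that by simp
  have Kz: "halfsum m (y * x * y') = y * ?K * y'"
    unfolding halfsum_def using c y'(2)
    by (simp add: square_simps)
  have Nz: "y * x * y' - 1\<^sub>m m = y * (x - 1\<^sub>m m) * y'"
    using c y'(2) by (simp add: square_simps)
  have xN: "x - 1\<^sub>m m \<in> carrier_mat m m" using c by (simp add: minus_carrier_mat)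
  have iso': "y * (?O * y\<^sup>T) = ?O" using iso c by (simp add: square_simps)
  have "halfsum m (y * x * y') * (y * ?b * y\<^sup>T) = y * (?K * ?b) * y\<^sup>T"
    unfolding Kz using c cp(1)
    by (simp add: mult_carrier_mat[of _ m m _ m] assoc_mult_mat[of _ m m _ m _ m] cancel)
  also have "\<dots> = y * (x - 1\<^sub>m m) * y' * (y * ?O * y\<^sup>T)"
    unfolding cp(2) using c xN
    by (simp add: mult_carrier_mat[of _ m m _ m] assoc_mult_mat[of _ m m _ m _ m] cancel)
  also have "\<dots> = (y * x * y' - 1\<^sub>m m) * ?O" unfolding Nz iso ..
  finally show ?thesis
    using c cp(1) by (intro cayley_props(3)[OF two z]) (auto simp: mult_carrier_mat[of _ m m _ m])
qed

text \<open>The matrix \<open>a = b \<Omega>\<^sup>T\<close>, with \<open>b = cayley G n x\<close> and \<open>\<Omega>\<close> the Gram matrix, is a rational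
  function of \<open>x\<close> and so commutes with \<open>x\<close>.\<close>

lemma cayley_commute:
  fixes x :: "'a::{field,finite} mat"
  assumes two: "(2::'a) \<noteq> 0" and x: "x \<in> unitriangular m"
  defines "a \<equiv> cayley G n x * (gram G n)\<^sup>T"
  shows "a \<in> carrier_mat m m" "halfsum m x * a = x - 1\<^sub>m m" "a * halfsum m x = x - 1\<^sub>m m"
    and "\<And>i j. i < m \<Longrightarrow> j < m \<Longrightarrow> a $$ (i, j) = cayley G n x $$ (i, m - 1 - j) * form_sign G n j"
proof -
  let ?K = "halfsum m x" and ?b = "cayley G n x" and ?O = "gram G n :: 'a mat"
  have K: "?K \<in> unitriangular m" by (rule halfsum_unitriangular[OF two x])
  note c = unitriangularD(1)[OF K] unitriangularD(1)[OF x]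
  note cp = cayley_props[OF two x]
  have xN: "x - 1\<^sub>m m \<in> carrier_mat m m" using c by (simp add: minus_carrier_mat)
  show a: "a \<in> carrier_mat m m" unfolding a_def using cp(1) by (simp add: mult_carrier_mat[of _ m m _ m])
  have "?K * a = (x - 1\<^sub>m m) * (?O * ?O\<^sup>T)"
    unfolding a_def using c cp(1,2) xN
    by (simp add: assoc_mult_mat[of _ m m _ m _ m, symmetric] mult_carrier_mat[of _ m m _ m])
  thus Ka: "?K * a = x - 1\<^sub>m m" using xN gram_orthogonal(1)[of G n, where ?'a = 'a] by (simp add: m)
  have KN: "?K * (x - 1\<^sub>m m) = (x - 1\<^sub>m m) * ?K"
    unfolding halfsum_def using c
    by (simp add: square_simps)
  have aK: "a * ?K \<in> carrier_mat m m" using a c by (simp add: mult_carrier_mat[of _ m m _ m])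
  have "?K * (a * ?K) = ?K * (x - 1\<^sub>m m)"
    using assoc_mult_mat[OF c(1) a c(1)] Ka KN by simp
  thus "a * ?K = x - 1\<^sub>m m" using unitriangular_left_cancel[OF K aK xN] by simp
  show "a $$ (i, j) = ?b $$ (i, m - 1 - j) * form_sign G n j" if ij: "i < m" "j < m" for i j
  proof -
    have "a = - form_eps G \<cdot>\<^sub>m (?b * ?O)"
      unfolding a_def gram_transpose using cp(1) by (simp add: mult_smult_distrib[of _ m m _ m])
    hence "a $$ (i, j) = - form_eps G * (?b $$ (i, m - 1 - j) * form_sign G n (m - 1 - j))"
      using ij cp(1) mult_gram_entry[of ?b m G n i j] by (simp add: m del: index_mult_mat(1))
    thus ?thesis
      using form_sign_bar[of j G n, where ?'a = 'a] form_eps_cases[of G, where ?'a = 'a] ij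
      by (auto simp: m)
  qed
qed

text \<open>Solving for x gives x = (1 + h)(1 - h)^(-1) with h = b Omega^T / 2. The support
  condition on \<open>b\<close> makes h strictly upper triangular, so both factors are
  unitriangular.\<close>

lemma cayley_surj:
  fixes b :: "'a::{field,finite} mat"
  assumes two: "(2::'a) \<noteq> 0" and b: "eps_symmetric m (form_eps G) b"
    and supp: "\<And>i j. i < m \<Longrightarrow> j < m \<Longrightarrow> m \<le> i + j + 1 \<Longrightarrow> b $$ (i, j) = 0"
  obtains x where "x \<in> U_set G n" "cayley G n x = b"
proof -
  let ?O = "gram G n :: 'a mat" and ?e = "form_eps G :: 'a"
  have bc: "b \<in> carrier_mat m m" using b by (simp add: eps_symmetric_def)
  define h where "h = (1 / 2) \<cdot>\<^sub>m (b * ?O\<^sup>T)"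
  have h: "h \<in> carrier_mat m m" unfolding h_def using bc by (simp add: mult_carrier_mat[of _ m m _ m])
  have h0: "h $$ (i, j) = 0" if "j \<le> i" "i < m" for i j
  proof -
    have "h = (- ?e / 2) \<cdot>\<^sub>m (b * ?O)"
      unfolding h_def gram_transpose using bc
      by (simp add: mult_smult_distrib[of _ m m _ m]) (intro eq_matI; auto simp del: index_mult_mat(1))
    hence "h $$ (i, j) = (- ?e / 2) * (b $$ (i, m - 1 - j) * form_sign G n (m - 1 - j))"
      using that bc mult_gram_entry[of b m G n i j] by (simp add: m del: index_mult_mat(1))
    thus ?thesis using supp[of i "m - 1 - j"] that by simp
  qed
  define u where "u = 1\<^sub>m m - h"
  have uc: "u \<in> carrier_mat m m" unfolding u_def using h by (simp add: minus_carrier_mat)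
  have u: "u \<in> unitriangular m"
    by (rule unitriangularI[OF uc]) (use h0 h in \<open>auto simp: u_def\<close>)
  have p: "1\<^sub>m m + h \<in> unitriangular m"
    by (rule unitriangularI) (use h0 h in \<open>auto\<close>)
  obtain v where v: "v \<in> unitriangular m" "u * v = 1\<^sub>m m" "v * u = 1\<^sub>m m"
    using unitriangular_inverse[OF u] by blast
  define x where "x = (1\<^sub>m m + h) * v"
  have x: "x \<in> unitriangular m" unfolding x_def using mult_unitriangular[OF p v(1)] .
  note c = unitriangularD(1)[OF x] unitriangularD(1)[OF v(1)] unitriangularD(1)[OF p]
  have xu: "x * u = 1\<^sub>m m + h"
    unfolding x_def using assoc_mult_mat[OF c(3,2) uc] v(3) right_mult_one_mat[OF c(3)] by simp
  have xxh: "x - x * h = 1\<^sub>m m + h"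
    using xu c(1) h unfolding u_def by (simp add: mult_minus_distrib_mat[of _ m m _ m])
  have hO: "h * ?O = (1 / 2) \<cdot>\<^sub>m b"
    unfolding h_def using bc gram_orthogonal(2)[of G n, where ?'a = 'a]
    by (simp add: square_simps m)
  have e1: "x * b + b = 2 \<cdot>\<^sub>m (x * ?O - ?O)"
  proof -
    have "(x - x * h) * ?O = (1\<^sub>m m + h) * ?O" by (simp add: xxh)
    hence e: "x * ?O - (1 / 2) \<cdot>\<^sub>m (x * b) = ?O + (1 / 2) \<cdot>\<^sub>m b"
      using c h bc hO by (simp add: square_simps)
    show ?thesis
    proof (rule eq_matI, goal_cases)
      case (1 i j)
      hence ij: "i < m" "j < m" using c by (auto simp: m)
      have "(x * ?O - (1 / 2) \<cdot>\<^sub>m (x * b)) $$ (i, j) = (?O + (1 / 2) \<cdot>\<^sub>m b) $$ (i, j)" using e by simp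
      hence "2 * ((x * b) $$ (i, j) + b $$ (i, j)) = 2 * (2 * ((x * ?O) $$ (i, j) - ?O $$ (i, j)))"
        using ij c bc two carrier_matD[OF gram_m[where ?'a = 'a]]
        by (simp del: index_mult_mat(1) gram_dim add: field_simps)
      hence "(x * b) $$ (i, j) + b $$ (i, j) = 2 * ((x * ?O) $$ (i, j) - ?O $$ (i, j))"
        by (simp only: mult_left_cancel[OF two])
      thus ?case using ij c bc carrier_matD[OF gram_m[where ?'a = 'a]]
        by (simp del: index_mult_mat(1) gram_dim)
    qed (use c bc in \<open>auto simp: m\<close>)
  qed
  have R: "halfsum m x * b = (x - 1\<^sub>m m) * ?O"
  proof -
    have "halfsum m x * b = (1 / 2) \<cdot>\<^sub>m (x * b + b)"
      unfolding halfsum_def using c bc by (simp add: square_simps)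
    also have "\<dots> = x * ?O - ?O"
      unfolding e1 using c two by (intro eq_matI) (auto simp del: index_mult_mat(1) simp: m)
    also have "\<dots> = (x - 1\<^sub>m m) * ?O" using c by (simp add: square_simps)
    finally show ?thesis .
  qed
  have cay: "cayley G n x = b" by (rule cayley_props(3)[OF two x bc R])
  \<comment> \<open>\<open>(x - 1) \<Omega> (x + 1)\<^sup>T\<close> is \<open>\<epsilon>\<close>-symmetric because it is congruent to \<open>b\<close>; comparing it with its
    transpose gives the isometry condition.\<close>
  have "x * ?O * x\<^sup>T = ?O"
  proof -
    let ?K = "halfsum m x"
    have Kc: "?K \<in> carrier_mat m m" using halfsum_unitriangular[OF two x] unitriangularD(1) by blast
    let ?W = "(x - 1\<^sub>m m) * ?O * (x\<^sup>T + 1\<^sub>m m)"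
    have xO: "x * ?O \<in> carrier_mat m m" "?O * x\<^sup>T \<in> carrier_mat m m"
      "x * ?O * x\<^sup>T \<in> carrier_mat m m" using c by (simp_all add: mult_carrier_mat[of _ m m _ m])
    have xT: "x\<^sup>T \<in> carrier_mat m m" using c by simp
    have W: "?W = x * ?O * x\<^sup>T + x * ?O - (?O * x\<^sup>T + ?O)"
    proof -
      have "(x - 1\<^sub>m m) * ?O = x * ?O - ?O" using c by (simp add: square_simps)
      moreover have "(x * ?O - ?O) * (x\<^sup>T + 1\<^sub>m m)
        = x * ?O * (x\<^sup>T + 1\<^sub>m m) - ?O * (x\<^sup>T + 1\<^sub>m m)"
        using c xO by (intro minus_mult_distrib_mat[of _ m m _ _ m]) auto
      moreover have "x * ?O * (x\<^sup>T + 1\<^sub>m m) = x * ?O * x\<^sup>T + x * ?O"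
        using mult_add_distrib_mat[OF xO(1) xT one_carrier_mat] right_mult_one_mat[OF xO(1)] by simp
      moreover have "?O * (x\<^sup>T + 1\<^sub>m m) = ?O * x\<^sup>T + ?O"
        using mult_add_distrib_mat[OF gram_m xT one_carrier_mat] right_mult_one_mat[OF gram_m[where ?'a = 'a]] by simp
      ultimately show ?thesis by simp
    qed
    have "eps_symmetric m ?e (?K * b * ?K\<^sup>T)" by (rule eps_symmetric_congruence[OF Kc b])
    moreover have "?K * b * ?K\<^sup>T = (1 / 2) \<cdot>\<^sub>m ?W"
    proof -
      have KT: "?K\<^sup>T = (1 / 2) \<cdot>\<^sub>m (x\<^sup>T + 1\<^sub>m m)"
        using c by (auto simp: halfsum_def)
      have "(x - 1\<^sub>m m) * ?O \<in> carrier_mat m m" using c by (simp add: mult_carrier_mat[of _ m m _ m] minus_carrier_mat)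
      thus ?thesis unfolding R KT using c by (simp add: mult_smult_distrib[of _ m m _ m])
    qed
    ultimately have sy: "(1 / 2) * ?W $$ (j, i) = ?e * ((1 / 2) * ?W $$ (i, j))" if "i < m" "j < m" for i j
    proof -
      assume a: "eps_symmetric m ?e (?K * b * ?K\<^sup>T)" "?K * b * ?K\<^sup>T = (1 / 2) \<cdot>\<^sub>m ?W"
      have "((1 / 2) \<cdot>\<^sub>m ?W) $$ (j, i) = ?e * ((1 / 2) \<cdot>\<^sub>m ?W) $$ (i, j)"
        using a that unfolding eps_symmetric_def by metis
      thus ?thesis using that c by (simp del: index_mult_mat(1))
    qed
    have OT: "?O\<^sup>T = - ?e \<cdot>\<^sub>m ?O" by (rule gram_transpose)
    have t1: "(x * ?O * x\<^sup>T) $$ (j, i) = - ?e * (x * ?O * x\<^sup>T) $$ (i, j)"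
      and t2: "(x * ?O) $$ (j, i) = - ?e * (?O * x\<^sup>T) $$ (i, j)"
      and t4: "?O $$ (j, i) = - ?e * ?O $$ (i, j)" if "i < m" "j < m" for i j
    proof -
      have "(x * ?O * x\<^sup>T)\<^sup>T = - ?e \<cdot>\<^sub>m (x * ?O * x\<^sup>T)"
        using c by (simp add: square_simps OT)
      hence "(x * ?O * x\<^sup>T)\<^sup>T $$ (i, j) = (- ?e \<cdot>\<^sub>m (x * ?O * x\<^sup>T)) $$ (i, j)" by simp
      thus "(x * ?O * x\<^sup>T) $$ (j, i) = - ?e * (x * ?O * x\<^sup>T) $$ (i, j)"
        using that c by (simp del: index_mult_mat(1))
      have "(x * ?O)\<^sup>T = - ?e \<cdot>\<^sub>m (?O * x\<^sup>T)"
        using c by (simp add: square_simps OT)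
      hence "(x * ?O)\<^sup>T $$ (i, j) = (- ?e \<cdot>\<^sub>m (?O * x\<^sup>T)) $$ (i, j)" by simp
      thus "(x * ?O) $$ (j, i) = - ?e * (?O * x\<^sup>T) $$ (i, j)"
        using that c xO carrier_matD[OF gram_m[where ?'a = 'a]] by (simp del: index_mult_mat(1) gram_dim)
      have "?O\<^sup>T $$ (i, j) = (- ?e \<cdot>\<^sub>m ?O) $$ (i, j)" using OT by simp
      thus "?O $$ (j, i) = - ?e * ?O $$ (i, j)" using that carrier_matD[OF gram_m[where ?'a = 'a]] by (simp del: gram_dim)
    qed
    have t3: "(?O * x\<^sup>T) $$ (j, i) = - ?e * (x * ?O) $$ (i, j)" if "i < m" "j < m" for i j
      using t2[OF that(2,1)] form_eps_cases[of G, where ?'a = 'a] by auto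
    have "(x * ?O * x\<^sup>T) $$ (i, j) = ?O $$ (i, j)" if ij: "i < m" "j < m" for i j
    proof -
      define A B C D where "A = (x * ?O * x\<^sup>T) $$ (i, j)" and "B = (x * ?O) $$ (i, j)"
        and "C = (?O * x\<^sup>T) $$ (i, j)" and "D = ?O $$ (i, j)"
      have dO: "dim_row ?O = m" "dim_col ?O = m" by (simp_all add: m)
      have "?W $$ (i, j) = A + B - (C + D)"
        unfolding W A_def B_def C_def D_def using ij c dO by (simp del: index_mult_mat(1) gram_dim)
      moreover have "?W $$ (j, i) = - ?e * A + (- ?e * C) - (- ?e * B + (- ?e * D))"
        unfolding W A_def B_def C_def D_def using ij c dO
          t1[OF ij] t2[OF ij] t3[OF ij] t4[OF ij] by (simp del: index_mult_mat(1) gram_dim)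
      moreover have half: "(1 / 2 :: 'a) \<noteq> 0" using two by simp
      ultimately have "(1 / 2) * (- ?e * A + (- ?e * C) - (- ?e * B + (- ?e * D))) = (1 / 2) * (?e * (A + B - (C + D)))"
        using sy[OF ij] by (simp add: mult_ac)
      hence "- ?e * A + (- ?e * C) - (- ?e * B + (- ?e * D)) = ?e * (A + B - (C + D))"
        by (simp only: mult_left_cancel[OF half])
      hence "- A + (- C) - (- B + (- D)) = A + B - (C + D)"
        using form_eps_cases[of G, where ?'a = 'a]
      proof (elim disjE)
        assume "?e = -1" "- ?e * A + (- ?e * C) - (- ?e * B + (- ?e * D)) = ?e * (A + B - (C + D))"
        hence "A + C - (B + D) = - (A + B - (C + D))" by simp
        hence "- (A + C - (B + D)) = A + B - (C + D)" by (simp only: minus_minus)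
        thus ?thesis by (simp add: algebra_simps)
      qed simp
      moreover have "2 * A - 2 * D = (A + B - (C + D)) - (- A + (- C) - (- B + (- D)))"
        by (simp add: algebra_simps)
      ultimately have "2 * A = 2 * D" by auto
      thus ?thesis using two by (simp add: A_def D_def)
    qed
    thus ?thesis using c by (intro eq_matI) (auto simp: m)
  qed
  hence "x \<in> U_set G n" using x by (simp add: U_set_iff m)
  thus ?thesis using that cay by blast
qed

text \<open>Congruence yields a two-sided relation because Omega makes the lower unitriangular
  factor upper. Conversely a two-sided relation only says that b and e Omega are equivalent under
  independent factors; but b is congruent to some monomial matrix, and
  \<open>monomial_unique\<close> identifies that matrix with e Omega.\<close>

lemma two_sided_orbit_iff_congruence:
  fixes x e :: "'a::{field,finite} mat"
  assumes two: "(2::'a) \<noteq> 0" and xU: "x \<in> U_set G n" and e: "e \<in> carrier_mat m m"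
    and E: "monomial m (e * gram G n)"
  shows "(\<exists>u\<in>unitriangular m. \<exists>v\<in>unitriangular m. x - 1\<^sub>m m = u * e * v) \<longleftrightarrow>
    (\<exists>g\<in>unitriangular m. g * cayley G n x * g\<^sup>T = e * gram G n)"
proof -
  have x: "x \<in> unitriangular m" using xU by (simp add: U_set_iff m)
  let ?K = "halfsum m x" and ?b = "cayley G n x" and ?O = "gram G n :: 'a mat"
  have K: "?K \<in> unitriangular m" by (rule halfsum_unitriangular[OF two x])
  obtain L where L: "L \<in> unitriangular m" "?K * L = 1\<^sub>m m" "L * ?K = 1\<^sub>m m" using unitriangular_inverse[OF K] by blast
  note c = unitriangularD(1)[OF K] unitriangularD(1)[OF L(1)] unitriangularD(1)[OF x] e
  note cp = cayley_props[OF two x]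
  note go = gram_orthogonal[of G n, where ?'a = 'a, folded m]
  note S = square_mat_simps[where m = m]
  have xN: "x - 1\<^sub>m m \<in> carrier_mat m m" using c by (simp add: minus_carrier_mat)
  have gc: "?O * (?O\<^sup>T * A) = A" "?O\<^sup>T * (?O * A) = A" if "A \<in> carrier_mat m m" for A
    using that go assoc_mult_mat[of ?O m m "?O\<^sup>T" m A m] assoc_mult_mat[of "?O\<^sup>T" m m ?O m A m]
    by (simp_all)
  have inv: "L * (?K * A) = A" "?K * (L * A) = A" if "A \<in> carrier_mat m m" for A
    using that L c assoc_mult_mat[OF c(1,2) that] assoc_mult_mat[OF c(2,1) that] by simp_all
  have Ka: "?K * ?b * ?O\<^sup>T = x - 1\<^sub>m m"
    using cayley_commute(1,2)[OF two x] c cp(1) by (simp add: S)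
  show ?thesis
  proof
    assume "\<exists>u\<in>unitriangular m. \<exists>v\<in>unitriangular m. x - 1\<^sub>m m = u * e * v"
    then obtain u v where u: "u \<in> unitriangular m" and v: "v \<in> unitriangular m" and eq: "x - 1\<^sub>m m = u * e * v" by blast
    obtain g where g: "g \<in> unitriangular m" "monomial m (g * ?b * g\<^sup>T)"
      using congruent_to_monomial[OF two form_eps_cases cayley_eps_symmetric[OF two xU]] by blast
    let ?E' = "g * ?b * g\<^sup>T"
    note c' = c unitriangularD(1)[OF u] unitriangularD(1)[OF v] unitriangularD(1)[OF g(1)]
    obtain g' where g': "g' \<in> unitriangular m" "g * g' = 1\<^sub>m m" "g' * g = 1\<^sub>m m" using unitriangular_inverse[OF g(1)] by blast
    obtain v' where v': "v' \<in> unitriangular m" "v * v' = 1\<^sub>m m" "v' * v = 1\<^sub>m m" using unitriangular_inverse[OF v] by blast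
    note c'' = c' unitriangularD(1)[OF g'(1)] unitriangularD(1)[OF v'(1)]
    have bb: "?b = L * (u * e * v * ?O)"
      using inv(1)[OF cp(1)] cp(2) eq by simp
    \<comment> \<open>\<open>w\<close> is lower unitriangular, being \<open>\<Omega>\<^sup>T v\<^sup>-\<^sup>1 \<Omega>\<close> up to a lower unitriangular factor.\<close>
    define w where "w = g'\<^sup>T * (?O\<^sup>T * v' * ?O)"
    have wc: "w \<in> carrier_mat m m" unfolding w_def using c'' by (simp add: S)
    have "w\<^sup>T = (?O * v'\<^sup>T * ?O\<^sup>T) * g'
      \<or> w\<^sup>T = (?O\<^sup>T * v'\<^sup>T * ?O) * g'"
      unfolding w_def using c'' by (simp add: S)
    moreover have "?O\<^sup>T * v'\<^sup>T * ?O = ?O * v'\<^sup>T * ?O\<^sup>T"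
    proof -
      have "?O\<^sup>T * v'\<^sup>T * ?O = - form_eps G \<cdot>\<^sub>m (?O * v'\<^sup>T * ?O)"
        unfolding gram_transpose using c'' by (simp add: S mult_smult_assoc_mat[of _ m m _ m])
      moreover have "?O * v'\<^sup>T * ?O\<^sup>T = - form_eps G \<cdot>\<^sub>m (?O * v'\<^sup>T * ?O)"
        unfolding gram_transpose using c'' by (simp add: S mult_smult_distrib[of _ m m _ m])
      ultimately show ?thesis by simp
    qed
    moreover have "?O * v'\<^sup>T * ?O\<^sup>T \<in> unitriangular m"
      unfolding m by (rule gram_conj_unitriangular) (use v'(1) m in simp)
    ultimately have wT: "w\<^sup>T \<in> unitriangular m" using g'(1) mult_unitriangular by metis
    have cg: "g\<^sup>T * (g'\<^sup>T * A) = A" if A: "A \<in> carrier_mat m m" for A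
    proof -
      have "g\<^sup>T * g'\<^sup>T = 1\<^sub>m m" using g'(3) c'' transpose_mult[of g' m m g m] by simp
      thus ?thesis using A c'' assoc_mult_mat[of "g\<^sup>T" m m "g'\<^sup>T" m A m] by simp
    qed
    have cv: "v * (v' * A) = A" if A: "A \<in> carrier_mat m m" for A
      using v'(2) A c'' assoc_mult_mat[of v m m v' m A m] by simp
    have "?E' * w = g * (L * u) * (e * ?O)"
      unfolding w_def bb using c'' by (simp add: S cg gc cv)
    moreover have gLu: "g * (L * u) \<in> unitriangular m" using mult_unitriangular g(1) L(1) u by blast
    moreover have "e * ?O \<in> carrier_mat m m" "?E' \<in> carrier_mat m m" using c'' cp(1) by (simp_all add: S)
    ultimately have "e * ?O = ?E'" using monomial_unique[OF gLu wT _ E _ g(2)] by metis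
    thus "\<exists>g\<in>unitriangular m. g * ?b * g\<^sup>T = e * ?O" using g(1) by metis
  next
    assume "\<exists>g\<in>unitriangular m. g * ?b * g\<^sup>T = e * ?O"
    then obtain g where g: "g \<in> unitriangular m" "g * ?b * g\<^sup>T = e * ?O" by blast
    obtain g' where g': "g' \<in> unitriangular m" "g * g' = 1\<^sub>m m" "g' * g = 1\<^sub>m m" using unitriangular_inverse[OF g(1)] by blast
    note c' = c unitriangularD(1)[OF g(1)] unitriangularD(1)[OF g'(1)]
    have c1: "g' * (g * A) = A" if "A \<in> carrier_mat m m" for A
      using that c' g'(3) assoc_mult_mat[of g' m m g m A m] by simp
    have c2: "g\<^sup>T * g'\<^sup>T = 1\<^sub>m m"
      using g'(3) c' transpose_mult[of g' m m g m] by simp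
    have "g' * (g * ?b * g\<^sup>T) * g'\<^sup>T = ?b"
      using c' cp(1) by (simp add: S c1 c2)
    hence b: "?b = g' * (e * ?O) * g'\<^sup>T" using g(2) by simp
    \<comment> \<open>From b = g' e Omega g'^T one gets b Omega^T = g' e v, with v upper
      unitriangular.\<close>
    let ?v = "?O * g'\<^sup>T * ?O\<^sup>T"
    have v: "?v \<in> unitriangular m"
      unfolding m by (rule gram_conj_unitriangular) (use g'(1) m in simp)
    have "x - 1\<^sub>m m = (?K * g') * e * ?v"
      unfolding Ka[symmetric] b using c' by (simp add: S)
    thus "\<exists>u\<in>unitriangular m. \<exists>v\<in>unitriangular m. x - 1\<^sub>m m = u * e * v"
      using v mult_unitriangular[OF K g'(1)] by blast
  qed
qed

end

section \<open>Roots and normal forms\<close>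

lemma pos_pos: "pos G n (int i + 1) = i"
  by (simp add: pos_def)

lemma pos_neg: "i < n \<Longrightarrow> pos G n (- (int i + 1)) = dimn G n - 1 - i"
  by (simp add: pos_def dimn_def)

lemma pos_zero: "pos G n 0 = n"
  by (simp add: pos_def)

lemma pos_inj_on_labels: "inj_on (pos G n) (labels G n)"
  by (rule inj_onI) (auto simp: pos_def labels_def dimn_def mid_def split: if_splits)

text \<open>A root is encoded by the pair of 0-based positions \<open>(k, l)\<close>, \<open>k \<le> l\<close>, such that its positive
  entry is \<open>(k, m - 1 - l)\<close>; multiplication of a root matrix by the Gram matrix moves its entries to
  \<open>(k, l)\<close> and \<open>(l, k)\<close>.\<close>

fun root_pair :: "group_type \<Rightarrow> nat \<Rightarrow> root \<Rightarrow> nat \<times> nat" where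
  "root_pair G n (Minus i j) = (nat (i - 1), dimn G n - nat j)"
| "root_pair G n (Plus i j) = (nat (i - 1), nat (j - 1))"
| "root_pair G n (Twice i) = (nat (i - 1), nat (i - 1))"
| "root_pair G n (Single i) = (nat (i - 1), n)"

text \<open>The free coordinates of an eps-symmetric form supported strictly above the
  anti-diagonal. Diagonal positions occur only for \<open>Sp\<close>, since skew forms have zero
  diagonal.\<close>

definition pairs :: "group_type \<Rightarrow> nat \<Rightarrow> (nat \<times> nat) set" where
  "pairs G n = {(k, l). k \<le> l \<and> (k = l \<longrightarrow> G = Sp) \<and> k + l + 1 < dimn G n}"

lemma rootsE [consumes 1, case_names Minus Plus Twice Single]:
  assumes "\<alpha> \<in> roots G n"
  obtains i j where "\<alpha> = Minus (int i + 1) (int j + 1)" "i < j" "j < n" "root_pair G n \<alpha> = (i, dimn G n - 1 - j)"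
  | i j where "\<alpha> = Plus (int i + 1) (int j + 1)" "i < j" "j < n" "root_pair G n \<alpha> = (i, j)"
  | i where "\<alpha> = Twice (int i + 1)" "i < n" "G = Sp" "root_pair G n \<alpha> = (i, i)"
  | i where "\<alpha> = Single (int i + 1)" "i < n" "G = O_odd" "root_pair G n \<alpha> = (i, n)"
proof -
  have I: "\<exists>a. i = int a + 1" if "1 \<le> i" for i :: int
    using that by (intro exI[of _ "nat (i - 1)"]) simp
  from assms consider
    (a) i j where "\<alpha> = Minus i j" "1 \<le> i" "i < j" "j \<le> int n"
  | (b) i j where "\<alpha> = Plus i j" "1 \<le> i" "i < j" "j \<le> int n"
  | (c) i where "\<alpha> = Twice i" "1 \<le> i" "i \<le> int n" "G = Sp"
  | (d) i where "\<alpha> = Single i" "1 \<le> i" "i \<le> int n" "G = O_odd"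
    unfolding roots_def by (cases G) auto
  thus ?thesis
  proof cases
    case a
    obtain i' j' where "i = int i' + 1" "j = int j' + 1" using I[of i] I[of j] a by auto
    thus ?thesis using a that(1)[of i' j'] by (simp add: nat_add_distrib)
  next
    case b
    obtain i' j' where "i = int i' + 1" "j = int j' + 1" using I[of i] I[of j] b by auto
    thus ?thesis using b that(2)[of i' j'] by simp
  next
    case c
    obtain i' where "i = int i' + 1" using I[of i] c by auto
    thus ?thesis using c that(3)[of i'] by simp
  next
    case d
    obtain i' where "i = int i' + 1" using I[of i] d by auto
    thus ?thesis using d that(4)[of i'] by simp
  qed
qed

lemma finite_roots: "finite (roots G n)"
proof (rule finite_subset)
  let ?I = "{1..int n}"
  show "roots G n \<subseteq> (\<lambda>(i, j). Minus i j) ` (?I \<times> ?I) \<union> (\<lambda>(i, j). Plus i j) ` (?I \<times> ?I) \<union> Twice ` ?I \<union> Single ` ?I"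
    by (cases G) (auto simp: roots_def)
qed auto

lemma root_pair_in_pairs: "\<alpha> \<in> roots G n \<Longrightarrow> root_pair G n \<alpha> \<in> pairs G n"
  by (cases rule: rootsE) (auto simp: pairs_def dimn_def mid_def)

lemma inj_root_pair: "inj_on (root_pair G n) (roots G n)"
proof (rule inj_onI)
  fix \<alpha> \<beta> assume a: "\<alpha> \<in> roots G n" and b: "\<beta> \<in> roots G n" and e: "root_pair G n \<alpha> = root_pair G n \<beta>"
  from a show "\<alpha> = \<beta>"
  proof (cases rule: rootsE)
    case (Minus i j)
    from b show ?thesis by (cases rule: rootsE) (use e Minus in \<open>auto simp: dimn_def mid_def\<close>)
  next
    case (Plus i j)
    from b show ?thesis by (cases rule: rootsE) (use e Plus in \<open>auto simp: dimn_def mid_def\<close>)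
  next
    case (Twice i)
    from b show ?thesis by (cases rule: rootsE) (use e Twice in \<open>auto simp: dimn_def mid_def\<close>)
  next
    case (Single i)
    from b show ?thesis by (cases rule: rootsE) (use e Single in \<open>auto simp: dimn_def mid_def\<close>)
  qed
qed

text \<open>The block containing \<open>l\<close> decides the kind of root: the first block gives
  \<open>Plus\<close> or \<open>Twice\<close>, the middle position \<open>Single\<close>, the last
  block \<open>Minus\<close>.\<close>

lemma root_pair_surj:
  assumes "(k, l) \<in> pairs G n"
  obtains \<alpha> where "\<alpha> \<in> roots G n" "root_pair G n \<alpha> = (k, l)"
proof -
  from assms have kl: "k \<le> l" "k = l \<Longrightarrow> G = Sp" "k + l + 1 < dimn G n" by (auto simp: pairs_def)
  consider "l < n" "k < l" | "l < n" "k = l" | "l = n" "G = O_odd" | "l \<ge> n + mid G"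
    using kl by (cases G) (auto simp: mid_def, linarith+)
  thus ?thesis
  proof cases
    case 1
    thus ?thesis by (intro that[of "Plus (int k + 1) (int l + 1)"]) (auto simp: roots_def)
  next
    case 2
    thus ?thesis using kl by (intro that[of "Twice (int k + 1)"]) (auto simp: roots_def)
  next
    case 3
    thus ?thesis using kl by (intro that[of "Single (int k + 1)"]) (auto simp: roots_def dimn_def mid_def)
  next
    case 4
    have "k + 1 < dimn G n - l" "dimn G n - l \<le> n" "dimn G n - (dimn G n - l) = l"
      using kl 4 by (auto simp: dimn_def)
    thus ?thesis
      by (intro that[of "Minus (int k + 1) (int (dimn G n - l))"]) (auto simp: roots_def simp del: of_nat_diff)
  qed
qed

section \<open>Entries, matrices and subgroups of a root in terms of its pair\<close>

lemma entries_pos: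
  assumes "\<alpha> \<in> roots G n" "root_pair G n \<alpha> = (k, l)"
  shows "(\<lambda>(i, j). (pos G n i, pos G n j)) ` entries \<alpha> = {(k, dimn G n - 1 - l), (l, dimn G n - 1 - k)}"
    "entries \<alpha> \<subseteq> labels G n \<times> labels G n"
proof -
  let ?img = "(\<lambda>(i, j). (pos G n i, pos G n j)) ` entries \<alpha> = {(k, dimn G n - 1 - l), (l, dimn G n - 1 - k)}"
  have "?img \<and> entries \<alpha> \<subseteq> labels G n \<times> labels G n"
    using assms(1)
  proof (cases rule: rootsE)
    case (Minus i j)
    have p: "pos G n (- 1 - int j) = dimn G n - 1 - j" "pos G n (- 1 - int i) = dimn G n - 1 - i"
      using Minus pos_neg[of j n G] pos_neg[of i n G] by (simp_all add: algebra_simps)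
    have kl: "k = i" "l = dimn G n - 1 - j" "dimn G n - 1 - (dimn G n - 1 - j) = j"
      using Minus assms(2) by (auto simp: dimn_def)
    show ?thesis unfolding Minus(1) kl(1,2) kl(3)
      using p Minus by (auto simp: pos_pos[unfolded add.commute[of _ 1]] labels_def algebra_simps)
  next
    case (Plus i j)
    have p: "pos G n (- 1 - int j) = dimn G n - 1 - j" "pos G n (- 1 - int i) = dimn G n - 1 - i"
      using Plus pos_neg[of j n G] pos_neg[of i n G] by (simp_all add: algebra_simps)
    have kl: "k = i" "l = j" using Plus assms(2) by auto
    show ?thesis unfolding Plus(1) kl
      using p Plus by (auto simp: pos_pos[unfolded add.commute[of _ 1]] labels_def algebra_simps)
  next
    case (Twice i)
    have p: "pos G n (- 1 - int i) = dimn G n - 1 - i"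
      using Twice pos_neg[of i n G] by (simp add: algebra_simps)
    have kl: "k = i" "l = i" using Twice assms(2) by auto
    show ?thesis unfolding Twice(1) kl
      using p Twice by (auto simp: pos_pos[unfolded add.commute[of _ 1]] labels_def algebra_simps)
  next
    case (Single i)
    have p: "pos G n (- 1 - int i) = dimn G n - 1 - i"
      using Single pos_neg[of i n G] by (simp add: algebra_simps)
    have kl: "k = i" "l = n" "dimn G n - 1 - n = n" using Single assms(2) by (auto simp: dimn_def mid_def)
    show ?thesis unfolding Single(1) kl(1,2) kl(3)
      using p Single by (auto simp: pos_pos[unfolded add.commute[of _ 1]] pos_zero labels_def algebra_simps)
  qed
  thus "?img" "entries \<alpha> \<subseteq> labels G n \<times> labels G n" by blast+
qed

text \<open>A root with pair (k, l) occupies exactly the rows k and l, and exactly the mirror images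
  of these as columns. Basic sets are therefore those in which different roots have disjoint index
  sets {k, l}, which also lets their character sums be taken independently.\<close>

lemma basic_iff_disjoint:
  "basic G n D \<longleftrightarrow> D \<subseteq> roots G n \<and>
    (\<forall>\<alpha>\<in>D. \<forall>\<beta>\<in>D. \<forall>k l k' l'. root_pair G n \<alpha> = (k, l) \<longrightarrow> root_pair G n \<beta> = (k', l') \<longrightarrow>
       \<alpha> \<noteq> \<beta> \<longrightarrow> {k, l} \<inter> {k', l'} = {})"
proof -
  let ?m = "dimn G n"
  let ?pp = "\<lambda>(i, j). (pos G n i, pos G n j)"
  have bd: "k < ?m" "l < ?m" "k \<le> l" if "\<alpha> \<in> roots G n" "root_pair G n \<alpha> = (k, l)" for \<alpha> k l
    using root_pair_in_pairs[OF that(1)] that(2) by (auto simp: pairs_def)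
  have bar: "s = t" if "?m - 1 - s = ?m - 1 - t" "s < ?m" "t < ?m" for s t using that by linarith
  have pick: "\<exists>i j. (i, j) \<in> entries \<alpha> \<and> i \<in> labels G n \<and> j \<in> labels G n \<and> pos G n i = s \<and> pos G n j = ?m - 1 - t"
    if "\<alpha> \<in> roots G n" "root_pair G n \<alpha> = (k, l)" "(s, t) = (k, l) \<or> (s, t) = (l, k)" for \<alpha> k l s t
  proof -
    have "(s, ?m - 1 - t) \<in> ?pp ` entries \<alpha>" using entries_pos(1)[OF that(1,2)] that(3) by auto
    then obtain i j where "(i, j) \<in> entries \<alpha>" "pos G n i = s" "pos G n j = ?m - 1 - t" by auto
    thus ?thesis using entries_pos(2)[OF that(1,2)] by blast
  qed
  have split: "\<exists>t. ((pos G n i, t) = (k, l) \<or> (pos G n i, t) = (l, k)) \<and> pos G n j = ?m - 1 - t"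
    if "\<alpha> \<in> roots G n" "root_pair G n \<alpha> = (k, l)" "(i, j) \<in> entries \<alpha>" for \<alpha> k l i j
  proof -
    have "(pos G n i, pos G n j) \<in> ?pp ` entries \<alpha>" using that(3) by force
    thus ?thesis using entries_pos(1)[OF that(1,2)] by auto
  qed
  show ?thesis
  proof (intro iffI conjI ballI allI impI)
    assume B: "basic G n D"
    thus D: "D \<subseteq> roots G n" by (simp add: basic_def)
    fix \<alpha> \<beta> k l k' l'
    assume ab: "\<alpha> \<in> D" "\<beta> \<in> D" "root_pair G n \<alpha> = (k, l)" "root_pair G n \<beta> = (k', l')" "\<alpha> \<noteq> \<beta>"
    note r = ab(1,2)[THEN subsetD[OF D]]
    show "{k, l} \<inter> {k', l'} = {}"
    proof (rule ccontr)
      assume "\<not> ?thesis"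
      then obtain s where s: "s \<in> {k, l}" "s \<in> {k', l'}" by auto
      obtain t where t: "(s, t) = (k, l) \<or> (s, t) = (l, k)" using s by auto
      obtain t' where t': "(s, t') = (k', l') \<or> (s, t') = (l', k')" using s by auto
      obtain i j where ij: "(i, j) \<in> entries \<alpha>" "i \<in> labels G n" "j \<in> labels G n" "pos G n i = s" "pos G n j = ?m - 1 - t"
        using pick[OF r(1) ab(3) t] by blast
      obtain i' j' where ij': "(i', j') \<in> entries \<beta>" "i' \<in> labels G n" "j' \<in> labels G n" "pos G n i' = s" "pos G n j' = ?m - 1 - t'"
        using pick[OF r(2) ab(4) t'] by blast
      have "i = i'" using inj_onD[OF pos_inj_on_labels] ij ij' by metis
      moreover have "(i, j) \<in> entries_of D" "(i', j') \<in> entries_of D"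
        using ij ij' ab by (auto simp: entries_of_def)
      ultimately have "j = j'" using B unfolding basic_def by blast
      hence "t = t'" using bar[of t t'] ij(5) ij'(5) t t' bd[OF r(1) ab(3)] bd[OF r(2) ab(4)] by auto
      hence "(k, l) = (k', l')" using t t' bd(3)[OF r(1) ab(3)] bd(3)[OF r(2) ab(4)] by auto
      hence "\<alpha> = \<beta>" using inj_onD[OF inj_root_pair] r ab(3,4) by metis
      thus False using ab(5) by simp
    qed
  next
    assume R: "D \<subseteq> roots G n \<and>
      (\<forall>\<alpha>\<in>D. \<forall>\<beta>\<in>D. \<forall>k l k' l'. root_pair G n \<alpha> = (k, l) \<longrightarrow> root_pair G n \<beta> = (k', l') \<longrightarrow>
         \<alpha> \<noteq> \<beta> \<longrightarrow> {k, l} \<inter> {k', l'} = {})"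
    have same: "\<alpha> = \<beta>" if "\<alpha> \<in> D" "\<beta> \<in> D" "root_pair G n \<alpha> = (k, l)" "root_pair G n \<beta> = (k', l')"
      "s \<in> {k, l}" "s \<in> {k', l'}" for \<alpha> \<beta> k l k' l' s
      using R[THEN conjunct2, rule_format, OF that(1-4)] that(5,6) by blast
    show "basic G n D"
      unfolding basic_def
    proof (intro conjI allI impI)
      show D: "D \<subseteq> roots G n" using R by blast
      fix i j j' assume "(i, j) \<in> entries_of D \<and> (i, j') \<in> entries_of D"
      then obtain \<alpha> \<beta> where ab: "\<alpha> \<in> D" "\<beta> \<in> D" "(i, j) \<in> entries \<alpha>" "(i, j') \<in> entries \<beta>"
        by (auto simp: entries_of_def)
      obtain k l k' l' where kl: "root_pair G n \<alpha> = (k, l)" "root_pair G n \<beta> = (k', l')" by fastforce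
      note r = ab(1,2)[THEN subsetD[OF D]]
      obtain t where t: "(pos G n i, t) = (k, l) \<or> (pos G n i, t) = (l, k)" "pos G n j = ?m - 1 - t"
        using split[OF r(1) kl(1) ab(3)] by blast
      obtain t' where t': "(pos G n i, t') = (k', l') \<or> (pos G n i, t') = (l', k')" "pos G n j' = ?m - 1 - t'"
        using split[OF r(2) kl(2) ab(4)] by blast
      have "\<alpha> = \<beta>" using same[OF ab(1,2) kl, of "pos G n i"] t t' by auto
      hence "t = t'" using t t' kl by auto
      hence "pos G n j = pos G n j'" using t t' by simp
      moreover have "j \<in> labels G n" "j' \<in> labels G n"
        using entries_pos(2)[OF r(1) kl(1)] entries_pos(2)[OF r(2) kl(2)] ab(3,4) by auto
      ultimately show "j = j'" using inj_onD[OF pos_inj_on_labels] by metis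
    next
      have D: "D \<subseteq> roots G n" using R by blast
      fix i i' j assume "(i, j) \<in> entries_of D \<and> (i', j) \<in> entries_of D"
      then obtain \<alpha> \<beta> where ab: "\<alpha> \<in> D" "\<beta> \<in> D" "(i, j) \<in> entries \<alpha>" "(i', j) \<in> entries \<beta>"
        by (auto simp: entries_of_def)
      obtain k l k' l' where kl: "root_pair G n \<alpha> = (k, l)" "root_pair G n \<beta> = (k', l')" by fastforce
      note r = ab(1,2)[THEN subsetD[OF D]]
      obtain t where t: "(pos G n i, t) = (k, l) \<or> (pos G n i, t) = (l, k)" "pos G n j = ?m - 1 - t"
        using split[OF r(1) kl(1) ab(3)] by blast
      obtain t' where t': "(pos G n i', t') = (k', l') \<or> (pos G n i', t') = (l', k')" "pos G n j = ?m - 1 - t'"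
        using split[OF r(2) kl(2) ab(4)] by blast
      have tt: "t = t'" using bar[of t t'] t t' bd[OF r(1) kl(1)] bd[OF r(2) kl(2)] by auto
      have "\<alpha> = \<beta>" using same[OF ab(1,2) kl, of t] t t' tt by auto
      hence "pos G n i = pos G n i'" using t t' kl tt by auto
      moreover have "i \<in> labels G n" "i' \<in> labels G n"
        using entries_pos(2)[OF r(1) kl(1)] entries_pos(2)[OF r(2) kl(2)] ab(3,4) by auto
      ultimately show "i = i'" using inj_onD[OF pos_inj_on_labels] by metis
    qed
  qed
qed

text \<open>By \<open>mult_gram_entry\<close> the left-hand side is entry (s, t) of e_\<alpha>
  Omega. The signs in the definition of e_\<alpha> are exactly those that make this product
  eps-symmetric.\<close>

lemma root_matrix_entry:
  assumes \<alpha>: "\<alpha> \<in> roots G n" "root_pair G n \<alpha> = (k, l)" and st: "s < dimn G n" "t < dimn G n"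
  shows "root_matrix G n \<alpha> $$ (s, dimn G n - 1 - t) * form_sign G n (dimn G n - 1 - t) =
    form_sign G n (dimn G n - 1 - l) *
      ((if s = k \<and> t = l then 1 else 0) + (if s = l \<and> t = k \<and> k \<noteq> l then form_eps G else 0 :: 'a::field))"
proof -
  have mu: "matrix_unit G n i j $$ (s, dimn G n - 1 - t) =
     (if s = pos G n i \<and> dimn G n - 1 - t = pos G n j then 1 else (0::'a))" for i j
    using st by (simp add: matrix_unit_def)
  have md: "dim_row (matrix_unit G n i j :: 'a mat) = dimn G n" "dim_col (matrix_unit G n i j :: 'a mat) = dimn G n" for i j
    by (simp_all add: matrix_unit_def)
  have t': "dimn G n - 1 - t < dimn G n" using st by auto
  have bar: "dimn G n - 1 - t = dimn G n - 1 - i \<longleftrightarrow> t = i" if "i < dimn G n" for i using that st by linarith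
  \<comment> \<open>For roots with two entries, only the coefficient \<open>c\<close> of the
    mirrored entry depends on the kind of root; it has to match the two Gram signs.\<close>
  have fin: ?thesis
    if "root_matrix G n \<alpha> $$ (s, dimn G n - 1 - t) =
      (if s = k \<and> t = l then 1 else 0) + (if s = l \<and> t = k \<and> k \<noteq> l then c else 0)"
      and "c * form_sign G n (dimn G n - 1 - k) = form_sign G n (dimn G n - 1 - l) * form_eps G" for c :: 'a
  proof -
    consider "s = k \<and> t = l" "\<not> (s = l \<and> t = k \<and> k \<noteq> l)" | "\<not> (s = k \<and> t = l)" "s = l \<and> t = k \<and> k \<noteq> l"
      | "\<not> (s = k \<and> t = l)" "\<not> (s = l \<and> t = k \<and> k \<noteq> l)" by blast
    thus ?thesis
    proof cases
      case 1
      have "t = l" using 1 by blast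
      have R: "root_matrix G n \<alpha> $$ (s, dimn G n - 1 - t) = (1::'a)"
        unfolding that(1) by (simp only: if_P[OF 1(1)] if_not_P[OF 1(2)] add_0_right)
      show ?thesis unfolding if_P[OF 1(1)] if_not_P[OF 1(2)] R using \<open>t = l\<close> by simp
    next
      case 2
      have "t = k" using 2 by blast
      have R: "root_matrix G n \<alpha> $$ (s, dimn G n - 1 - t) = c"
        unfolding that(1) by (simp only: if_not_P[OF 2(1)] if_P[OF 2(2)] add_0_left)
      show ?thesis unfolding if_not_P[OF 2(1)] if_P[OF 2(2)] R using \<open>t = k\<close> that(2) by simp
    next
      case 3
      have "root_matrix G n \<alpha> $$ (s, dimn G n - 1 - t) = (0::'a)"
        unfolding that(1) by (simp only: if_not_P[OF 3(1)] if_not_P[OF 3(2)] add_0_left)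
      thus ?thesis by (simp only: if_not_P[OF 3(1)] if_not_P[OF 3(2)] add_0_left mult_zero_left mult_zero_right)
    qed
  qed
  show ?thesis
    using \<alpha>(1)
  proof (cases rule: rootsE)
    case (Minus i j)
    have p: "pos G n (int i + 1) = i" "pos G n (int j + 1) = j" "pos G n (- (int j + 1)) = dimn G n - 1 - j"
      "pos G n (- (int i + 1)) = dimn G n - 1 - i" using Minus pos_neg[of j n G] pos_neg[of i n G] by (simp_all add: pos_pos)
    have kl: "k = i" "dimn G n - 1 - j = l" "j = dimn G n - 1 - l" "l < dimn G n" "i < dimn G n" "i \<noteq> l" "\<not> n \<le> j" "n \<le> dimn G n - 1 - i"
      using Minus \<alpha>(2) by (auto simp: dimn_def)
    have "root_matrix G n \<alpha> $$ (s, dimn G n - 1 - t) =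
      (if s = i \<and> dimn G n - 1 - t = j then 1 else 0) - (if s = dimn G n - 1 - j \<and> dimn G n - 1 - t = dimn G n - 1 - i then 1 else (0::'a))"
      unfolding Minus(1) root_matrix.simps using st t' by (simp only: index_minus_mat md mu p)
    also have "\<dots> = (if s = k \<and> t = l then 1 else 0) + (if s = l \<and> t = k \<and> k \<noteq> l then -1 else (0::'a))"
      unfolding kl(2) unfolding kl(3) bar[OF kl(4)] bar[OF kl(5)] kl(1) using kl(6) by auto
    finally show ?thesis
      by (rule fin) (use kl(1,3,7,8) in \<open>simp add: form_sign_def form_eps_def\<close>)
  next
    case (Plus i j)
    have p: "pos G n (int i + 1) = i" "pos G n (int j + 1) = j" "pos G n (- (int j + 1)) = dimn G n - 1 - j"
      "pos G n (- (int i + 1)) = dimn G n - 1 - i" using Plus pos_neg[of j n G] pos_neg[of i n G] by (simp_all add: pos_pos)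
    have kl: "k = i" "l = j" "j < dimn G n" "i < dimn G n" "i \<noteq> j" "n \<le> dimn G n - 1 - j" "n \<le> dimn G n - 1 - i"
      using Plus \<alpha>(2) by (auto simp: dimn_def)
    have "root_matrix G n \<alpha> $$ (s, dimn G n - 1 - t) =
      (if s = i \<and> dimn G n - 1 - t = dimn G n - 1 - j then 1 else 0) +
      (if s = j \<and> dimn G n - 1 - t = dimn G n - 1 - i then form_eps G else (0::'a))"
    proof (cases "G = Sp")
      case True
      have e: "form_eps G = (1::'a)" using True by (simp add: form_eps_def)
      show ?thesis unfolding Plus(1) root_matrix.simps if_P[OF True] e using st t'
        by (simp only: index_add_mat md mu p)
    next
      case False
      have e: "form_eps G = (-1::'a)" using False by (simp add: form_eps_def)
      have n: "- (if C then 1 else 0) = (if C then -1 else (0::'a))" for C by simp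
      show ?thesis unfolding Plus(1) root_matrix.simps if_not_P[OF False] e using st t'
        by (simp only: index_minus_mat md mu p diff_conv_add_uminus n)
    qed
    also have "\<dots> = (if s = k \<and> t = l then 1 else 0) + (if s = l \<and> t = k \<and> k \<noteq> l then form_eps G else (0::'a))"
      unfolding bar[OF kl(3)] bar[OF kl(4)] kl(1,2) using kl(5) by auto
    finally show ?thesis
      by (rule fin) (use kl(1,2,6,7) in \<open>simp add: form_sign_def form_eps_def\<close>)
  next
    case (Twice i)
    have p: "pos G n (int i + 1) = i" "pos G n (- (int i + 1)) = dimn G n - 1 - i"
      using Twice pos_neg[of i n G] by (simp_all add: pos_pos)
    have kl: "k = i" "l = i" "i < dimn G n" using Twice \<alpha>(2) by (auto simp: dimn_def)
    have "root_matrix G n \<alpha> $$ (s, dimn G n - 1 - t) =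
      (if s = i \<and> dimn G n - 1 - t = dimn G n - 1 - i then 1 else (0::'a))"
      unfolding Twice(1) root_matrix.simps by (simp only: mu p)
    thus ?thesis unfolding bar[OF kl(3)] kl(1,2) by simp
  next
    case (Single i)
    have p: "pos G n (int i + 1) = i" "pos G n (- (int i + 1)) = dimn G n - 1 - i" "pos G n 0 = n"
      using Single pos_neg[of i n G] by (simp_all add: pos_pos pos_zero)
    have kl: "k = i" "l = n" "n < dimn G n" "i < dimn G n" "i \<noteq> n" "dimn G n - 1 - n = n" "n \<le> dimn G n - 1 - i"
      using Single \<alpha>(2) by (auto simp: dimn_def mid_def)
    have "root_matrix G n \<alpha> $$ (s, dimn G n - 1 - t) =
      (if s = i \<and> dimn G n - 1 - t = dimn G n - 1 - n then 1 else 0) - (if s = n \<and> dimn G n - 1 - t = dimn G n - 1 - i then 1 else (0::'a))"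
      unfolding Single(1) root_matrix.simps kl(6) using st t' by (simp only: index_minus_mat md mu p)
    also have "\<dots> = (if s = k \<and> t = l then 1 else 0) + (if s = l \<and> t = k \<and> k \<noteq> l then -1 else (0::'a))"
      unfolding bar[OF kl(3)] bar[OF kl(4)] kl(1,2) using kl(5) by auto
    finally show ?thesis
      by (rule fin) (use Single(3) in \<open>simp add: form_sign_def form_eps_def\<close>)
  qed
qed

text \<open>One formula for all kinds of roots. The bound \<open>min n (dimn G n - 1 - l)\<close> is
  the column of the positive entry for \<open>Minus\<close> and is \<open>n\<close> otherwise. The
  second condition belongs to \<open>Plus\<close>: for \<open>Minus\<close> and
  \<open>Single\<close> its range is empty, and for \<open>Twice\<close>, where
  \<open>l = k\<close>, it repeats the first.\<close>

lemma U_root_iff: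
  assumes \<alpha>: "\<alpha> \<in> roots G n" "root_pair G n \<alpha> = (k, l)"
  shows "z \<in> U_root G n \<alpha> \<longleftrightarrow> z \<in> U_set G n \<and>
    (\<forall>c. k < c \<and> c < min n (dimn G n - 1 - l) \<longrightarrow> z $$ (k, c) = 0) \<and>
    (\<forall>c. l < c \<and> c < n + mid G \<longrightarrow> z $$ (l, c) = 0)"
proof -
  have Q: "(\<forall>k. int i + 1 < k \<and> k < int j + 1 \<longrightarrow> P k) \<longleftrightarrow> (\<forall>c. i < c \<and> c < j \<longrightarrow> P (int c + 1))" for P i j
  proof (intro iffI allI impI)
    fix k assume R: "\<forall>c. i < c \<and> c < j \<longrightarrow> P (int c + 1)" and k: "int i + 1 < k \<and> k < int j + 1"
    have "k = int (nat (k - 1)) + 1" "i < nat (k - 1)" "nat (k - 1) < j" using k by auto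
    thus "P k" using R by metis
  qed auto
  have Q': "(\<forall>k. int i + 1 < k \<and> k \<le> int n \<longrightarrow> P k) \<longleftrightarrow> (\<forall>c. i < c \<and> c < n \<longrightarrow> P (int c + 1))" for P i
    using Q[of i n P] by simp
  have QL: "(\<forall>l\<in>labels G n. prec G n (int j + 1) l \<and> l \<ge> 0 \<longrightarrow> entry G n z j' l = 0) \<longleftrightarrow>
    (\<forall>c. j < c \<and> c < n + mid G \<longrightarrow> z $$ (pos G n j', c) = 0)" if "j < n" for j j'
  proof (intro iffI allI ballI impI)
    fix c assume R: "\<forall>l\<in>labels G n. prec G n (int j + 1) l \<and> l \<ge> 0 \<longrightarrow> entry G n z j' l = 0"
      and c: "j < c \<and> c < n + mid G"
    show "z $$ (pos G n j', c) = 0"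
    proof (cases "c < n")
      case True
      have "int c + 1 \<in> labels G n" "prec G n (int j + 1) (int c + 1)" "int c + 1 \<ge> 0"
        using True c by (auto simp: labels_def prec_def pos_pos)
      thus ?thesis using R[rule_format, of "int c + 1"] by (simp add: entry_def pos_pos)
    next
      case False
      hence cn: "c = n" "G = O_odd" using c by (auto simp: mid_def split: if_splits)
      have "0 \<in> labels G n" "prec G n (int j + 1) 0" using cn c by (auto simp: labels_def prec_def pos_pos pos_zero)
      thus ?thesis using R[rule_format, of 0] cn by (simp add: entry_def pos_zero)
    qed
  next
    fix l assume R: "\<forall>c. j < c \<and> c < n + mid G \<longrightarrow> z $$ (pos G n j', c) = 0"
      and l: "l \<in> labels G n" "prec G n (int j + 1) l \<and> l \<ge> 0"
    have "j < pos G n l \<and> pos G n l < n + mid G"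
      using l that by (auto simp: labels_def prec_def pos_pos) (auto simp: pos_def mid_def split: if_splits)
    thus "entry G n z j' l = 0" using R by (simp add: entry_def)
  qed
  show ?thesis
    using \<alpha>(1)
  proof (cases rule: rootsE)
    case (Minus i j)
    have e: "min n (dimn G n - 1 - l) = j" "k = i" and l: "\<not> (l < c \<and> c < n + mid G)" for c
      using Minus \<alpha>(2) by (auto simp: dimn_def)
    show ?thesis unfolding Minus(1) e U_root.simps mem_Collect_eq Q using l by (auto simp: entry_def pos_pos)
  next
    case (Plus i j)
    have e: "min n (dimn G n - 1 - l) = n" "k = i" "l = j"
      using Plus \<alpha>(2) by (auto simp: dimn_def)
    show ?thesis unfolding Plus(1) e(1) U_root.simps mem_Collect_eq Q' QL[OF Plus(3)] unfolding e(2,3) by (simp add: entry_def pos_pos)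
  next
    case (Twice i)
    have e: "min n (dimn G n - 1 - l) = n" "k = i" "l = i" "mid G = 0"
      using Twice \<alpha>(2) by (auto simp: dimn_def mid_def)
    show ?thesis unfolding Twice(1) e(1) U_root.simps mem_Collect_eq Q' unfolding e(2-) by (auto simp: entry_def pos_pos)
  next
    case (Single i)
    have e: "min n (dimn G n - 1 - l) = n" "k = i" "l = n" "mid G = 1"
      using Single \<alpha>(2) by (auto simp: dimn_def mid_def)
    show ?thesis unfolding Single(1) e(1) U_root.simps mem_Collect_eq Q' unfolding e(2-) by (auto simp: entry_def pos_pos)
  qed
qed

lemma root_character_eq:
  assumes \<alpha>: "\<alpha> \<in> roots G n" "root_pair G n \<alpha> = (k, l)"
  shows "root_character G n \<theta> \<alpha> r z = \<theta> (r * z $$ (k, dimn G n - 1 - l))"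
  using \<alpha>(1)
proof (cases rule: rootsE)
  case (Minus i j)
  hence "k = i" "dimn G n - 1 - l = j" using \<alpha>(2) by (auto simp: dimn_def)
  thus ?thesis using Minus
    by (simp add: root_character_def positive_entry_simps entry_def pos_pos)
next
  case (Plus i j)
  have "positive_entry G n (Plus (int i + 1) (int j + 1)) = (int i + 1, - (int j + 1))"
    using Plus by (intro positive_entry_simps) auto
  thus ?thesis using \<alpha>(2) Plus pos_neg[of j n G] by (simp add: root_character_def entry_def pos_pos)
next
  case (Twice i)
  have "positive_entry G n (Twice (int i + 1)) = (int i + 1, - (int i + 1))"
    using Twice by (intro positive_entry_simps) auto
  moreover have "k = i" "l = i" using \<alpha>(2) Twice by auto
  ultimately show ?thesis using Twice pos_neg[of i n G] by (simp add: root_character_def entry_def pos_pos)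
next
  case (Single i)
  thus ?thesis using \<alpha>(2)
    by (simp add: root_character_def positive_entry_simps entry_def pos_pos pos_zero dimn_def mid_def)
qed

section \<open>Normal forms and basic pairs\<close>

definition superform :: "group_type \<Rightarrow> nat \<Rightarrow> root set \<Rightarrow> (root \<Rightarrow> 'a::field) \<Rightarrow> 'a mat" where
  "superform G n D \<phi> = e_mat G n D \<phi> * gram G n"

definition normal_form :: "group_type \<Rightarrow> nat \<Rightarrow> 'a::field mat \<Rightarrow> bool" where
  "normal_form G n b \<longleftrightarrow> eps_symmetric (dimn G n) (form_eps G) b \<and> monomial (dimn G n) b \<and>
     (\<forall>i<dimn G n. \<forall>j<dimn G n. dimn G n \<le> i + j + 1 \<longrightarrow> b $$ (i, j) = 0)"

lemma e_mat_carrier [simp]: "e_mat G n D \<phi> \<in> carrier_mat (dimn G n) (dimn G n)"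
  by (simp add: e_mat_def)

lemma superform_carrier [simp]: "superform G n D \<phi> \<in> carrier_mat (dimn G n) (dimn G n)"
  by (simp add: superform_def mult_carrier_mat[of _ "dimn G n" "dimn G n" _ "dimn G n"])

lemma superform_entry:
  fixes \<phi> :: "root \<Rightarrow> 'a::field"
  assumes D: "D \<subseteq> roots G n" and st: "s < dimn G n" "t < dimn G n"
  shows "superform G n D \<phi> $$ (s, t) = (\<Sum>\<alpha>\<in>D. case root_pair G n \<alpha> of (k, l) \<Rightarrow>
    \<phi> \<alpha> * form_sign G n (dimn G n - 1 - l) *
      ((if s = k \<and> t = l then 1 else 0) + (if s = l \<and> t = k \<and> k \<noteq> l then form_eps G else 0)))"
proof -
  have t': "dimn G n - 1 - t < dimn G n" using st by auto
  have "superform G n D \<phi> $$ (s, t) =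
    (\<Sum>\<alpha>\<in>D. \<phi> \<alpha> * root_matrix G n \<alpha> $$ (s, dimn G n - 1 - t)) * form_sign G n (dimn G n - 1 - t)"
    unfolding superform_def mult_gram_entry[OF e_mat_carrier st] using st t' by (simp add: e_mat_def)
  also have "\<dots> = (\<Sum>\<alpha>\<in>D. \<phi> \<alpha> * (root_matrix G n \<alpha> $$ (s, dimn G n - 1 - t) * form_sign G n (dimn G n - 1 - t)))"
    by (simp only: sum_distrib_right mult.assoc)
  also have "\<dots> = (\<Sum>\<alpha>\<in>D. case root_pair G n \<alpha> of (k, l) \<Rightarrow>
    \<phi> \<alpha> * form_sign G n (dimn G n - 1 - l) *
      ((if s = k \<and> t = l then 1 else 0) + (if s = l \<and> t = k \<and> k \<noteq> l then form_eps G else 0)))"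
  proof (rule sum.cong[OF refl])
    fix \<alpha> assume "\<alpha> \<in> D"
    hence \<alpha>: "\<alpha> \<in> roots G n" using D by blast
    obtain k l where kl: "root_pair G n \<alpha> = (k, l)" by fastforce
    show "\<phi> \<alpha> * (root_matrix G n \<alpha> $$ (s, dimn G n - 1 - t) * form_sign G n (dimn G n - 1 - t)) =
      (case root_pair G n \<alpha> of (k, l) \<Rightarrow> \<phi> \<alpha> * form_sign G n (dimn G n - 1 - l) *
      ((if s = k \<and> t = l then 1 else 0) + (if s = l \<and> t = k \<and> k \<noteq> l then form_eps G else 0)))"
      unfolding root_matrix_entry[OF \<alpha> kl st] kl prod.case by (rule mult.assoc[symmetric])
  qed
  finally show ?thesis .
qed

lemma superform_nonzero:
  assumes D: "D \<subseteq> roots G n" and st: "s < dimn G n" "t < dimn G n" and nz: "superform G n D \<phi> $$ (s, t) \<noteq> 0"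
  obtains \<alpha> where "\<alpha> \<in> D" "root_pair G n \<alpha> = (s, t) \<or> root_pair G n \<alpha> = (t, s)"
proof -
  obtain \<alpha> where \<alpha>: "\<alpha> \<in> D" "(case root_pair G n \<alpha> of (k, l) \<Rightarrow> \<phi> \<alpha> * form_sign G n (dimn G n - 1 - l) *
      ((if s = k \<and> t = l then 1 else 0) + (if s = l \<and> t = k \<and> k \<noteq> l then form_eps G else 0))) \<noteq> 0"
    using nz unfolding superform_entry[OF D st] by (rule sum.not_neutral_contains_not_neutral)
  obtain k l where kl: "root_pair G n \<alpha> = (k, l)" by fastforce
  have "(s = k \<and> t = l) \<or> (s = l \<and> t = k)"
  proof (rule ccontr)
    assume n: "\<not> ?thesis"
    have a: "\<not> (s = k \<and> t = l)" and b: "\<not> (s = l \<and> t = k \<and> k \<noteq> l)" using n by blast+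
    show False using \<alpha>(2) unfolding kl prod.case if_not_P[OF a] if_not_P[OF b] by simp
  qed
  thus ?thesis using that[OF \<alpha>(1)] kl by blast
qed

lemma basic_disjoint:
  assumes "basic G n D" "\<alpha> \<in> D" "\<beta> \<in> D" "root_pair G n \<alpha> = (k, l)" "root_pair G n \<beta> = (k', l')"
    "s \<in> {k, l}" "s \<in> {k', l'}"
  shows "\<alpha> = \<beta>"
proof (rule ccontr)
  assume "\<alpha> \<noteq> \<beta>"
  hence "{k, l} \<inter> {k', l'} = {}"
    using assms(1)[unfolded basic_iff_disjoint, THEN conjunct2, rule_format, OF assms(2-5)] by blast
  thus False using assms(6,7) by blast
qed

lemma superform_at_pair:
  fixes \<phi> :: "root \<Rightarrow> 'a::field"
  assumes B: "basic G n D" and \<alpha>: "\<alpha> \<in> D" "root_pair G n \<alpha> = (k, l)"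
  shows "superform G n D \<phi> $$ (k, l) = \<phi> \<alpha> * form_sign G n (dimn G n - 1 - l)"
proof -
  have D: "D \<subseteq> roots G n" using B by (simp add: basic_def)
  have P: "(k, l) \<in> pairs G n" using root_pair_in_pairs[of \<alpha>] D \<alpha> by (metis subsetD)
  have lt: "k < dimn G n" "l < dimn G n" using P by (auto simp: pairs_def)
  let ?f = "\<lambda>\<beta>. case root_pair G n \<beta> of (k', l') \<Rightarrow> \<phi> \<beta> * form_sign G n (dimn G n - 1 - l') *
      ((if k = k' \<and> l = l' then 1 else 0) + (if k = l' \<and> l = k' \<and> k' \<noteq> l' then form_eps G else 0))"
  have "superform G n D \<phi> $$ (k, l) = (\<Sum>\<beta>\<in>D. ?f \<beta>)" by (rule superform_entry[OF D lt])
  also have "\<dots> = (\<Sum>\<beta>\<in>{\<alpha>}. ?f \<beta>)"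
  proof (rule sum.mono_neutral_right)
    show "finite D" using finite_subset[OF D finite_roots] .
    show "\<forall>\<beta>\<in>D - {\<alpha>}. ?f \<beta> = 0"
    proof
      fix \<beta> assume \<beta>: "\<beta> \<in> D - {\<alpha>}"
      obtain k' l' where kl': "root_pair G n \<beta> = (k', l')" by fastforce
      have "k \<notin> {k', l'}" using basic_disjoint[OF B \<alpha>(1) _ \<alpha>(2) kl', of k] \<beta> by blast
      thus "?f \<beta> = 0" unfolding kl' by simp
    qed
  qed (use \<alpha> in auto)
  also have "\<dots> = ?f \<alpha>"
  proof -
    have "sum f {\<alpha>} = f \<alpha>" for f :: "root \<Rightarrow> 'a" by simp
    thus ?thesis .
  qed
  also have "\<dots> = \<phi> \<alpha> * form_sign G n (dimn G n - 1 - l)"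
  proof -
    have c: "\<not> (k = l \<and> l = k \<and> k \<noteq> l)" and d: "k = k \<and> l = l" by blast+
    show ?thesis unfolding \<alpha>(2) prod.case if_not_P[OF c] if_P[OF d] by simp
  qed
  finally show ?thesis .
qed

lemma form_sign_nonzero [simp]: "form_sign G n i \<noteq> 0"
  by (simp add: form_sign_def)

lemma superform_eps_symmetric:
  fixes \<phi> :: "root \<Rightarrow> 'a::field"
  assumes D: "D \<subseteq> roots G n"
  shows "eps_symmetric (dimn G n) (form_eps G) (superform G n D \<phi>)"
proof -
  have "superform G n D \<phi> $$ (t, s) = form_eps G * superform G n D \<phi> $$ (s, t)"
    if st: "s < dimn G n" "t < dimn G n" for s t
    unfolding superform_entry[OF D st] superform_entry[OF D st(2,1)] sum_distrib_left
  proof (rule sum.cong[OF refl])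
    fix \<alpha> assume "\<alpha> \<in> D"
    obtain k l where kl: "root_pair G n \<alpha> = (k, l)" by fastforce
    have "(k, l) \<in> pairs G n" using root_pair_in_pairs[of \<alpha>] D \<open>\<alpha> \<in> D\<close> kl by (metis subsetD)
    hence Sp: "k = l \<Longrightarrow> form_eps G = (1::'a)" by (auto simp: pairs_def form_eps_def)
    have e2: "form_eps G * form_eps G = (1::'a)" by (simp add: form_eps_def)
    have "(if t = k \<and> s = l then 1 else 0) + (if t = l \<and> s = k \<and> k \<noteq> l then form_eps G else 0) =
      form_eps G * ((if s = k \<and> t = l then 1 else 0) + (if s = l \<and> t = k \<and> k \<noteq> l then form_eps G else (0::'a)))"
    proof (cases "k = l")
      case True
      thus ?thesis using Sp by (cases "s = l"; cases "t = l") simp_all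
    next
      case False
      thus ?thesis using e2 by (cases "s = k"; cases "s = l"; cases "t = k"; cases "t = l") simp_all
    qed
    thus "(case root_pair G n \<alpha> of (k, l) \<Rightarrow> \<phi> \<alpha> * form_sign G n (dimn G n - 1 - l) *
        ((if t = k \<and> s = l then 1 else 0) + (if t = l \<and> s = k \<and> k \<noteq> l then form_eps G else 0))) =
      form_eps G * (case root_pair G n \<alpha> of (k, l) \<Rightarrow> \<phi> \<alpha> * form_sign G n (dimn G n - 1 - l) *
        ((if s = k \<and> t = l then 1 else 0) + (if s = l \<and> t = k \<and> k \<noteq> l then form_eps G else 0)))"
      unfolding kl prod.case by (simp only: mult.left_commute)
  qed
  thus ?thesis unfolding eps_symmetric_def using superform_carrier by blast
qed

lemma superform_normal_form:
  fixes \<phi> :: "root \<Rightarrow> 'a::field"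
  assumes B: "basic G n D"
  shows "normal_form G n (superform G n D \<phi>)"
proof -
  let ?m = "dimn G n" and ?b = "superform G n D \<phi>"
  have D: "D \<subseteq> roots G n" using B by (simp add: basic_def)
  have P: "root_pair G n \<alpha> \<in> pairs G n" if "\<alpha> \<in> D" for \<alpha> using root_pair_in_pairs D that by blast
  have "?b $$ (i, j) = 0" if ij: "i < ?m" "j < ?m" "?m \<le> i + j + 1" for i j
  proof (rule ccontr)
    assume "?b $$ (i, j) \<noteq> 0"
    then obtain \<alpha> where "\<alpha> \<in> D" "root_pair G n \<alpha> = (i, j) \<or> root_pair G n \<alpha> = (j, i)"
      using superform_nonzero[OF D ij(1,2)] by blast
    thus False using P[of \<alpha>] ij(3) by (auto simp: pairs_def)
  qed
  moreover have row: "t = t'" if st: "s < ?m" "t < ?m" "t' < ?m" "?b $$ (s, t) \<noteq> 0" "?b $$ (s, t') \<noteq> 0" for s t t'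
  proof -
    obtain \<alpha> where \<alpha>: "\<alpha> \<in> D" "root_pair G n \<alpha> = (s, t) \<or> root_pair G n \<alpha> = (t, s)"
      using superform_nonzero[OF D st(1,2,4)] by blast
    obtain \<beta> where \<beta>: "\<beta> \<in> D" "root_pair G n \<beta> = (s, t') \<or> root_pair G n \<beta> = (t', s)"
      using superform_nonzero[OF D st(1,3,5)] by blast
    obtain k l where kl: "root_pair G n \<alpha> = (k, l)" by fastforce
    obtain k' l' where kl': "root_pair G n \<beta> = (k', l')" by fastforce
    have "\<alpha> = \<beta>" using basic_disjoint[OF B \<alpha>(1) \<beta>(1) kl kl', of s] \<alpha>(2) \<beta>(2) kl kl' by auto
    thus ?thesis using \<alpha>(2) \<beta>(2) P[OF \<alpha>(1)] by auto
  qed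
  moreover have sym: "eps_symmetric ?m (form_eps G) ?b" by (rule superform_eps_symmetric[OF D])
  moreover have "s = s'" if st: "t < ?m" "s < ?m" "s' < ?m" "?b $$ (s, t) \<noteq> 0" "?b $$ (s', t) \<noteq> 0" for s s' t
  proof -
    have f: "?b $$ (t, s) \<noteq> 0" if "s < ?m" "?b $$ (s, t) \<noteq> 0" for s
    proof
      assume "?b $$ (t, s) = 0"
      moreover have "?b $$ (s, t) = form_eps G * ?b $$ (t, s)" using sym st(1) that(1) unfolding eps_symmetric_def by blast
      ultimately show False using that(2) by simp
    qed
    show ?thesis using row[OF st(1,2,3) f[OF st(2,4)] f[OF st(3,5)]] .
  qed
  ultimately show ?thesis unfolding normal_form_def monomial_def by blast
qed

text \<open>Entries below the diagonal follow by symmetry, and the diagonal of a skew form vanishes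
  since 2 is invertible; what is left are the positions in \<open>pairs\<close> and those that
  \<open>supp\<close> compares.\<close>

lemma eps_symmetric_eqI:
  fixes b :: "'a::field mat"
  assumes two: "(2::'a) \<noteq> 0" and b: "eps_symmetric (dimn G n) (form_eps G) b" "eps_symmetric (dimn G n) (form_eps G) b'"
    and supp: "\<And>i j. i < dimn G n \<Longrightarrow> j < dimn G n \<Longrightarrow> dimn G n \<le> i + j + 1 \<Longrightarrow> b $$ (i, j) = b' $$ (i, j)"
    and eq: "\<And>k l. (k, l) \<in> pairs G n \<Longrightarrow> b $$ (k, l) = b' $$ (k, l)"
  shows "b = b'"
proof -
  let ?m = "dimn G n"
  have sb: "b $$ (j, i) = form_eps G * b $$ (i, j)" "b' $$ (j, i) = form_eps G * b' $$ (i, j)"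
    if "i < ?m" "j < ?m" for i j using b that unfolding eps_symmetric_def by blast+
  have diag: "c $$ (i, i) = 0" if "G \<noteq> Sp" "i < ?m" "eps_symmetric (dimn G n) (form_eps G) c" for i and c :: "'a mat"
  proof -
    have "c $$ (i, i) = form_eps G * c $$ (i, i)" using that unfolding eps_symmetric_def by blast
    hence "c $$ (i, i) = - c $$ (i, i)" using that(1) unfolding form_eps_def by (metis mult_minus1)
    hence "2 * c $$ (i, i) = 0" by (metis add.right_inverse mult_2)
    thus ?thesis using two by simp
  qed
  have le: "b $$ (i, j) = b' $$ (i, j)" if ij: "i \<le> j" "j < ?m" for i j
  proof -
    have i: "i < ?m" using ij by simp
    have "?m \<le> i + j + 1 \<or> (i = j \<and> G \<noteq> Sp) \<or> (i, j) \<in> pairs G n"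
      using ij by (auto simp: pairs_def)
    then consider "?m \<le> i + j + 1" | "i = j" "G \<noteq> Sp" | "(i, j) \<in> pairs G n" by blast
    thus ?thesis
    proof cases
      case 1
      thus ?thesis using supp[OF i ij(2)] by blast
    next
      case 2
      thus ?thesis using diag[OF 2(2) ij(2) b(1)] diag[OF 2(2) ij(2) b(2)] by simp
    next
      case 3
      thus ?thesis by (rule eq)
    qed
  qed
  have "b $$ (i, j) = b' $$ (i, j)" if ij: "i < ?m" "j < ?m" for i j
  proof (cases "i \<le> j")
    case False
    hence "b $$ (j, i) = b' $$ (j, i)" using le[of j i] ij by simp
    thus ?thesis unfolding sb(1)[OF ij(2,1)] sb(2)[OF ij(2,1)] by simp
  qed (use le ij in blast)
  moreover have "b \<in> carrier_mat ?m ?m" "b' \<in> carrier_mat ?m ?m" using b unfolding eps_symmetric_def by blast+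
  ultimately show ?thesis by (intro eq_matI) auto
qed

text \<open>The roots are read off from the non-zero entries, every position in \<open>pairs\<close>
  being the pair of a root. Having at most one entry in each row makes the pairs disjoint, hence
  \<open>D\<close> basic.\<close>

lemma normal_form_superform:
  fixes b :: "'a::field mat"
  assumes two: "(2::'a) \<noteq> 0" and b: "normal_form G n b"
  obtains D \<phi> where "basic_pair G n D \<phi>" "superform G n D \<phi> = b"
proof -
  let ?m = "dimn G n"
  have sym: "eps_symmetric ?m (form_eps G) b" and mono: "monomial ?m b"
    and supp: "\<And>i j. i < ?m \<Longrightarrow> j < ?m \<Longrightarrow> ?m \<le> i + j + 1 \<Longrightarrow> b $$ (i, j) = 0"
    using b by (auto simp: normal_form_def)
  have sb: "b $$ (j, i) = form_eps G * b $$ (i, j)" if "i < ?m" "j < ?m" for i j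
    using sym that unfolding eps_symmetric_def by blast
  have sb0: "b $$ (j, i) \<noteq> 0" if "i < ?m" "j < ?m" "b $$ (i, j) \<noteq> 0" for i j
    using sb[OF that(1,2)] that(3) form_eps_cases[of G, where ?'a = 'a] by auto
  define D where "D = {\<alpha> \<in> roots G n. b $$ root_pair G n \<alpha> \<noteq> 0}"
  \<comment> \<open>Dividing by the sign undoes the factor that Omega puts on the entry at the pair,
    see \<open>superform_at_pair\<close>.\<close>
  define \<phi> where "\<phi> = restrict (\<lambda>\<alpha>. b $$ root_pair G n \<alpha> / form_sign G n (?m - 1 - snd (root_pair G n \<alpha>))) D"
  have D: "D \<subseteq> roots G n" by (auto simp: D_def)
  have P: "k \<le> l" "k < ?m" "l < ?m" if "\<alpha> \<in> D" "root_pair G n \<alpha> = (k, l)" for \<alpha> k l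
  proof -
    have "(k, l) \<in> pairs G n" using root_pair_in_pairs[of \<alpha>] D that by (metis subsetD)
    thus "k \<le> l" "k < ?m" "l < ?m" by (auto simp: pairs_def)
  qed
  have basic: "basic G n D"
    unfolding basic_iff_disjoint
  proof (intro conjI D ballI allI impI)
    fix \<alpha> \<beta> k l k' l'
    assume ab: "\<alpha> \<in> D" "\<beta> \<in> D" "root_pair G n \<alpha> = (k, l)" "root_pair G n \<beta> = (k', l')" "\<alpha> \<noteq> \<beta>"
    note p = P[OF ab(1,3)] P[OF ab(2,4)]
    have nz: "b $$ (k, l) \<noteq> 0" "b $$ (k', l') \<noteq> 0" using ab by (auto simp: D_def)
    note nz' = sb0[OF p(2,3) nz(1)] sb0[OF p(5,6) nz(2)]
    show "{k, l} \<inter> {k', l'} = {}"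
    proof (rule ccontr)
      assume "\<not> ?thesis"
      then obtain s where s: "s \<in> {k, l}" "s \<in> {k', l'}" by auto
      obtain t where t: "(s, t) = (k, l) \<or> (s, t) = (l, k)" using s by auto
      obtain t' where t': "(s, t') = (k', l') \<or> (s, t') = (l', k')" using s by auto
      have "s < ?m" "t < ?m" "t' < ?m" "b $$ (s, t) \<noteq> 0" "b $$ (s, t') \<noteq> 0"
        using t t' p nz nz' by auto
      hence "t = t'" using mono unfolding monomial_def by blast
      hence "(k, l) = (k', l')" using t t' p(1,4) by auto
      thus False using inj_onD[OF inj_root_pair[of G n], of \<alpha> \<beta>] D ab by auto
    qed
  qed
  have bp: "basic_pair G n D \<phi>"
    unfolding basic_pair_def using basic by (auto simp: \<phi>_def D_def)
  have sf: "normal_form G n (superform G n D \<phi>)" by (rule superform_normal_form[OF basic])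
  have "superform G n D \<phi> = b"
  proof (rule eps_symmetric_eqI[OF two _ sym])
    show "eps_symmetric ?m (form_eps G) (superform G n D \<phi>)" using sf by (simp add: normal_form_def)
    show "superform G n D \<phi> $$ (i, j) = b $$ (i, j)" if "i < ?m" "j < ?m" "?m \<le> i + j + 1" for i j
      using sf supp[OF that] that by (simp add: normal_form_def)
    fix k l assume kl: "(k, l) \<in> pairs G n"
    hence lt: "k < ?m" "l < ?m" "k \<le> l" by (auto simp: pairs_def)
    obtain \<alpha> where \<alpha>: "\<alpha> \<in> roots G n" "root_pair G n \<alpha> = (k, l)" using root_pair_surj[OF kl] by blast
    show "superform G n D \<phi> $$ (k, l) = b $$ (k, l)"
    proof (cases "\<alpha> \<in> D")
      case True
      thus ?thesis unfolding superform_at_pair[OF basic True \<alpha>(2)] using \<alpha>(2) by (simp add: \<phi>_def)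
    next
      case False
      hence b0: "b $$ (k, l) = 0" using \<alpha> by (simp add: D_def)
      have "superform G n D \<phi> $$ (k, l) = 0"
      proof (rule ccontr)
        assume "superform G n D \<phi> $$ (k, l) \<noteq> 0"
        then obtain \<beta> where \<beta>: "\<beta> \<in> D" "root_pair G n \<beta> = (k, l) \<or> root_pair G n \<beta> = (l, k)"
          using superform_nonzero[OF D lt(1,2)] by blast
        hence "root_pair G n \<beta> = (k, l)" using P(1)[OF \<beta>(1)] lt by force
        hence "\<alpha> = \<beta>" using inj_onD[OF inj_root_pair[of G n], of \<alpha> \<beta>] \<alpha> \<beta> D by auto
        thus False using False \<beta> by simp
      qed
      thus ?thesis using b0 by simp
    qed
  qed
  thus ?thesis using that bp by blast
qed

lemma superform_inj:
  fixes \<phi> :: "root \<Rightarrow> 'a::field"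
  assumes B: "basic_pair G n D \<phi>" "basic_pair G n D' \<phi>'" and eq: "superform G n D \<phi> = superform G n D' \<phi>'"
  shows "D = D'" "\<phi> = \<phi>'"
proof -
  have b: "basic G n D" "basic G n D'" and ph: "\<phi> \<in> D \<rightarrow>\<^sub>E (UNIV - {0})" "\<phi>' \<in> D' \<rightarrow>\<^sub>E (UNIV - {0})"
    using B by (auto simp: basic_pair_def)
  have sub: "\<alpha> \<in> D'"
    if b: "basic G n D" "basic G n D'" and ph: "\<phi> \<in> D \<rightarrow>\<^sub>E (UNIV - {0})"
      and eq: "superform G n D \<phi> = superform G n D' \<phi>'" and \<alpha>: "\<alpha> \<in> D"
    for D D' \<alpha> and \<phi> \<phi>' :: "root \<Rightarrow> 'a"
  proof -
    have DD: "D \<subseteq> roots G n" "D' \<subseteq> roots G n" using b by (auto simp: basic_def)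
    obtain k l where kl: "root_pair G n \<alpha> = (k, l)" by fastforce
    have "(k, l) \<in> pairs G n" using root_pair_in_pairs[of \<alpha>] DD \<alpha> kl by (metis subsetD)
    hence lt: "k < dimn G n" "l < dimn G n" "k \<le> l" by (auto simp: pairs_def)
    have "superform G n D' \<phi>' $$ (k, l) \<noteq> 0"
      unfolding eq[symmetric] superform_at_pair[OF b(1) \<alpha> kl] using ph \<alpha> by auto
    then obtain \<beta> where \<beta>: "\<beta> \<in> D'" "root_pair G n \<beta> = (k, l) \<or> root_pair G n \<beta> = (l, k)"
      using superform_nonzero[OF DD(2) lt(1,2)] by blast
    have "root_pair G n \<beta> \<in> pairs G n" using root_pair_in_pairs \<beta> DD by blast
    hence "root_pair G n \<beta> = (k, l)" using \<beta>(2) lt by (auto simp: pairs_def)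
    hence "\<alpha> = \<beta>" using inj_onD[OF inj_root_pair[of G n], of \<alpha> \<beta>] \<alpha> \<beta> DD kl by auto
    thus ?thesis using \<beta> by simp
  qed
  show D: "D = D'" using sub[OF b ph(1) eq] sub[OF b(2,1) ph(2) eq[symmetric]] by blast
  show "\<phi> = \<phi>'"
  proof (rule ext)
    fix \<alpha>
    show "\<phi> \<alpha> = \<phi>' \<alpha>"
    proof (cases "\<alpha> \<in> D")
      case True
      obtain k l where kl: "root_pair G n \<alpha> = (k, l)" by fastforce
      have "\<phi> \<alpha> * form_sign G n (dimn G n - 1 - l) = \<phi>' \<alpha> * form_sign G n (dimn G n - 1 - l)"
        using superform_at_pair[OF b(1) True kl, of \<phi>] superform_at_pair[OF b(2) _ kl, of \<phi>'] True D eq by simp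
      thus ?thesis by simp
    next
      case False
      \<comment> \<open>Outside \<open>D\<close> both functions are \<open>undefined\<close>, being
        members of an extensional function space.\<close>
      thus ?thesis using ph D by (auto simp: PiE_def extensional_def)
    qed
  qed
qed

section \<open>Superclasses as congruence orbits\<close>

lemma superclass_iff:
  fixes \<phi> :: "root \<Rightarrow> 'a::{field,finite}"
  assumes two: "(2::'a) \<noteq> 0" and B: "basic_pair G n D \<phi>"
  shows "x \<in> superclass G n D \<phi> \<longleftrightarrow> x \<in> U_set G n \<and>
    (\<exists>g\<in>unitriangular (dimn G n). g * cayley G n x * g\<^sup>T = superform G n D \<phi>)"
proof (cases "x \<in> U_set G n")
  case True
  have "monomial (dimn G n) (e_mat G n D \<phi> * gram G n)"
    using superform_normal_form[of G n D \<phi>] B by (simp add: normal_form_def basic_pair_def superform_def)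
  from two_sided_orbit_iff_congruence[OF refl two True e_mat_carrier this]
  show ?thesis using True unfolding superclass_def V_set_def superform_def by auto
qed (simp add: superclass_def)

text \<open>The normal form is itself the Cayley transform of an element of U.\<close>

lemma superclass_nonempty:
  fixes \<phi> :: "root \<Rightarrow> 'a::{field,finite}"
  assumes two: "(2::'a) \<noteq> 0" and B: "basic_pair G n D \<phi>"
  shows "superclass G n D \<phi> \<noteq> {}"
proof -
  let ?b = "superform G n D \<phi>"
  have nf: "normal_form G n ?b" using B by (intro superform_normal_form) (simp add: basic_pair_def)
  obtain x where x: "x \<in> U_set G n" "cayley G n x = ?b"
    by (rule cayley_surj[OF refl two, of G n ?b]) (use nf in \<open>auto simp: normal_form_def\<close>)
  have "1\<^sub>m (dimn G n) * ?b * (1\<^sub>m (dimn G n))\<^sup>T = ?b"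
    using left_mult_one_mat[OF superform_carrier[of G n D \<phi>]] right_mult_one_mat[OF superform_carrier[of G n D \<phi>]]
    by simp
  hence "x \<in> superclass G n D \<phi>"
    unfolding superclass_iff[OF two B] using x one_unitriangular by metis
  thus ?thesis by blast
qed

text \<open>If g b g^T = E and h b h^T = E', then (h g^(-1)) E = E' (g h^(-1))^T, which is the
  situation of \<open>monomial_unique\<close>.\<close>

lemma superclass_disjoint:
  fixes \<phi> :: "root \<Rightarrow> 'a::{field,finite}"
  assumes two: "(2::'a) \<noteq> 0" and B: "basic_pair G n D \<phi>" "basic_pair G n D' \<phi>'"
    and x: "x \<in> superclass G n D \<phi>" "x \<in> superclass G n D' \<phi>'"
  shows "D = D'" "\<phi> = \<phi>'"
proof -
  let ?m = "dimn G n"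
  let ?E = "superform G n D \<phi>" and ?E' = "superform G n D' \<phi>'" and ?b = "cayley G n x"
  have xT: "x \<in> unitriangular ?m" using x(1) by (simp add: superclass_def U_set_iff)
  have bc: "?b \<in> carrier_mat ?m ?m" by (rule cayley_props(1)[OF refl two xT])
  obtain g h where g: "g \<in> unitriangular ?m" "g * ?b * g\<^sup>T = ?E"
    and h: "h \<in> unitriangular ?m" "h * ?b * h\<^sup>T = ?E'"
    using x superclass_iff[OF two B(1)] superclass_iff[OF two B(2)] by blast
  obtain g' where g': "g' \<in> unitriangular ?m" "g * g' = 1\<^sub>m ?m" "g' * g = 1\<^sub>m ?m" using unitriangular_inverse[OF g(1)] by blast
  obtain h' where h': "h' \<in> unitriangular ?m" "h * h' = 1\<^sub>m ?m" "h' * h = 1\<^sub>m ?m" using unitriangular_inverse[OF h(1)] by blast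
  note c = unitriangularD(1)[OF g(1)] unitriangularD(1)[OF h(1)] unitriangularD(1)[OF g'(1)] unitriangularD(1)[OF h'(1)] bc
  note S = square_mat_simps[where m = ?m]
  have a: "g' * (g * A) = A" if "A \<in> carrier_mat ?m ?m" for A
    using that c g'(3) assoc_mult_mat[of g' ?m ?m g ?m A ?m] by simp
  have t: "h\<^sup>T * (h'\<^sup>T * A) = A" if "A \<in> carrier_mat ?m ?m" for A
  proof -
    have "h\<^sup>T * h'\<^sup>T = 1\<^sub>m ?m" using h'(3) c transpose_mult[of h' ?m ?m h ?m] by simp
    thus ?thesis using that c assoc_mult_mat[of "h\<^sup>T" ?m ?m "h'\<^sup>T" ?m A ?m] by simp
  qed
  have "(h * g') * ?E = ?E' * (g * h')\<^sup>T"
    unfolding g(2)[symmetric] h(2)[symmetric] using c by (simp add: S a t)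
  moreover have "monomial ?m ?E" "monomial ?m ?E'"
    using superform_normal_form[of G n] B by (auto simp: normal_form_def basic_pair_def)
  moreover have "((g * h')\<^sup>T)\<^sup>T \<in> unitriangular ?m"
    using mult_unitriangular[OF g(1) h'(1)] by simp
  ultimately have "?E = ?E'"
    using monomial_unique[OF mult_unitriangular[OF h(1) g'(1)] _ superform_carrier _ superform_carrier] by blast
  thus "D = D'" "\<phi> = \<phi>'" using superform_inj[OF B] by blast+
qed

text \<open>By \<open>cayley_supported_form\<close> and \<open>cayley_surj\<close> these are, for 2
  invertible over a finite field, the Cayley transforms of U. Unlike U itself under conjugation,
  they are stable under the action of the whole unitriangular group.\<close>

definition supported_form :: "group_type \<Rightarrow> nat \<Rightarrow> 'a::field mat \<Rightarrow> bool" where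
  "supported_form G n C \<longleftrightarrow> eps_symmetric (dimn G n) (form_eps G) C \<and>
     (\<forall>i<dimn G n. \<forall>j<dimn G n. dimn G n \<le> i + j + 1 \<longrightarrow> C $$ (i, j) = 0)"

lemma cayley_supported_form:
  fixes x :: "'a::{field,finite} mat"
  assumes "(2::'a) \<noteq> 0" "x \<in> U_set G n"
  shows "supported_form G n (cayley G n x)"
  using cayley_eps_symmetric[OF refl assms] cayley_support[OF refl assms(1) assms(2)[unfolded U_set_iff, THEN conjunct1]]
  unfolding supported_form_def by blast

text \<open>Entry (i, j) of g B g^T involves only entries (a, b) of \<open>B\<close> with a \<ge> i
  and b \<ge> j, so zeros on and below the anti-diagonal persist.\<close>

lemma supported_form_congruence:
  fixes B :: "'a::field mat"
  assumes g: "g \<in> unitriangular (dimn G n)" and B: "supported_form G n B"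
  shows "supported_form G n (g * B * g\<^sup>T)"
proof -
  let ?m = "dimn G n"
  have sym: "eps_symmetric ?m (form_eps G) B" and Bs: "\<And>i j. i < ?m \<Longrightarrow> j < ?m \<Longrightarrow> ?m \<le> i + j + 1 \<Longrightarrow> B $$ (i, j) = 0"
    using B unfolding supported_form_def by blast+
  have Bc: "B \<in> carrier_mat ?m ?m" using sym by (simp add: eps_symmetric_def)
  have "(g * B * g\<^sup>T) $$ (i, j) = 0" if ij: "i < ?m" "j < ?m" "?m \<le> i + j + 1" for i j
    unfolding congruence_entry[OF unitriangularD(1)[OF g] Bc ij(1,2)]
  proof (rule sum.neutral, rule ballI)
    fix a assume a: "a \<in> {..<?m}"
    have "g $$ (j, b) * B $$ (a, b) = 0" if "i \<le> a" "b < ?m" for b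
    proof (cases "b < j")
      case True
      thus ?thesis using unitriangularD(2)[OF g True ij(2)] by simp
    next
      case False
      hence "?m \<le> a + b + 1" using that ij(3) by simp
      thus ?thesis using Bs[of a b] a that by simp
    qed
    hence "(\<Sum>b<?m. g $$ (j, b) * B $$ (a, b)) = 0" if "i \<le> a" using that by (intro sum.neutral) auto
    thus "g $$ (i, a) * (\<Sum>b<?m. g $$ (j, b) * B $$ (a, b)) = 0"
      using unitriangularD(2)[OF g, of a i] ij(1) by (cases "i \<le> a") auto
  qed
  thus ?thesis
    using eps_symmetric_congruence[OF unitriangularD(1)[OF g] sym] unfolding supported_form_def by blast
qed

text \<open>Reduction to monomial shape keeps the support, so the result is a normal form and comes
  from a basic pair.\<close>

lemma superclass_cover:
  fixes x :: "'a::{field,finite} mat"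
  assumes two: "(2::'a) \<noteq> 0" and x: "x \<in> U_set G n"
  obtains D \<phi> where "basic_pair G n D \<phi>" "x \<in> superclass G n D \<phi>"
proof -
  let ?m = "dimn G n" and ?b = "cayley G n x"
  have sym: "eps_symmetric ?m (form_eps G) ?b" by (rule cayley_eps_symmetric[OF refl two x])
  obtain g where g: "g \<in> unitriangular ?m" "monomial ?m (g * ?b * g\<^sup>T)"
    using congruent_to_monomial[OF two form_eps_cases sym] by blast
  let ?E = "g * ?b * g\<^sup>T"
  have "supported_form G n ?E" by (rule supported_form_congruence[OF g(1) cayley_supported_form[OF two x]])
  hence "normal_form G n ?E" using g(2) by (simp add: normal_form_def supported_form_def)
  then obtain D \<phi> where "basic_pair G n D \<phi>" "superform G n D \<phi> = ?E" using normal_form_superform[OF two] by blast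
  thus ?thesis using that superclass_iff[OF two] x g(1) by metis
qed

section \<open>Elementary characters\<close>

lemma U_set_unitriangular: "z \<in> U_set G n \<Longrightarrow> z \<in> unitriangular (dimn G n)" for z :: "'a::{field,finite} mat"
  by (simp add: U_set_iff)

lemma U_set_mult:
  fixes y z :: "'a::{field,finite} mat"
  assumes y: "y \<in> U_set G n" and z: "z \<in> U_set G n"
  shows "y * z \<in> U_set G n"
proof -
  let ?m = "dimn G n"
  note c = unitriangularD(1)[OF U_set_unitriangular[OF y]] unitriangularD(1)[OF U_set_unitriangular[OF z]]
  have "(y * z) * gram G n * (y * z)\<^sup>T = y * (z * gram G n * z\<^sup>T) * y\<^sup>T"
    using c by (simp add: square_mat_simps[where m = ?m])
  also have "\<dots> = gram G n" using y z by (simp add: U_set_iff)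
  finally show ?thesis using mult_unitriangular[of y ?m z] y z by (simp add: U_set_iff)
qed

lemma U_set_one: "1\<^sub>m (dimn G n) \<in> (U_set G n :: 'a::{field,finite} mat set)"
  using left_mult_one_mat[OF gram_carrier[of G n, where ?'a = 'a]] right_mult_one_mat[OF gram_carrier[of G n, where ?'a = 'a]]
  by (simp add: U_set_iff one_unitriangular)

lemma U_set_inverse:
  fixes z :: "'a::{field,finite} mat"
  assumes z: "z \<in> U_set G n" and z': "z' \<in> unitriangular (dimn G n)" "z' * z = 1\<^sub>m (dimn G n)"
  shows "z' \<in> U_set G n"
proof -
  let ?m = "dimn G n"
  note c = unitriangularD(1)[OF U_set_unitriangular[OF z]] unitriangularD(1)[OF z'(1)]
  have a: "z' * (z * A) = A" if "A \<in> carrier_mat ?m ?m" for A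
    using that c z'(2) assoc_mult_mat[of z' ?m ?m z ?m A ?m] by simp
  have t: "z\<^sup>T * z'\<^sup>T = 1\<^sub>m ?m" using z'(2) c transpose_mult[of z' ?m ?m z ?m] by simp
  have g1: "gram G n * 1\<^sub>m ?m = (gram G n :: 'a mat)" by (rule right_mult_one_mat[OF gram_carrier])
  have "z' * (z * gram G n * z\<^sup>T) * z'\<^sup>T = gram G n"
    using c by (simp add: mult_carrier_mat[of _ ?m ?m _ ?m] assoc_mult_mat[of _ ?m ?m _ ?m _ ?m] t a g1)
  thus ?thesis using z z'(1) by (simp add: U_set_iff)
qed

lemma U_group_simps [simp]:
  "carrier (U_group G n) = U_set G n" "x \<otimes>\<^bsub>U_group G n\<^esub> y = x * y" "\<one>\<^bsub>U_group G n\<^esub> = 1\<^sub>m (dimn G n)"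
  by (simp_all add: U_group_def)

lemma group_U_group: "group (U_group G n :: 'a::{field,finite} mat monoid)"
proof (rule groupI)
  let ?m = "dimn G n"
  fix x y z :: "'a mat"
  note carr = unitriangularD(1)[OF U_set_unitriangular]
  assume x: "x \<in> carrier (U_group G n)"
  show "\<one>\<^bsub>U_group G n\<^esub> \<otimes>\<^bsub>U_group G n\<^esub> x = x"
    using left_mult_one_mat[OF carr[of x]] x by simp
  obtain x' where x': "x' \<in> unitriangular ?m" "x * x' = 1\<^sub>m ?m" "x' * x = 1\<^sub>m ?m"
    using unitriangular_inverse U_set_unitriangular x by (metis U_group_simps(1))
  have "x' \<in> U_set G n" using U_set_inverse[OF _ x'(1,3)] x by simp
  thus "\<exists>y\<in>carrier (U_group G n). y \<otimes>\<^bsub>U_group G n\<^esub> x = \<one>\<^bsub>U_group G n\<^esub>" using x' by auto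
  assume y: "y \<in> carrier (U_group G n)"
  show "x \<otimes>\<^bsub>U_group G n\<^esub> y \<in> carrier (U_group G n)" using x y U_set_mult by simp
  assume z: "z \<in> carrier (U_group G n)"
  have "(x * y) * z = x * (y * z)"
    using x y z by (intro assoc_mult_mat[of _ ?m ?m _ ?m _ ?m] carr[of _ G n]) simp_all
  thus "x \<otimes>\<^bsub>U_group G n\<^esub> y \<otimes>\<^bsub>U_group G n\<^esub> z = x \<otimes>\<^bsub>U_group G n\<^esub> (y \<otimes>\<^bsub>U_group G n\<^esub> z)" by simp
qed (simp add: U_set_one)

lemma finite_U_set: "finite (U_set G n :: 'a::{field,finite} mat set)"
  by (rule finite_subset[OF _ finite_unitriangular]) (auto dest: U_set_unitriangular)

text \<open>\<open>row_group G n k l\<close> is the analogue of \<open>U_root\<close> in the full unitriangular group, for the root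
  with pair \<open>(k, l)\<close>.\<close>

definition row_group :: "group_type \<Rightarrow> nat \<Rightarrow> nat \<Rightarrow> nat \<Rightarrow> 'a::field mat set" where
  "row_group G n k l = {h \<in> unitriangular (dimn G n).
     (\<forall>c. k < c \<and> c < min n (dimn G n - 1 - l) \<longrightarrow> h $$ (k, c) = 0) \<and>
     (\<forall>c. l < c \<and> c < n + mid G \<longrightarrow> h $$ (l, c) = 0)}"

text \<open>The constraints of \<open>row_group\<close> translated to a form: Omega moves column c
  of the group element to column m - 1 - c of its Cayley transform, where m is
  \<open>dimn G n\<close>.\<close>

definition row_condition :: "group_type \<Rightarrow> nat \<Rightarrow> nat \<Rightarrow> nat \<Rightarrow> 'a::field mat \<Rightarrow> bool" where
  "row_condition G n k l C \<longleftrightarrow>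
     (\<forall>c. k < c \<and> c < min n (dimn G n - 1 - l) \<longrightarrow> C $$ (k, dimn G n - 1 - c) = 0) \<and>
     (\<forall>c. l < c \<and> c < n + mid G \<longrightarrow> C $$ (l, dimn G n - 1 - c) = 0)"

lemma U_root_row_group:
  fixes \<alpha> :: root
  assumes "\<alpha> \<in> roots G n" "root_pair G n \<alpha> = (k, l)"
  shows "U_root G n \<alpha> = U_set G n \<inter> (row_group G n k l :: 'a::{field,finite} mat set)"
  using U_root_iff[OF assms] U_set_unitriangular by (auto simp: row_group_def)

lemma pairsD:
  assumes "(k, l) \<in> pairs G n"
  shows "k \<le> l" "k < n" "l < dimn G n" "k < dimn G n" "k + l + 1 < dimn G n" "k = l \<Longrightarrow> G = Sp"
  using assms by (auto simp: pairs_def dimn_def mid_def split: if_splits)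

context
  fixes G :: group_type and n k l m c0 c1 :: nat and C :: "'a::{field,finite} mat"
  assumes kl: "(k, l) \<in> pairs G n" and C: "supported_form G n C"
  defines "m \<equiv> dimn G n" and "c0 \<equiv> min n (dimn G n - 1 - l)" and "c1 \<equiv> n + mid G"
begin

private lemma Cc: "C \<in> carrier_mat m m"
  using C by (simp add: supported_form_def eps_symmetric_def m_def)

private lemma Csym: "i < m \<Longrightarrow> j < m \<Longrightarrow> C $$ (j, i) = form_eps G * C $$ (i, j)"
  using C unfolding supported_form_def eps_symmetric_def m_def by blast

private lemma Csupp: "i < m \<Longrightarrow> j < m \<Longrightarrow> m \<le> i + j + 1 \<Longrightarrow> C $$ (i, j) = 0"
  using C unfolding supported_form_def m_def by blast

private lemma bounds: "k \<le> l" "k < n" "l < m" "k < m" "k + l + 1 < m" "k = l \<Longrightarrow> c0 = n \<and> c1 = n \<and> l < n"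
  "m = c1 + n" "n \<le> c1" "c0 \<le> n"
  using pairsD[OF kl] by (auto simp: m_def c0_def c1_def dimn_def mid_def)

text \<open>The entry is affine in \<open>h\<close>. A product of an off-diagonal entry of row
  \<open>k\<close> with one of row \<open>l\<close> comes with an entry (a, b) of \<open>C\<close>;
  if neither factor is killed by the constraints on \<open>h\<close>, then (a, b) lies on or below
  the anti-diagonal, where \<open>C\<close> vanishes.\<close>

lemma row_group_entry:
  assumes h: "h \<in> row_group G n k l"
  shows "(h * C * h\<^sup>T) $$ (k, l) =
    C $$ (k, l) + (\<Sum>b\<in>{l<..<m}. h $$ (l, b) * C $$ (k, b)) + (\<Sum>a\<in>{k<..<m}. h $$ (k, a) * C $$ (a, l))"
proof -
  have hT: "h \<in> unitriangular m" and z0: "\<And>c. k < c \<Longrightarrow> c < c0 \<Longrightarrow> h $$ (k, c) = 0"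
    and z1: "\<And>c. l < c \<Longrightarrow> c < c1 \<Longrightarrow> h $$ (l, c) = 0"
    using h by (auto simp: row_group_def m_def c0_def c1_def)
  note hD = unitriangularD[OF hT]
  have split: "(\<Sum>s<m. h $$ (i, s) * f s) = f i + (\<Sum>s\<in>{i<..<m}. h $$ (i, s) * f s)" if "i < m" for i f
  proof -
    have "(\<Sum>s<m. h $$ (i, s) * f s) = (\<Sum>s\<in>insert i {i<..<m}. h $$ (i, s) * f s)"
      using that by (intro sum.mono_neutral_right) (auto simp: hD)
    thus ?thesis using that by (simp add: hD)
  qed
  have cross: "h $$ (k, a) * (h $$ (l, b) * C $$ (a, b)) = 0" if "a \<in> {k<..<m}" "b \<in> {l<..<m}" for a b
  proof (cases "c0 \<le> a \<and> c1 \<le> b")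
    case True
    have "m \<le> a + b + 1"
    proof (cases "c0 = n")
      case False
      hence "c0 = m - 1 - l" by (auto simp: c0_def m_def)
      thus ?thesis using True that bounds by auto
    qed (use True bounds in simp)
    thus ?thesis using Csupp[of a b] that by simp
  next
    case False
    thus ?thesis using z0[of a] z1[of b] that by auto
  qed
  have D: "(\<Sum>b<m. h $$ (l, b) * C $$ (a, b)) = C $$ (a, l) + (\<Sum>b\<in>{l<..<m}. h $$ (l, b) * C $$ (a, b))" for a
    using split[OF bounds(3), of "\<lambda>b. C $$ (a, b)"] .
  have "(h * C * h\<^sup>T) $$ (k, l) = (\<Sum>a<m. h $$ (k, a) * (\<Sum>b<m. h $$ (l, b) * C $$ (a, b)))"
    by (rule congruence_entry[OF hD(1) Cc bounds(4,3)])
  also have "\<dots> = C $$ (k, l) + (\<Sum>b\<in>{l<..<m}. h $$ (l, b) * C $$ (k, b)) +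
     (\<Sum>a\<in>{k<..<m}. h $$ (k, a) * (C $$ (a, l) + (\<Sum>b\<in>{l<..<m}. h $$ (l, b) * C $$ (a, b))))"
    unfolding split[OF bounds(4)] D ..
  also have "(\<Sum>a\<in>{k<..<m}. h $$ (k, a) * (C $$ (a, l) + (\<Sum>b\<in>{l<..<m}. h $$ (l, b) * C $$ (a, b)))) =
     (\<Sum>a\<in>{k<..<m}. h $$ (k, a) * C $$ (a, l))"
  proof (rule sum.cong[OF refl])
    fix a assume "a \<in> {k<..<m}"
    hence "h $$ (k, a) * (\<Sum>b\<in>{l<..<m}. h $$ (l, b) * C $$ (a, b)) = 0"
      unfolding sum_distrib_left using cross by (intro sum.neutral) blast
    thus "h $$ (k, a) * (C $$ (a, l) + (\<Sum>b\<in>{l<..<m}. h $$ (l, b) * C $$ (a, b))) = h $$ (k, a) * C $$ (a, l)"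
      by (simp add: distrib_left)
  qed
  finally show ?thesis .
qed

text \<open>The two linear sums are crosswise: row \<open>l\<close> of \<open>h\<close> meets row
  \<open>k\<close> of \<open>C\<close> and vice versa. In each term one factor vanishes, by the
  constraint on \<open>h\<close>, by the condition on \<open>C\<close>, or by the support of
  \<open>C\<close>.\<close>

lemma row_group_entry_const:
  assumes h: "h \<in> row_group G n k l" and R: "row_condition G n k l C"
  shows "(h * C * h\<^sup>T) $$ (k, l) = C $$ (k, l)"
proof -
  have z0: "\<And>c. k < c \<Longrightarrow> c < c0 \<Longrightarrow> h $$ (k, c) = 0" and z1: "\<And>c. l < c \<Longrightarrow> c < c1 \<Longrightarrow> h $$ (l, c) = 0"
    using h by (auto simp: row_group_def m_def c0_def c1_def)
  have R0: "\<And>c. k < c \<Longrightarrow> c < c0 \<Longrightarrow> C $$ (k, m - 1 - c) = 0" and R1: "\<And>c. l < c \<Longrightarrow> c < c1 \<Longrightarrow> C $$ (l, m - 1 - c) = 0"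
    using R by (auto simp: row_condition_def m_def c0_def c1_def)
  have "h $$ (l, b) * C $$ (k, b) = 0" if b: "b \<in> {l<..<m}" for b
  proof (cases "c1 \<le> b \<and> k + b + 1 < m")
    case True
    hence "k < m - 1 - b" "m - 1 - b < c0" "m - 1 - (m - 1 - b) = b"
      using b bounds by (auto simp: c0_def m_def)
    thus ?thesis using R0[of "m - 1 - b"] by simp
  next
    case False
    thus ?thesis using z1[of b] Csupp[of k b] b bounds by auto
  qed
  moreover have "h $$ (k, a) * C $$ (a, l) = 0" if a: "a \<in> {k<..<m}" for a
  proof (cases "c0 \<le> a \<and> a + l + 1 < m")
    case True
    hence na: "n \<le> a" by (auto simp: c0_def m_def)
    hence "l < m - 1 - a" "m - 1 - a < c1" "m - 1 - (m - 1 - a) = a"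
      using True a bounds by auto
    hence "C $$ (l, a) = 0" using R1[of "m - 1 - a"] by simp
    thus ?thesis using Csym[of l a] a bounds by simp
  next
    case False
    thus ?thesis using z0[of a] Csupp[of a l] a bounds by auto
  qed
  ultimately show ?thesis unfolding row_group_entry[OF h] by (simp add: sum.neutral)
qed

text \<open>When the condition fails, adding a multiple of a matrix unit to \<open>h\<close> moves the entry by an
  arbitrary amount, and the character sum vanishes.\<close>

lemma row_group_shift:
  assumes two: "(2::'a) \<noteq> 0" and R: "\<not> row_condition G n k l C"
  obtains \<delta> and f :: "'a \<Rightarrow> 'a mat \<Rightarrow> 'a mat" where "\<delta> \<noteq> 0"
    "\<And>t. bij_betw (f t) (row_group G n k l) (row_group G n k l)"
    "\<And>t h. h \<in> row_group G n k l \<Longrightarrow>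
      (f t h * C * (f t h)\<^sup>T) $$ (k, l) = (h * C * h\<^sup>T) $$ (k, l) + t * \<delta>"
proof -
  have "(\<exists>c. k < c \<and> c < c0 \<and> C $$ (k, m - 1 - c) \<noteq> 0) \<or> (\<exists>c. l < c \<and> c < c1 \<and> C $$ (l, m - 1 - c) \<noteq> 0)"
    using R unfolding row_condition_def m_def c0_def c1_def by blast
  \<comment> \<open>A non-zero entry of \<open>C\<close> that violates the condition in row
    \<open>k\<close> is multiplied by an entry of row \<open>l\<close> of \<open>h\<close>, and
    conversely. The bounds on \<open>s\<close> place that entry of \<open>h\<close> beyond the
    constrained columns, so it may be changed freely.\<close>
  then obtain r s where rs: "r = l \<and> l < s \<and> s < m \<and> c1 \<le> s \<and> C $$ (k, s) \<noteq> 0 \<or>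
      r = k \<and> k < s \<and> s < m \<and> n \<le> s \<and> C $$ (s, l) \<noteq> 0"
  proof
    assume "\<exists>c. k < c \<and> c < c0 \<and> C $$ (k, m - 1 - c) \<noteq> 0"
    then obtain c where c: "k < c" "c < c0" "C $$ (k, m - 1 - c) \<noteq> 0" by blast
    hence "l < m - 1 - c \<and> m - 1 - c < m \<and> c1 \<le> m - 1 - c"
      using bounds by (auto simp: c0_def m_def)
    thus ?thesis using that[of l "m - 1 - c"] c(3) by blast
  next
    assume "\<exists>c. l < c \<and> c < c1 \<and> C $$ (l, m - 1 - c) \<noteq> 0"
    then obtain c where c: "l < c" "c < c1" "C $$ (l, m - 1 - c) \<noteq> 0" by blast
    hence s: "k < m - 1 - c \<and> m - 1 - c < m \<and> n \<le> m - 1 - c" using bounds by auto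
    have "C $$ (l, m - 1 - c) = form_eps G * C $$ (m - 1 - c, l)" using Csym[of "m - 1 - c" l] s bounds by simp
    hence "C $$ (m - 1 - c, l) \<noteq> 0" using c(3) by auto
    thus ?thesis using that[of k "m - 1 - c"] s by blast
  qed
  have rsm: "r < s" "r < m" "s < m" using rs bounds by auto
  define f where "f t h = mat m m (\<lambda>(i, j). h $$ (i, j) + (if i = r \<and> j = s then t else 0))" for t and h :: "'a mat"
  have fe: "f t h $$ (i, j) = h $$ (i, j) + (if i = r \<and> j = s then t else 0)" if "i < m" "j < m" for t h i j
    using that by (simp add: f_def)
  \<comment> \<open>For \<open>k = l\<close> both linear sums move with the same entry of
    \<open>h\<close>. This happens only for \<open>Sp\<close>, where \<open>C\<close> is symmetric,
    and the increment is then twice an entry of \<open>C\<close>.\<close>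
  define \<delta> where "\<delta> = (if r = l then C $$ (k, s) else 0) + (if r = k then C $$ (s, l) else 0)"
  have \<delta>: "\<delta> \<noteq> 0"
  proof (cases "k = l")
    case True
    hence "form_eps G = (1::'a)" using pairsD(6)[OF kl] by (simp add: form_eps_def)
    hence "C $$ (s, l) = C $$ (k, s)" using Csym[of k s] True rsm bounds by simp
    thus ?thesis using two rs True by (auto simp: \<delta>_def mult_2[symmetric])
  next
    case False
    thus ?thesis using rs by (auto simp: \<delta>_def)
  qed
  have fH: "f t h \<in> row_group G n k l" if h: "h \<in> row_group G n k l" for t and h :: "'a mat"
  proof -
    have hT: "h \<in> unitriangular m" and z0: "\<And>c. k < c \<Longrightarrow> c < c0 \<Longrightarrow> h $$ (k, c) = 0"
      and z1: "\<And>c. l < c \<Longrightarrow> c < c1 \<Longrightarrow> h $$ (l, c) = 0"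
      using h by (auto simp: row_group_def m_def c0_def c1_def)
    have "f t h \<in> unitriangular m"
      by (rule unitriangularI) (use rsm unitriangularD[OF hT] in \<open>auto simp: f_def\<close>)
    moreover have "f t h $$ (k, c) = 0" if "k < c" "c < c0" for c
      using that z0[of c] rs bounds fe[of k c t h] by auto
    moreover have "f t h $$ (l, c) = 0" if "l < c" "c < c1" for c
    proof -
      have "\<not> (l = r \<and> c = s)" using that rs bounds by auto
      thus ?thesis using that z1[of c] bounds fe[of l c t h] by auto
    qed
    ultimately show ?thesis by (simp add: row_group_def m_def c0_def c1_def)
  qed
  have inv: "f (- t) (f t h) = h" if "h \<in> row_group G n k l" for t and h :: "'a mat"
  proof -
    have "h \<in> carrier_mat m m" using that unitriangularD(1) by (auto simp: row_group_def m_def)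
    thus ?thesis by (intro eq_matI) (auto simp: f_def)
  qed
  show ?thesis
  proof (rule that[OF \<delta>])
    show "bij_betw (f t) (row_group G n k l) (row_group G n k l)" for t
      by (rule bij_betwI[where g = "f (- t)"]) (use fH inv[of _ t] inv[of _ "- t"] in auto)
    fix t :: 'a and h :: "'a mat" assume h: "h \<in> row_group G n k l"
    have S: "(\<Sum>b\<in>{i<..<m}. f t h $$ (i, b) * g b) = (\<Sum>b\<in>{i<..<m}. h $$ (i, b) * g b) + (if i = r then t * g s else 0)"
      if i: "i < m" for i and g :: "nat \<Rightarrow> 'a"
    proof -
      have "(\<Sum>b\<in>{i<..<m}. f t h $$ (i, b) * g b) = (\<Sum>b\<in>{i<..<m}. h $$ (i, b) * g b + (if b = s then (if i = r then t * g s else 0) else 0))"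
        using i by (intro sum.cong) (auto simp: fe distrib_right)
      also have "\<dots> = (\<Sum>b\<in>{i<..<m}. h $$ (i, b) * g b) + (if i = r then t * g s else 0)"
        using rsm by (simp add: sum.distrib sum.delta)
      finally show ?thesis .
    qed
    show "(f t h * C * (f t h)\<^sup>T) $$ (k, l) = (h * C * h\<^sup>T) $$ (k, l) + t * \<delta>"
      unfolding row_group_entry[OF fH[OF h]] row_group_entry[OF h] S[OF bounds(3)] S[OF bounds(4)] \<delta>_def
      by (auto simp: distrib_left)
  qed
qed

end

section \<open>From induced characters to sums over the unitriangular group\<close>

lemma nontrivial_additive_characterD:
  assumes "nontrivial_additive_character \<theta>"
  shows "\<theta> (a + b) = \<theta> a * \<theta> b" "\<theta> a \<noteq> 0" "\<theta> 0 = 1" "\<exists>a. \<theta> a \<noteq> 1"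
proof -
  show *: "\<theta> (a + b) = \<theta> a * \<theta> b" "\<theta> a \<noteq> 0" for a b
    using assms unfolding nontrivial_additive_character_def by blast+
  show "\<theta> 0 = 1" using *(1)[of 0 0] *(2)[of 0] by simp
  show "\<exists>a. \<theta> a \<noteq> 1" using assms unfolding nontrivial_additive_character_def by blast
qed

text \<open>If the condition fails, a reparametrisation of the row group adds a chosen amount to the
  argument and multiplies the sum by a value of \<theta> other than 1, so the sum vanishes.
  Otherwise all terms agree.\<close>

lemma row_group_character_sum:
  fixes C :: "'a::{field,finite} mat"
  assumes two: "(2::'a) \<noteq> 0" and \<theta>: "nontrivial_additive_character \<theta>" and r: "r \<noteq> 0"
    and kl: "(k, l) \<in> pairs G n" and C: "supported_form G n C"
  shows "(\<Sum>h\<in>row_group G n k l. \<theta> (r * (h * C * h\<^sup>T) $$ (k, l))) =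
    (if row_condition G n k l C then of_nat (card (row_group G n k l :: 'a mat set)) * \<theta> (r * C $$ (k, l)) else 0)"
proof (cases "row_condition G n k l C")
  case True
  thus ?thesis using row_group_entry_const[OF kl C] by simp
next
  case False
  obtain \<delta> f where \<delta>: "\<delta> \<noteq> 0" and bij: "\<And>t. bij_betw (f t) (row_group G n k l) (row_group G n k l)"
    and sh: "\<And>t h. h \<in> row_group G n k l \<Longrightarrow>
      (f t h * C * (f t h)\<^sup>T) $$ (k, l) = (h * C * h\<^sup>T) $$ (k, l) + t * \<delta>"
    using row_group_shift[OF kl C two False] by blast
  obtain a where a: "\<theta> a \<noteq> 1" using nontrivial_additive_characterD(4)[OF \<theta>] by blast
  define t where "t = a / (r * \<delta>)"
  have t: "r * (t * \<delta>) = a" using r \<delta> by (simp add: t_def)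
  let ?S = "\<Sum>h\<in>row_group G n k l. \<theta> (r * (h * C * h\<^sup>T) $$ (k, l))"
  have "?S = (\<Sum>h\<in>row_group G n k l. \<theta> (r * (f t h * C * (f t h)\<^sup>T) $$ (k, l)))"
    by (rule sum.reindex_bij_betw[OF bij, symmetric])
  also have "\<dots> = (\<Sum>h\<in>row_group G n k l. \<theta> (r * (h * C * h\<^sup>T) $$ (k, l)) * \<theta> a)"
  proof (rule sum.cong[OF refl])
    fix h :: "'a mat" assume "h \<in> row_group G n k l"
    hence "r * (f t h * C * (f t h)\<^sup>T) $$ (k, l) = r * (h * C * h\<^sup>T) $$ (k, l) + a"
      using sh[of h t] t by (simp only: distrib_left)
    thus "\<theta> (r * (f t h * C * (f t h)\<^sup>T) $$ (k, l)) = \<theta> (r * (h * C * h\<^sup>T) $$ (k, l)) * \<theta> a"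
      by (simp only: nontrivial_additive_characterD(1)[OF \<theta>])
  qed
  also have "\<dots> = ?S * \<theta> a" by (simp only: sum_distrib_right)
  finally have "?S * (1 - \<theta> a) = 0" by (simp add: right_diff_distrib)
  hence "?S = 0" using a by simp
  thus ?thesis using False by simp
qed

text \<open>For a = b Omega^T one has a (z + 1)/2 = z - 1. Right multiplication by the unitriangular
  (z + 1)/2 preserves the leading zeros of a row, so a and z - 1 satisfy the same vanishing
  conditions; Omega reverses the columns.\<close>

lemma row_condition_cayley_iff:
  fixes z :: "'a::{field,finite} mat"
  assumes two: "(2::'a) \<noteq> 0" and z: "z \<in> U_set G n" and kl: "(k, l) \<in> pairs G n"
  shows "row_condition G n k l (cayley G n z) \<longleftrightarrow> z \<in> row_group G n k l"
proof -
  let ?m = "dimn G n"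
  note zT = U_set_unitriangular[OF z]
  note zD = unitriangularD[OF zT]
  define a where "a = cayley G n z * (gram G n)\<^sup>T"
  note ca = cayley_commute[OF refl two zT, folded a_def]
  have pre: "(\<forall>c. i < c \<and> c < q \<longrightarrow> cayley G n z $$ (i, ?m - 1 - c) = 0) \<longleftrightarrow> (\<forall>c. i < c \<and> c < q \<longrightarrow> z $$ (i, c) = 0)"
    if i: "i < ?m" and q: "q \<le> ?m" for i q
  proof -
    have "(\<forall>c. i < c \<and> c < q \<longrightarrow> cayley G n z $$ (i, ?m - 1 - c) = 0) \<longleftrightarrow> (\<forall>j<q. a $$ (i, j) = 0)"
    proof -
      have "a $$ (i, j) = 0 \<longleftrightarrow> (i < j \<longrightarrow> cayley G n z $$ (i, ?m - 1 - j) = 0)" if j: "j < q" for j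
      proof -
        have "cayley G n z $$ (i, ?m - 1 - j) = 0" if "\<not> i < j"
          by (rule cayley_support[OF refl two zT]) (use that j i q in auto)
        moreover have "j < ?m" using j q by simp
        ultimately show ?thesis using ca(4)[OF i, of j] by auto
      qed
      thus ?thesis by blast
    qed
    also have "\<dots> \<longleftrightarrow> (\<forall>j<q. (a * halfsum ?m z) $$ (i, j) = 0)"
      using zero_prefix_right_mult_iff[OF halfsum_unitriangular[OF two zT] ca(1) i q] by blast
    also have "\<dots> \<longleftrightarrow> (\<forall>j<q. (z - 1\<^sub>m ?m) $$ (i, j) = 0)" unfolding ca(3) ..
    also have "\<dots> \<longleftrightarrow> (\<forall>c. i < c \<and> c < q \<longrightarrow> z $$ (i, c) = 0)"
    proof -
      have "(z - 1\<^sub>m ?m) $$ (i, j) = 0 \<longleftrightarrow> (i < j \<longrightarrow> z $$ (i, j) = 0)" if "j < q" for j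
        using that q i zD(1,3) zD(2)[of j i] by (cases i j rule: linorder_cases) auto
      thus ?thesis by blast
    qed
    finally show ?thesis .
  qed
  have b: "k < ?m" "l < ?m" "min n (?m - 1 - l) \<le> ?m" "n + mid G \<le> ?m"
    using pairsD[OF kl] by (auto simp: dimn_def)
  show ?thesis unfolding row_condition_def row_group_def pre[OF b(1,3)] pre[OF b(2,4)] using zT by blast
qed

text \<open>Read off from (z + 1)/2 a = z - 1 in row \<open>k\<close>. Off the diagonal each term of
  the product vanishes: early columns by the constraint on row \<open>k\<close> of \<open>z\<close>,
  later ones by the condition on row \<open>l\<close> of the form or by its support.\<close>

lemma row_group_cayley_entry:
  fixes z :: "'a::{field,finite} mat"
  assumes two: "(2::'a) \<noteq> 0" and z: "z \<in> U_set G n" and kl: "(k, l) \<in> pairs G n"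
    and zr: "z \<in> row_group G n k l"
  shows "z $$ (k, dimn G n - 1 - l) = form_sign G n (dimn G n - 1 - l) * cayley G n z $$ (k, l)"
proof -
  let ?m = "dimn G n"
  let ?j = "?m - 1 - l"
  note zT = U_set_unitriangular[OF z]
  note zD = unitriangularD[OF zT]
  define a where "a = cayley G n z * (gram G n)\<^sup>T"
  note ca = cayley_commute[OF refl two zT, folded a_def]
  note p = pairsD[OF kl]
  have j: "?j < ?m" "k < ?j" "?m - 1 - ?j = l" using p by auto
  have R: "row_condition G n k l (cayley G n z)" using row_condition_cayley_iff[OF two z kl] zr by blast
  have "halfsum ?m z $$ (k, s) * a $$ (s, ?j) = 0" if s: "s \<in> {k<..<?m}" for s
  proof (cases "s < min n ?j")
    case True
    hence "z $$ (k, s) = 0" using zr s by (auto simp: row_group_def)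
    thus ?thesis using s zD(1) p by (simp add: halfsum_def)
  next
    case False
    have "cayley G n z $$ (s, l) = 0"
    proof (cases "s < ?j")
      case True
      hence c: "l < ?m - 1 - s" "?m - 1 - s < n + mid G" "?m - 1 - (?m - 1 - s) = s"
        using False s p by (auto simp: dimn_def)
      hence "cayley G n z $$ (l, s) = 0" using R unfolding row_condition_def by metis
      moreover have "cayley G n z $$ (s, l) = form_eps G * cayley G n z $$ (l, s)"
      proof -
        have "s < ?m" using s by simp
        thus ?thesis using cayley_eps_symmetric[OF refl two z] p(3) unfolding eps_symmetric_def by blast
      qed
      ultimately show ?thesis by simp
    next
      case False
      thus ?thesis using cayley_support[OF refl two zT, of s l] s p by auto
    qed
    thus ?thesis using ca(4)[of s ?j] s j by simp
  qed
  hence "(halfsum ?m z * a) $$ (k, ?j) = a $$ (k, ?j)"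
    unfolding unitriangular_mult_entry[OF halfsum_unitriangular[OF two zT] ca(1) p(4) j(1)]
    by (simp add: sum.neutral)
  hence "(z - 1\<^sub>m ?m) $$ (k, ?j) = a $$ (k, ?j)" unfolding ca(2) .
  thus ?thesis using ca(4)[OF p(4) j(1)] j p(4) zD(1) by (simp add: mult.commute)
qed

text \<open>Each g is a product h y in as many ways as the intersection of U with the row group has
  elements: the coset of g meets U by \<open>U_set_matches_upper_left\<close>, and the elements of U
  in one coset of the row group form a coset of the intersection.\<close>

lemma sum_cosets:
  fixes F :: "'a::{field,finite} mat \<Rightarrow> complex"
  assumes two: "(2::'a) \<noteq> 0" and kl: "(k, l) \<in> pairs G n"
  shows "(\<Sum>y\<in>U_set G n. \<Sum>h\<in>row_group G n k l. F (h * y)) =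
    of_nat (card (U_set G n \<inter> (row_group G n k l :: 'a mat set))) * (\<Sum>g\<in>unitriangular (dimn G n). F g)"
proof -
  let ?m = "dimn G n" and ?T = "unitriangular (dimn G n) :: 'a mat set" and ?H = "row_group G n k l :: 'a mat set"
  let ?c0 = "min n (?m - 1 - l)" and ?c1 = "n + mid G"
  note p = pairsD[OF kl]
  have cm: "?c0 \<le> ?m" "?c1 \<le> ?m" by (auto simp: dimn_def)
  \<comment> \<open>\<open>g\<close> and \<open>y\<close> lie in the same coset of the row group iff they agree on initial segments of
    rows \<open>k\<close> and \<open>l\<close>.\<close>
  define agree where "agree g y \<longleftrightarrow> (\<forall>j<?c0. (g - y) $$ (k, j) = (0::'a)) \<and> (\<forall>j<?c1. (g - y) $$ (l, j) = 0)" for g y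
  have agree_mult: "agree (h * y) y \<longleftrightarrow> h \<in> ?H" if h: "h \<in> ?T" and y: "y \<in> ?T" for h y
  proof -
    note c = unitriangularD(1)[OF h] unitriangularD(1)[OF y]
    have e: "h * y - y = (h - 1\<^sub>m ?m) * y" using c by (simp add: minus_mult_distrib_mat[of _ ?m ?m _ _ ?m])
    have c': "h - 1\<^sub>m ?m \<in> carrier_mat ?m ?m" using c by (simp add: minus_carrier_mat)
    have q: "(\<forall>j<q. (h - 1\<^sub>m ?m) $$ (i, j) = 0) \<longleftrightarrow> (\<forall>c. i < c \<and> c < q \<longrightarrow> h $$ (i, c) = 0)"
      if "i < ?m" "q \<le> ?m" for i q
    proof -
      have "(h - 1\<^sub>m ?m) $$ (i, j) = 0 \<longleftrightarrow> (i < j \<longrightarrow> h $$ (i, j) = 0)" if "j < q" for j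
        using that \<open>q \<le> ?m\<close> \<open>i < ?m\<close> c(1) unitriangularD(3)[OF h] unitriangularD(2)[OF h, of j i]
        by (cases i j rule: linorder_cases) auto
      thus ?thesis by blast
    qed
    show ?thesis
      unfolding agree_def e zero_prefix_right_mult_iff[OF y c' p(4) cm(1)] zero_prefix_right_mult_iff[OF y c' p(3) cm(2)]
        q[OF p(4) cm(1)] q[OF p(3) cm(2)] row_group_def using h by blast
  qed
  have inner: "(\<Sum>h\<in>?H. F (h * y)) = (\<Sum>g\<in>{g \<in> ?T. agree g y}. F g)" if y: "y \<in> ?T" for y
  proof -
    obtain y' where y': "y' \<in> ?T" "y * y' = 1\<^sub>m ?m" "y' * y = 1\<^sub>m ?m" using unitriangular_inverse[OF y] by blast
    have c: "g * y * y' = g" "g * y' * y = g" if "g \<in> ?T" for g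
      using unitriangularD(1)[OF that] unitriangularD(1)[OF y] unitriangularD(1)[OF y'(1)] y'(2,3)
      by (simp_all add: assoc_mult_mat[of _ ?m ?m _ ?m _ ?m])
    have HT: "h \<in> ?T" if "h \<in> ?H" for h using that by (simp add: row_group_def)
    show ?thesis
    proof (rule sum.reindex_bij_betw)
      show "bij_betw (\<lambda>h. h * y) ?H {g \<in> ?T. agree g y}"
      proof (rule bij_betwI[where g = "\<lambda>g. g * y'"])
        show "(\<lambda>h. h * y) \<in> ?H \<rightarrow> {g \<in> ?T. agree g y}"
        proof
          fix h assume h: "h \<in> ?H"
          thus "h * y \<in> {g \<in> ?T. agree g y}"
            using agree_mult[OF HT[OF h] y] mult_unitriangular[OF HT[OF h] y] by blast
        qed
        show "(\<lambda>g. g * y') \<in> {g \<in> ?T. agree g y} \<rightarrow> ?H"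
        proof
          fix g assume "g \<in> {g \<in> ?T. agree g y}"
          hence g: "g \<in> ?T" "agree g y" by auto
          have "agree (g * y' * y) y" using g c(2)[OF g(1)] by simp
          thus "g * y' \<in> ?H" using agree_mult[OF mult_unitriangular[OF g(1) y'(1)] y] by blast
        qed
      qed (use c HT in auto)
    qed
  qed
  have fiber: "card {y \<in> U_set G n. agree g y} = card (U_set G n \<inter> ?H)" if g: "g \<in> ?T" for g
  proof -
    obtain y0 where y0: "y0 \<in> U_set G n" "\<And>i c. i < n \<Longrightarrow> c < n + mid G \<Longrightarrow> y0 $$ (i, c) = g $$ (i, c)"
      using U_set_matches_upper_left[OF two g] by blast
    note y0T = U_set_unitriangular[OF y0(1)]
    note c0 = unitriangularD(1)[OF y0T] unitriangularD(1)[OF g]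
    have ag: "agree g y \<longleftrightarrow> agree y y0" if y: "y \<in> U_set G n" for y
    proof -
      note yc = unitriangularD(1)[OF U_set_unitriangular[OF y]]
      have k: "(g - y) $$ (k, j) = 0 \<longleftrightarrow> (y - y0) $$ (k, j) = 0" if "j < ?c0" for j
        using that y0(2)[of k j] p cm c0 yc by auto
      have l: "(g - y) $$ (l, j) = 0 \<longleftrightarrow> (y - y0) $$ (l, j) = 0" if "j < ?c1" for j
      proof (cases "l < n")
        case True
        thus ?thesis using that y0(2)[of l j] p cm c0 yc by auto
      next
        case False
        \<comment> \<open>For l \<ge> n the tested columns of row \<open>l\<close> reach at most the
          diagonal, where all unitriangular matrices agree.\<close>
        have "j \<le> l" using that False by (auto simp: mid_def split: if_splits)
        hence "g $$ (l, j) = y0 $$ (l, j)"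
          using unitriangularD(2,3)[OF g] unitriangularD(2,3)[OF y0T] p(3) by (cases "j = l") auto
        thus ?thesis using that p cm c0 yc by auto
      qed
      show ?thesis unfolding agree_def using k l by blast
    qed
    obtain y' where y': "y' \<in> ?T" "y0 * y' = 1\<^sub>m ?m" "y' * y0 = 1\<^sub>m ?m" using unitriangular_inverse[OF y0T] by blast
    have y'U: "y' \<in> U_set G n" by (rule U_set_inverse[OF y0(1) y'(1,3)])
    have c: "u * y0 * y' = u" "u * y' * y0 = u" if "u \<in> U_set G n" for u
      using unitriangularD(1)[OF U_set_unitriangular[OF that]] c0 unitriangularD(1)[OF y'(1)] y'(2,3)
      by (simp_all add: assoc_mult_mat[of _ ?m ?m _ ?m _ ?m])
    have "bij_betw (\<lambda>u. u * y0) (U_set G n \<inter> ?H) {y \<in> U_set G n. agree g y}"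
    proof (rule bij_betwI[where g = "\<lambda>y. y * y'"])
      show "(\<lambda>u. u * y0) \<in> U_set G n \<inter> ?H \<rightarrow> {y \<in> U_set G n. agree g y}"
      proof
        fix u assume "u \<in> U_set G n \<inter> ?H"
        hence u: "u \<in> U_set G n" "u \<in> ?H" by auto
        have uy: "u * y0 \<in> U_set G n" by (rule U_set_mult[OF u(1) y0(1)])
        thus "u * y0 \<in> {y \<in> U_set G n. agree g y}"
          using agree_mult[OF U_set_unitriangular[OF u(1)] y0T] ag[OF uy] u(2) by blast
      qed
      show "(\<lambda>y. y * y') \<in> {y \<in> U_set G n. agree g y} \<rightarrow> U_set G n \<inter> ?H"
      proof
        fix y assume "y \<in> {y \<in> U_set G n. agree g y}"
        hence y: "y \<in> U_set G n" "agree y y0" using ag by auto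
        have yy: "y * y' \<in> U_set G n" by (rule U_set_mult[OF y(1) y'U])
        have "agree (y * y' * y0) y0" using y c(2)[OF y(1)] by simp
        thus "y * y' \<in> U_set G n \<inter> ?H" using agree_mult[OF U_set_unitriangular[OF yy] y0T] yy by blast
      qed
    qed (use c in auto)
    thus ?thesis using bij_betw_same_card by metis
  qed
  have "(\<Sum>y\<in>U_set G n. \<Sum>h\<in>?H. F (h * y)) = (\<Sum>y\<in>U_set G n. \<Sum>g\<in>?T. if agree g y then F g else 0)"
  proof (rule sum.cong[OF refl])
    fix y :: "'a mat" assume "y \<in> U_set G n"
    from inner[OF U_set_unitriangular[OF this]]
    show "(\<Sum>h\<in>?H. F (h * y)) = (\<Sum>g\<in>?T. if agree g y then F g else 0)"
      by (simp only: sum.inter_filter[OF finite_unitriangular])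
  qed
  also have "\<dots> = (\<Sum>g\<in>?T. \<Sum>y\<in>U_set G n. if agree g y then F g else 0)" by (rule sum.swap)
  also have "\<dots> = (\<Sum>g\<in>?T. of_nat (card (U_set G n \<inter> ?H)) * F g)"
  proof (rule sum.cong[OF refl])
    fix g assume g: "g \<in> ?T"
    have "(\<Sum>y\<in>U_set G n. if agree g y then F g else 0) = (\<Sum>y\<in>{y \<in> U_set G n. agree g y}. F g)"
      by (rule sum.inter_filter[OF finite_U_set, symmetric])
    thus "(\<Sum>y\<in>U_set G n. if agree g y then F g else 0) = of_nat (card (U_set G n \<inter> ?H)) * F g"
      using fiber[OF g] by simp
  qed
  finally show ?thesis by (simp only: sum_distrib_left)
qed

text \<open>For each conjugate z = y x y^(-1), the Frobenius term, extended by zero off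
  \<open>U_root\<close>, is the average over h in the row group of \<theta> at an entry of h b(z)
  h^T: \<open>row_condition_cayley_iff\<close> matches where both vanish and
  \<open>row_group_cayley_entry\<close> matches the values. As b(z) = y b(x) y^T, the sum over h and
  y is one over products h y. By \<open>sum_cosets\<close> it is a sum over the whole unitriangular
  group times the order of \<open>U_root\<close>, which cancels the Frobenius denominator.\<close>

lemma elementary_character_eq:
  fixes x :: "'a::{field,finite} mat"
  assumes two: "(2::'a) \<noteq> 0" and \<theta>: "nontrivial_additive_character \<theta>" and r: "r \<noteq> 0"
    and \<alpha>: "\<alpha> \<in> roots G n" "root_pair G n \<alpha> = (k, l)" and x: "x \<in> U_set G n"
  shows "elementary_character G n \<theta> \<alpha> r x =
    (\<Sum>g\<in>unitriangular (dimn G n).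
       \<theta> (r * form_sign G n (dimn G n - 1 - l) * (g * cayley G n x * g\<^sup>T) $$ (k, l)))
    / of_nat (card (row_group G n k l :: 'a mat set))"
proof -
  let ?m = "dimn G n" and ?UG = "U_group G n :: 'a mat monoid" and ?H = "row_group G n k l :: 'a mat set"
  let ?\<sigma> = "form_sign G n (dimn G n - 1 - l) :: 'a" and ?R = "U_root G n \<alpha> :: 'a mat set"
  let ?B = "cayley G n x"
  interpret U: group ?UG by (rule group_U_group)
  have kl: "(k, l) \<in> pairs G n" using root_pair_in_pairs[OF \<alpha>(1)] \<alpha>(2) by simp
  have Rdef: "?R = U_set G n \<inter> ?H" by (rule U_root_row_group[OF \<alpha>])
  note xT = U_set_unitriangular[OF x]
  have Bc: "?B \<in> carrier_mat ?m ?m" by (rule cayley_props(1)[OF refl two xT])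
  have oneH: "1\<^sub>m ?m \<in> ?H"
    using pairsD[OF kl] one_unitriangular[of ?m] by (auto simp: row_group_def dimn_def)
  have cH: "card ?H \<noteq> 0" and cR: "card ?R \<noteq> 0"
  proof -
    have "finite ?H" by (rule finite_subset[OF _ finite_unitriangular[of ?m]]) (auto simp: row_group_def)
    thus "card ?H \<noteq> 0" using oneH by auto
    have "finite ?R" unfolding Rdef using finite_U_set by blast
    thus "card ?R \<noteq> 0" using oneH U_set_one[of G n] unfolding Rdef by auto
  qed
  let ?F = "\<lambda>g. \<theta> (r * ?\<sigma> * (g * ?B * g\<^sup>T) $$ (k, l))"
  have one: "(if y * x * y' \<in> ?R then \<theta> (r * (y * x * y') $$ (k, ?m - 1 - l)) else 0) =
      (\<Sum>h\<in>?H. ?F (h * y)) / of_nat (card ?H)"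
    if y: "y \<in> U_set G n" and y': "y' \<in> U_set G n" "y * y' = 1\<^sub>m ?m" "y' * y = 1\<^sub>m ?m" for y y'
  proof -
    let ?z = "y * x * y'"
    have z: "?z \<in> U_set G n" using U_set_mult x y y'(1) by blast
    note cc = cayley_conj[OF refl two xT y U_set_unitriangular[OF y'(1)] y'(2,3)]
    have F: "?F (h * y) = \<theta> (r * ?\<sigma> * (h * cayley G n ?z * h\<^sup>T) $$ (k, l))" if "h \<in> ?H" for h
    proof -
      have hc: "h \<in> carrier_mat ?m ?m" using that unitriangularD(1) by (auto simp: row_group_def)
      note yc = unitriangularD(1)[OF U_set_unitriangular[OF y]]
      have "h * y * ?B * (h * y)\<^sup>T = h * (y * ?B * y\<^sup>T) * h\<^sup>T"
        using hc yc Bc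
        by (simp add: square_mat_simps[where m = ?m])
      thus ?thesis unfolding cc by simp
    qed
    have rs: "r * ?\<sigma> \<noteq> 0" using r by simp
    have "(\<Sum>h\<in>?H. ?F (h * y)) = (\<Sum>h\<in>?H. \<theta> (r * ?\<sigma> * (h * cayley G n ?z * h\<^sup>T) $$ (k, l)))"
      by (rule sum.cong[OF refl F])
    also have "\<dots> = (if row_condition G n k l (cayley G n ?z) then of_nat (card ?H) * \<theta> (r * ?\<sigma> * cayley G n ?z $$ (k, l)) else 0)"
      by (rule row_group_character_sum[OF two \<theta> rs kl cayley_supported_form[OF two z]])
    also have "\<dots> = of_nat (card ?H) * (if ?z \<in> ?R then \<theta> (r * ?z $$ (k, ?m - 1 - l)) else 0)"
    proof (cases "?z \<in> ?H")
      case True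
      thus ?thesis unfolding row_condition_cayley_iff[OF two z kl] Rdef row_group_cayley_entry[OF two z kl True]
        using z True by (simp add: mult.assoc)
    next
      case False
      thus ?thesis unfolding row_condition_cayley_iff[OF two z kl] Rdef by simp
    qed
    finally show ?thesis using cH by simp
  qed
  have inv1: "inv\<^bsub>?UG\<^esub> y \<in> U_set G n" "y * inv\<^bsub>?UG\<^esub> y = 1\<^sub>m ?m" "inv\<^bsub>?UG\<^esub> y * y = 1\<^sub>m ?m"
    if "y \<in> U_set G n" for y
    using U.inv_closed[of y] U.r_inv[of y] U.l_inv[of y] that by simp_all
  have "elementary_character G n \<theta> \<alpha> r x =
    (\<Sum>y\<in>{y \<in> U_set G n. inv\<^bsub>?UG\<^esub> y * x * y \<in> ?R}. \<theta> (r * (inv\<^bsub>?UG\<^esub> y * x * y) $$ (k, ?m - 1 - l))) / of_nat (card ?R)"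
    unfolding elementary_character_def induced_def using x by (simp add: root_character_eq[OF \<alpha>])
  also have "(\<Sum>y\<in>{y \<in> U_set G n. inv\<^bsub>?UG\<^esub> y * x * y \<in> ?R}. \<theta> (r * (inv\<^bsub>?UG\<^esub> y * x * y) $$ (k, ?m - 1 - l))) =
    (\<Sum>y\<in>U_set G n. if inv\<^bsub>?UG\<^esub> y * x * y \<in> ?R then \<theta> (r * (inv\<^bsub>?UG\<^esub> y * x * y) $$ (k, ?m - 1 - l)) else 0)"
    by (rule sum.inter_filter[OF finite_U_set])
  also have "\<dots> = (\<Sum>y\<in>U_set G n. (\<Sum>h\<in>?H. ?F (h * inv\<^bsub>?UG\<^esub> y)) / of_nat (card ?H))"
    by (intro sum.cong refl one) (use inv1 in auto)
  \<comment> \<open>The Frobenius formula conjugates by the inverse of the summation variable;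
    inversion permutes U.\<close>
  also have "\<dots> = (\<Sum>y\<in>U_set G n. (\<Sum>h\<in>?H. ?F (h * y)) / of_nat (card ?H))"
  proof (rule sum.reindex_bij_betw)
    show "bij_betw (\<lambda>y. inv\<^bsub>?UG\<^esub> y) (U_set G n) (U_set G n)"
      by (rule bij_betwI[where g = "\<lambda>y. inv\<^bsub>?UG\<^esub> y"]) (use U.inv_closed U.inv_inv in auto)
  qed
  also have "\<dots> = (\<Sum>y\<in>U_set G n. \<Sum>h\<in>?H. ?F (h * y)) / of_nat (card ?H)"
    by (simp only: sum_divide_distrib)
  also have "(\<Sum>y\<in>U_set G n. \<Sum>h\<in>?H. ?F (h * y)) = of_nat (card ?R) * (\<Sum>g\<in>unitriangular ?m. ?F g)"
    unfolding Rdef by (rule sum_cosets[OF two kl])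
  finally show ?thesis using cR by simp
qed

section \<open>Supercharacters as sums over the unitriangular group\<close>

lemma sum_unitriangular_left_shift:
  fixes u :: "'a::{field,finite} mat"
  assumes u: "u \<in> unitriangular m"
  shows "(\<Sum>g\<in>unitriangular m. f (u * g)) = (\<Sum>g\<in>unitriangular m. f g)"
proof (rule sum.reindex_bij_betw)
  obtain y where y: "y \<in> unitriangular m" "u * y = 1\<^sub>m m" "y * u = 1\<^sub>m m"
    using unitriangular_inverse[OF u] by blast
  have c: "y * (u * g) = g" "u * (y * g) = g" if "g \<in> unitriangular m" for g
    using unitriangularD(1)[OF that] unitriangularD(1)[OF u] unitriangularD(1)[OF y(1)] y(2,3)
    by (simp_all add: assoc_mult_mat[of _ m m _ m _ m, symmetric])
  show "bij_betw (\<lambda>g. u * g) (unitriangular m) (unitriangular m)"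
    by (rule bij_betwI[where g = "\<lambda>g. y * g"]) (use u y c in \<open>auto simp: mult_unitriangular\<close>)
qed

definition depends_on_rows :: "nat \<Rightarrow> nat set \<Rightarrow> ('a::field mat \<Rightarrow> 'b) \<Rightarrow> bool" where
  "depends_on_rows m R f \<longleftrightarrow> (\<forall>g\<in>unitriangular m. \<forall>h\<in>unitriangular m.
     (\<forall>i\<in>R. \<forall>j<m. g $$ (i, j) = h $$ (i, j)) \<longrightarrow> f g = f h)"

text \<open>Rows of a unitriangular matrix vary independently: exchanging the rows in \<open>R\<close> of two
  matrices is an involution on pairs.\<close>

lemma sum_times_sum_rows:
  fixes f f' :: "'a::{field,finite} mat \<Rightarrow> complex"
  assumes f: "depends_on_rows m R f" and f': "depends_on_rows m R' f'" and disj: "R \<inter> R' = {}"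
    and R: "R \<subseteq> {..<m}" "R' \<subseteq> {..<m}"
  shows "(\<Sum>g\<in>unitriangular m. f g) * (\<Sum>g\<in>unitriangular m. f' g) =
    of_nat (card (unitriangular m :: 'a mat set)) * (\<Sum>g\<in>unitriangular m. f g * f' g)"
proof -
  let ?T = "unitriangular m :: 'a mat set"
  define mix where "mix g h = mat m m (\<lambda>(i, j). if i \<in> R then g $$ (i, j) else h $$ (i, j))" for g h :: "'a mat"
  have mT: "mix g h \<in> ?T" if "g \<in> ?T" "h \<in> ?T" for g h
    by (rule unitriangularI) (use unitriangularD[OF that(1)] unitriangularD[OF that(2)] in \<open>auto simp: mix_def\<close>)
  have mm: "mix (mix g h) (mix h g) = g" if "g \<in> ?T" "h \<in> ?T" for g h
    using unitriangularD(1)[OF that(1)] by (intro eq_matI) (auto simp: mix_def)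
  have e: "f g * f' h = f (mix g h) * f' (mix g h)" if "g \<in> ?T" "h \<in> ?T" for g h
  proof -
    have "mix g h $$ (i, j) = g $$ (i, j)" if "i \<in> R" "j < m" for i j
    proof -
      have "i \<in> {..<m}" using that R by blast
      thus ?thesis using that by (simp add: mix_def)
    qed
    hence "f g = f (mix g h)" using f that mT[OF that] unfolding depends_on_rows_def by metis
    moreover have "mix g h $$ (i, j) = h $$ (i, j)" if "i \<in> R'" "j < m" for i j
    proof -
      have "i \<in> {..<m}" "i \<notin> R" using that R disj by blast+
      thus ?thesis using that by (simp add: mix_def)
    qed
    hence "f' h = f' (mix g h)" using f' that mT[OF that] unfolding depends_on_rows_def by metis
    ultimately show ?thesis by simp
  qed
  have "(\<Sum>g\<in>?T. f g) * (\<Sum>g\<in>?T. f' g) = (\<Sum>(g, h)\<in>?T \<times> ?T. f g * f' h)"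
    by (simp only: sum_product sum.cartesian_product)
  also have "\<dots> = (\<Sum>p\<in>?T \<times> ?T. (\<lambda>(a, b). f a * f' a) (case p of (g, h) \<Rightarrow> (mix g h, mix h g)))"
    by (intro sum.cong refl) (auto simp: e)
  also have "\<dots> = (\<Sum>(a, b)\<in>?T \<times> ?T. f a * f' a)"
  proof (rule sum.reindex_bij_betw)
    show "bij_betw (\<lambda>p. case p of (g, h) \<Rightarrow> (mix g h, mix h g)) (?T \<times> ?T) (?T \<times> ?T)"
      by (rule bij_betwI[where g = "\<lambda>p. case p of (g, h) \<Rightarrow> (mix g h, mix h g)"]) (use mT mm in auto)
  qed
  also have "\<dots> = (\<Sum>a\<in>?T. \<Sum>b\<in>?T. f a * f' a)" by (simp only: sum.cartesian_product)
  finally show ?thesis by (simp add: sum_distrib_left)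
qed

text \<open>Merging the sums one at a time costs one factor for each index but the first. The extra
  factor on the left makes the exponent \<open>card I\<close>, so that the empty product fits
  too.\<close>

lemma prod_sum_rows:
  fixes f :: "'i \<Rightarrow> 'a::{field,finite} mat \<Rightarrow> complex"
  assumes "finite I" and "\<And>i. i \<in> I \<Longrightarrow> depends_on_rows m (R i) (f i)" and "\<And>i. i \<in> I \<Longrightarrow> R i \<subseteq> {..<m}"
    and "\<And>i j. i \<in> I \<Longrightarrow> j \<in> I \<Longrightarrow> i \<noteq> j \<Longrightarrow> R i \<inter> R j = {}"
  shows "of_nat (card (unitriangular m :: 'a mat set)) * (\<Prod>i\<in>I. \<Sum>g\<in>unitriangular m. f i g) =
    of_nat (card (unitriangular m :: 'a mat set)) ^ card I * (\<Sum>g\<in>unitriangular m. \<Prod>i\<in>I. f i g)"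
  using assms
proof (induction I)
  case empty
  show ?case by simp
next
  case (insert i I)
  let ?T = "unitriangular m :: 'a mat set"
  have IH: "of_nat (card ?T) * (\<Prod>i\<in>I. \<Sum>g\<in>?T. f i g) = of_nat (card ?T) ^ card I * (\<Sum>g\<in>?T. \<Prod>i\<in>I. f i g)"
    using insert by blast
  have dep: "depends_on_rows m (\<Union>i\<in>I. R i) (\<lambda>g. \<Prod>i\<in>I. f i g)"
    unfolding depends_on_rows_def
  proof (intro ballI impI prod.cong refl)
    fix g h :: "'a mat" and j assume a: "g \<in> ?T" "h \<in> ?T" "\<forall>i\<in>\<Union>i\<in>I. R i. \<forall>j<m. g $$ (i, j) = h $$ (i, j)" "j \<in> I"
    show "f j g = f j h"
      using insert.prems(1)[of j] a unfolding depends_on_rows_def by blast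
  qed
  have disj: "R i \<inter> (\<Union>i\<in>I. R i) = {}" using insert.prems(3)[of i] insert.hyps by blast
  have sub: "R i \<subseteq> {..<m}" "(\<Union>i\<in>I. R i) \<subseteq> {..<m}" using insert.prems(2) by blast+
  have di: "depends_on_rows m (R i) (f i)" using insert.prems(1) by blast
  have "of_nat (card ?T) * (\<Prod>i\<in>insert i I. \<Sum>g\<in>?T. f i g) = (\<Sum>g\<in>?T. f i g) * (of_nat (card ?T) * (\<Prod>i\<in>I. \<Sum>g\<in>?T. f i g))"
    using insert.hyps by (simp add: mult_ac)
  also have "\<dots> = of_nat (card ?T) ^ card I * ((\<Sum>g\<in>?T. f i g) * (\<Sum>g\<in>?T. \<Prod>i\<in>I. f i g))"
    unfolding IH by (simp only: mult.left_commute)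
  also have "\<dots> = of_nat (card ?T) ^ card I * (of_nat (card ?T) * (\<Sum>g\<in>?T. f i g * (\<Prod>i\<in>I. f i g)))"
    unfolding sum_times_sum_rows[OF di dep disj sub] ..
  also have "\<dots> = of_nat (card ?T) ^ card (insert i I) * (\<Sum>g\<in>?T. \<Prod>i\<in>insert i I. f i g)"
    using insert.hyps by (simp add: mult_ac)
  finally show ?case .
qed

text \<open>Up to normalisation, the average over the congruence orbit of \<open>B\<close> of an
  additive character of forms. The sign is that of \<open>row_group_cayley_entry\<close>.\<close>

definition orbit_sum ::
  "group_type \<Rightarrow> nat \<Rightarrow> ('a::field \<Rightarrow> complex) \<Rightarrow> root set \<Rightarrow> (root \<Rightarrow> 'a) \<Rightarrow> 'a mat \<Rightarrow> complex" where
  "orbit_sum G n \<theta> D \<phi> B = (\<Sum>g\<in>unitriangular (dimn G n).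
     \<theta> (\<Sum>\<alpha>\<in>D. \<phi> \<alpha> * form_sign G n (dimn G n - 1 - snd (root_pair G n \<alpha>)) *
       (g * B * g\<^sup>T) $$ root_pair G n \<alpha>))"

lemma additive_character_sum:
  assumes \<theta>: "nontrivial_additive_character \<theta>" and "finite I"
  shows "\<theta> (\<Sum>i\<in>I. f i) = (\<Prod>i\<in>I. \<theta> (f i))"
  using assms(2) by (induction I) (simp_all add: nontrivial_additive_characterD[OF \<theta>])

lemma card_unitriangular_nonzero: "card (unitriangular m :: 'a::{field,finite} mat set) \<noteq> 0"
  using finite_unitriangular one_unitriangular by (metis card_0_eq empty_iff)

text \<open>Each elementary character is a sum of a function of two rows. Disjointness of the pairs
  of a basic set allows the product of these sums to be merged by \<open>prod_sum_rows\<close>, and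
  \<theta> turns the product of values into the value at a sum.\<close>

lemma supercharacter_eq_orbit_sum:
  fixes \<phi> :: "root \<Rightarrow> 'a::{field,finite}"
  assumes two: "(2::'a) \<noteq> 0" and \<theta>: "nontrivial_additive_character \<theta>" and B: "basic_pair G n D \<phi>"
  obtains c where "c \<noteq> 0"
    "\<And>x. x \<in> U_set G n \<Longrightarrow> supercharacter G n \<theta> D \<phi> x = c * orbit_sum G n \<theta> D \<phi> (cayley G n x)"
proof -
  let ?m = "dimn G n" and ?T = "unitriangular (dimn G n) :: 'a mat set"
  have b: "basic G n D" and D: "D \<subseteq> roots G n" and ph: "\<And>\<alpha>. \<alpha> \<in> D \<Longrightarrow> \<phi> \<alpha> \<noteq> 0"
    using B by (auto simp: basic_pair_def basic_def)
  have fin: "finite D" using finite_subset[OF D finite_roots] .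
  define K L where "K \<alpha> = fst (root_pair G n \<alpha>)" and "L \<alpha> = snd (root_pair G n \<alpha>)" for \<alpha>
  have KL: "root_pair G n \<alpha> = (K \<alpha>, L \<alpha>)" for \<alpha> by (simp add: K_def L_def)
  have kl: "(K \<alpha>, L \<alpha>) \<in> pairs G n" if "\<alpha> \<in> D" for \<alpha> using root_pair_in_pairs[of \<alpha> G n] D that KL by auto
  let ?H = "\<lambda>\<alpha>. row_group G n (K \<alpha>) (L \<alpha>) :: 'a mat set"
  have cH: "card (?H \<alpha>) \<noteq> 0" if "\<alpha> \<in> D" for \<alpha>
  proof -
    have "1\<^sub>m ?m \<in> ?H \<alpha>" using pairsD[OF kl[OF that]] one_unitriangular[of ?m] by (auto simp: row_group_def dimn_def)
    moreover have "finite (?H \<alpha>)" by (rule finite_subset[OF _ finite_unitriangular[of ?m]]) (auto simp: row_group_def)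
    ultimately show ?thesis by auto
  qed
  define t where "t = complex_of_nat (card ?T)"
  have t0: "t \<noteq> 0" using card_unitriangular_nonzero[of ?m, where ?'a = 'a] by (simp add: t_def)
  \<comment> \<open>The order of each row group comes from one elementary character; the power of
    \<open>t\<close> divided by \<open>t\<close> comes from merging the sums, and for empty
    \<open>D\<close> it makes \<open>c\<close> the normalising factor of a constant sum.\<close>
  define c where "c = t ^ card D / t / (\<Prod>\<alpha>\<in>D. of_nat (card (?H \<alpha>)))"
  have "c \<noteq> 0" using t0 cH fin by (simp add: c_def)
  moreover have "supercharacter G n \<theta> D \<phi> x = c * orbit_sum G n \<theta> D \<phi> (cayley G n x)" if x: "x \<in> U_set G n" for x
  proof -
    let ?B = "cayley G n x"
    have Bc: "?B \<in> carrier_mat ?m ?m" by (rule cayley_props(1)[OF refl two U_set_unitriangular[OF x]])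
    let ?f = "\<lambda>\<alpha> g. \<theta> (\<phi> \<alpha> * form_sign G n (?m - 1 - L \<alpha>) * (g * ?B * g\<^sup>T) $$ (K \<alpha>, L \<alpha>))"
    have dep: "depends_on_rows ?m {K \<alpha>, L \<alpha>} (?f \<alpha>)" if "\<alpha> \<in> D" for \<alpha>
      unfolding depends_on_rows_def
    proof (intro ballI impI)
      fix g h assume g: "g \<in> ?T" and h: "h \<in> ?T"
        and eq: "\<forall>i\<in>{K \<alpha>, L \<alpha>}. \<forall>j<?m. g $$ (i, j) = h $$ (i, j)"
      note p = pairsD(4,3)[OF kl[OF that]]
      have "(g * ?B * g\<^sup>T) $$ (K \<alpha>, L \<alpha>) = (h * ?B * h\<^sup>T) $$ (K \<alpha>, L \<alpha>)"
        unfolding congruence_entry[OF unitriangularD(1)[OF g] Bc p] congruence_entry[OF unitriangularD(1)[OF h] Bc p]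
        using eq by simp
      thus "?f \<alpha> g = ?f \<alpha> h" by simp
    qed
    have disj: "{K \<alpha>, L \<alpha>} \<inter> {K \<beta>, L \<beta>} = {}" if "\<alpha> \<in> D" "\<beta> \<in> D" "\<alpha> \<noteq> \<beta>" for \<alpha> \<beta>
      using b[unfolded basic_iff_disjoint, THEN conjunct2, rule_format, OF that(1,2) KL KL that(3)] .
    have "t * (\<Prod>\<alpha>\<in>D. \<Sum>g\<in>?T. ?f \<alpha> g) = t ^ card D * (\<Sum>g\<in>?T. \<Prod>\<alpha>\<in>D. ?f \<alpha> g)"
      unfolding t_def
    proof (rule prod_sum_rows[OF fin dep _ disj])
      show "{K \<alpha>, L \<alpha>} \<subseteq> {..<?m}" if "\<alpha> \<in> D" for \<alpha> using pairsD(3,4)[OF kl[OF that]] by auto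
    qed
    also have "(\<Sum>g\<in>?T. \<Prod>\<alpha>\<in>D. ?f \<alpha> g) = orbit_sum G n \<theta> D \<phi> ?B"
      unfolding orbit_sum_def KL snd_conv additive_character_sum[OF \<theta> fin] ..
    finally have P: "(\<Prod>\<alpha>\<in>D. \<Sum>g\<in>?T. ?f \<alpha> g) = t ^ card D * orbit_sum G n \<theta> D \<phi> ?B / t"
      using t0 by (simp add: field_simps)
    have "supercharacter G n \<theta> D \<phi> x = (\<Prod>\<alpha>\<in>D. (\<Sum>g\<in>?T. ?f \<alpha> g) / of_nat (card (?H \<alpha>)))"
      unfolding supercharacter_def using x
    proof (simp only: if_True, intro prod.cong refl)
      fix \<alpha> assume "\<alpha> \<in> D"
      thus "elementary_character G n \<theta> \<alpha> (\<phi> \<alpha>) x = (\<Sum>g\<in>?T. ?f \<alpha> g) / of_nat (card (?H \<alpha>))"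
        using D by (intro elementary_character_eq[OF two \<theta> ph _ KL x]) auto
    qed
    also have "\<dots> = (\<Prod>\<alpha>\<in>D. \<Sum>g\<in>?T. ?f \<alpha> g) / (\<Prod>\<alpha>\<in>D. of_nat (card (?H \<alpha>)))" by (rule prod_dividef)
    finally show ?thesis unfolding P c_def by simp
  qed
  ultimately show ?thesis using that by blast
qed

lemma orbit_sum_congruence:
  fixes B :: "'a::{field,finite} mat"
  assumes B: "B \<in> carrier_mat (dimn G n) (dimn G n)" and u: "u \<in> unitriangular (dimn G n)"
  shows "orbit_sum G n \<theta> D \<phi> (u * B * u\<^sup>T) = orbit_sum G n \<theta> D \<phi> B"
proof -
  let ?m = "dimn G n"
  have e: "g * (u * B * u\<^sup>T) * g\<^sup>T = (g * u) * B * (g * u)\<^sup>T"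
    if "g \<in> unitriangular ?m" for g
    using unitriangularD(1)[OF that] unitriangularD(1)[OF u] B
    by (simp add: square_mat_simps[where m = ?m])
  show ?thesis
    unfolding orbit_sum_def
    by (subst sum_unitriangular_shift[OF u, symmetric]) (intro sum.cong refl, simp add: e)
qed

lemma supercharacter_in_scf:
  fixes \<phi> :: "root \<Rightarrow> 'a::{field,finite}"
  assumes two: "(2::'a) \<noteq> 0" and \<theta>: "nontrivial_additive_character \<theta>" and B: "basic_pair G n D \<phi>"
  shows "supercharacter G n \<theta> D \<phi> \<in> scf G n"
proof -
  obtain c where c: "\<And>x. x \<in> U_set G n \<Longrightarrow> supercharacter G n \<theta> D \<phi> x = c * orbit_sum G n \<theta> D \<phi> (cayley G n x)"
    using supercharacter_eq_orbit_sum[OF two \<theta> B] by metis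
  have os: "supercharacter G n \<theta> D \<phi> x = c * orbit_sum G n \<theta> D \<phi> (superform G n D' \<phi>')"
    if B': "basic_pair G n D' \<phi>'" and x: "x \<in> superclass G n D' \<phi>'" for x D' \<phi>'
  proof -
    obtain g where g: "g \<in> unitriangular (dimn G n)" "g * cayley G n x * g\<^sup>T = superform G n D' \<phi>'" and xU: "x \<in> U_set G n"
      using x superclass_iff[OF two B'] by blast
    have "cayley G n x \<in> carrier_mat (dimn G n) (dimn G n)"
      by (rule cayley_props(1)[OF refl two U_set_unitriangular[OF xU]])
    from orbit_sum_congruence[OF this g(1)] show ?thesis unfolding c[OF xU] g(2) by simp
  qed
  show ?thesis unfolding scf_def
  proof (intro CollectI conjI allI impI ballI)
    show "supercharacter G n \<theta> D \<phi> x = 0" if "x \<notin> U_set G n" for x using that by (simp add: supercharacter_def)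
    show "supercharacter G n \<theta> D \<phi> x = supercharacter G n \<theta> D \<phi> y"
      if "basic_pair G n D' \<phi>'" "x \<in> superclass G n D' \<phi>'" "y \<in> superclass G n D' \<phi>'" for D' \<phi>' x y
      unfolding os[OF that(1,2)] os[OF that(1,3)] ..
  qed
qed

section \<open>Fourier analysis on the space of matrices\<close>

definition mat_pairing :: "nat \<Rightarrow> 'a::comm_semiring_0 mat \<Rightarrow> 'a mat \<Rightarrow> 'a" where
  "mat_pairing m A X = (\<Sum>i<m. \<Sum>j<m. A $$ (i, j) * X $$ (i, j))"

text \<open>Adjointness: the action on forms moves to the contragredient action on coefficient
  matrices.\<close>

lemma mat_pairing_congruence:
  fixes A :: "'a::field mat"
  assumes A: "A \<in> carrier_mat m m" and X: "X \<in> carrier_mat m m" and u: "u \<in> carrier_mat m m"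
  shows "mat_pairing m (u\<^sup>T * A * u) X = mat_pairing m A (u * X * u\<^sup>T)"
proof -
  let ?t = "\<lambda>i j a b. u $$ (a, i) * u $$ (b, j) * A $$ (a, b) * X $$ (i, j)"
  have L: "(u\<^sup>T * A * u) $$ (i, j) = (\<Sum>a<m. u $$ (a, i) * (\<Sum>b<m. u $$ (b, j) * A $$ (a, b)))"
    if "i < m" "j < m" for i j
    using congruence_entry[of "u\<^sup>T" m A i j] u A that by (simp del: index_mult_mat(1))
  have "mat_pairing m (u\<^sup>T * A * u) X = (\<Sum>i<m. \<Sum>j<m. \<Sum>a<m. \<Sum>b<m. ?t i j a b)"
    unfolding mat_pairing_def
    by (intro sum.cong refl) (simp add: L sum_distrib_left sum_distrib_right mult_ac del: index_mult_mat(1))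
  also have "\<dots> = (\<Sum>i<m. \<Sum>a<m. \<Sum>j<m. \<Sum>b<m. ?t i j a b)" by (rule sum.cong[OF refl], rule sum.swap)
  also have "\<dots> = (\<Sum>a<m. \<Sum>i<m. \<Sum>j<m. \<Sum>b<m. ?t i j a b)" by (rule sum.swap)
  also have "\<dots> = (\<Sum>a<m. \<Sum>i<m. \<Sum>b<m. \<Sum>j<m. ?t i j a b)"
    by (rule sum.cong[OF refl], rule sum.cong[OF refl], rule sum.swap)
  also have "\<dots> = (\<Sum>a<m. \<Sum>b<m. \<Sum>i<m. \<Sum>j<m. ?t i j a b)" by (rule sum.cong[OF refl], rule sum.swap)
  also have "\<dots> = mat_pairing m A (u * X * u\<^sup>T)"
    unfolding mat_pairing_def
    by (intro sum.cong refl) (simp add: congruence_entry[OF u X] sum_distrib_left sum_distrib_right mult_ac del: index_mult_mat(1))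
  finally show ?thesis .
qed

lemma mat_pairing_diff:
  fixes A :: "'a::field mat"
  assumes "X \<in> carrier_mat m m" "Y \<in> carrier_mat m m"
  shows "mat_pairing m A (X - Y) = mat_pairing m A X + - mat_pairing m A Y"
proof -
  have "mat_pairing m A (X - Y) = (\<Sum>i<m. \<Sum>j<m. A $$ (i, j) * X $$ (i, j) - A $$ (i, j) * Y $$ (i, j))"
    unfolding mat_pairing_def using assms by (intro sum.cong refl) (simp add: right_diff_distrib)
  thus ?thesis by (simp add: mat_pairing_def sum_subtractf)
qed

text \<open>If \<open>X\<close> has a non-zero entry, changing the corresponding entry of
  \<open>A\<close> permutes the summands and multiplies the sum by a value of \<theta> other than
  1.\<close>

lemma mat_pairing_orthogonality:
  fixes X :: "'a::{field,finite} mat"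
  assumes \<theta>: "nontrivial_additive_character \<theta>" and X: "X \<in> carrier_mat m m"
  shows "(\<Sum>A\<in>carrier_mat m m. \<theta> (mat_pairing m A X)) =
    (if X = 0\<^sub>m m m then of_nat (card (carrier_mat m m :: 'a mat set)) else 0)"
proof (cases "X = 0\<^sub>m m m")
  case True
  have "mat_pairing m A X = 0" for A unfolding mat_pairing_def True by (simp add: sum.neutral)
  thus ?thesis using True nontrivial_additive_characterD(3)[OF \<theta>] by simp
next
  case False
  then obtain r s where rs: "r < m" "s < m" "X $$ (r, s) \<noteq> 0" using X by (auto simp: mat_eq_iff)
  obtain a where a: "\<theta> a \<noteq> 1" using nontrivial_additive_characterD(4)[OF \<theta>] by blast
  define t where "t = a / X $$ (r, s)"
  have t: "t * X $$ (r, s) = a" using rs by (simp add: t_def)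
  define f where "f t A = mat m m (\<lambda>(i, j). A $$ (i, j) + (if i = r \<and> j = s then t else 0))" for t and A :: "'a mat"
  have bij: "bij_betw (f t) (carrier_mat m m) (carrier_mat m m)"
    by (rule bij_betwI[where g = "f (- t)"]) (auto simp: f_def intro!: eq_matI)
  have fp: "mat_pairing m (f t A) X = mat_pairing m A X + a" for A
  proof -
    have "mat_pairing m (f t A) X = (\<Sum>i<m. \<Sum>j<m. A $$ (i, j) * X $$ (i, j) + (if j = s then (if i = r then t * X $$ (r, s) else 0) else 0))"
      unfolding mat_pairing_def by (intro sum.cong refl) (auto simp: f_def distrib_right)
    also have "\<dots> = mat_pairing m A X + (\<Sum>i<m. if i = r then t * X $$ (r, s) else 0)"
      using rs by (simp add: mat_pairing_def sum.distrib sum.delta)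
    also have "\<dots> = mat_pairing m A X + a" using rs t by (simp add: sum.delta)
    finally show ?thesis .
  qed
  let ?S = "\<Sum>A\<in>carrier_mat m m. \<theta> (mat_pairing m A X)"
  have "?S = (\<Sum>A\<in>carrier_mat m m. \<theta> (mat_pairing m (f t A) X))"
    by (rule sum.reindex_bij_betw[OF bij, symmetric])
  also have "\<dots> = ?S * \<theta> a" by (simp only: fp nontrivial_additive_characterD(1)[OF \<theta>] sum_distrib_right)
  finally have "?S * (1 - \<theta> a) = 0" by (simp add: right_diff_distrib)
  thus ?thesis using a False by simp
qed

text \<open>The mirrored positions (k, l) and (l, k) contribute equally, because eps squares to 1;
  hence the factor 2 off the diagonal.\<close>

lemma mat_pairing_superform:
  fixes \<phi> :: "root \<Rightarrow> 'a::field"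
  assumes D: "D \<subseteq> roots G n" and X: "eps_symmetric (dimn G n) (form_eps G) X"
  shows "mat_pairing (dimn G n) (superform G n D \<phi>) X =
    (\<Sum>\<alpha>\<in>D. (if fst (root_pair G n \<alpha>) = snd (root_pair G n \<alpha>) then 1 else 2) * \<phi> \<alpha> *
       form_sign G n (dimn G n - 1 - snd (root_pair G n \<alpha>)) * X $$ root_pair G n \<alpha>)"
proof -
  let ?m = "dimn G n"
  have pr: "(\<Sum>s<?m. \<Sum>t<?m. (case root_pair G n \<alpha> of (k, l) \<Rightarrow> \<phi> \<alpha> * form_sign G n (?m - 1 - l) *
      ((if s = k \<and> t = l then 1 else 0) + (if s = l \<and> t = k \<and> k \<noteq> l then form_eps G else 0))) * X $$ (s, t)) =
    (if fst (root_pair G n \<alpha>) = snd (root_pair G n \<alpha>) then 1 else 2) * \<phi> \<alpha> *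
       form_sign G n (?m - 1 - snd (root_pair G n \<alpha>)) * X $$ root_pair G n \<alpha>" if "\<alpha> \<in> D" for \<alpha>
  proof -
    obtain k l where kl: "root_pair G n \<alpha> = (k, l)" by fastforce
    have lt: "k < ?m" "l < ?m" using pairsD(3,4)[of k l G n] root_pair_in_pairs[of \<alpha> G n] D that kl by auto
    let ?c = "\<phi> \<alpha> * form_sign G n (?m - 1 - l)"
    have d: "(\<Sum>s<?m. \<Sum>t<?m. if s = p then (if t = q then h s t else 0) else 0) = h p q" if "p < ?m" "q < ?m"
      for p q and h :: "nat \<Rightarrow> nat \<Rightarrow> 'a"
    proof -
      have "(\<Sum>s<?m. \<Sum>t<?m. if s = p then (if t = q then h s t else 0) else 0) = (\<Sum>s<?m. if s = p then h s q else 0)"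
        using that by (intro sum.cong refl) (auto simp: sum.delta)
      thus ?thesis using that by (simp add: sum.delta)
    qed
    have "(\<Sum>s<?m. \<Sum>t<?m. (?c * ((if s = k \<and> t = l then 1 else 0) + (if s = l \<and> t = k \<and> k \<noteq> l then form_eps G else 0))) * X $$ (s, t)) =
      (\<Sum>s<?m. \<Sum>t<?m. (if s = k then (if t = l then ?c * X $$ (s, t) else 0) else 0) +
         (if s = l then (if t = k then (if k = l then 0 else ?c * form_eps G * X $$ (s, t)) else 0) else 0))"
    proof (intro sum.cong refl)
      fix s t
      show "(?c * ((if s = k \<and> t = l then 1 else 0) + (if s = l \<and> t = k \<and> k \<noteq> l then form_eps G else 0))) * X $$ (s, t) =
        (if s = k then (if t = l then ?c * X $$ (s, t) else 0) else 0) +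
         (if s = l then (if t = k then (if k = l then 0 else ?c * form_eps G * X $$ (s, t)) else 0) else 0)"
        by (cases "k = l"; cases "s = k"; cases "s = l"; cases "t = k"; cases "t = l") (simp_all add: algebra_simps)
    qed
    also have "\<dots> = ?c * X $$ (k, l) + (if k = l then 0 else ?c * form_eps G * X $$ (l, k))"
      unfolding sum.distrib d[OF lt] d[OF lt(2,1)] ..
    also have "\<dots> = (if k = l then 1 else 2) * ?c * X $$ (k, l)"
    proof (cases "k = l")
      case False
      have "X $$ (l, k) = form_eps G * X $$ (k, l)" using X lt unfolding eps_symmetric_def by blast
      moreover have "form_eps G * form_eps G = (1::'a)" by (simp add: form_eps_def)
      ultimately have "form_eps G * X $$ (l, k) = X $$ (k, l)" by (simp add: mult.assoc[symmetric])
      hence "?c * form_eps G * X $$ (l, k) = ?c * X $$ (k, l)" by (simp only: mult.assoc)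
      thus ?thesis by (simp only: if_not_P[OF False] mult_2 distrib_right)
    qed simp
    finally show ?thesis unfolding kl prod.case fst_conv snd_conv by (simp add: mult.assoc)
  qed
  have "mat_pairing ?m (superform G n D \<phi>) X = (\<Sum>s<?m. \<Sum>t<?m. \<Sum>\<alpha>\<in>D. (case root_pair G n \<alpha> of (k, l) \<Rightarrow> \<phi> \<alpha> * form_sign G n (?m - 1 - l) *
      ((if s = k \<and> t = l then 1 else 0) + (if s = l \<and> t = k \<and> k \<noteq> l then form_eps G else 0))) * X $$ (s, t))"
    unfolding mat_pairing_def
  proof (intro sum.cong refl)
    fix s t assume "s \<in> {..<?m}" "t \<in> {..<?m}"
    hence st: "s < ?m" "t < ?m" by auto
    show "superform G n D \<phi> $$ (s, t) * X $$ (s, t) = (\<Sum>\<alpha>\<in>D. (case root_pair G n \<alpha> of (k, l) \<Rightarrow> \<phi> \<alpha> * form_sign G n (?m - 1 - l) *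
      ((if s = k \<and> t = l then 1 else 0) + (if s = l \<and> t = k \<and> k \<noteq> l then form_eps G else 0))) * X $$ (s, t))"
      unfolding superform_entry[OF D st] by (rule sum_distrib_right)
  qed
  also have "\<dots> = (\<Sum>s<?m. \<Sum>\<alpha>\<in>D. \<Sum>t<?m. (case root_pair G n \<alpha> of (k, l) \<Rightarrow> \<phi> \<alpha> * form_sign G n (?m - 1 - l) *
      ((if s = k \<and> t = l then 1 else 0) + (if s = l \<and> t = k \<and> k \<noteq> l then form_eps G else 0))) * X $$ (s, t))"
    by (rule sum.cong[OF refl], rule sum.swap)
  also have "\<dots> = (\<Sum>\<alpha>\<in>D. \<Sum>s<?m. \<Sum>t<?m. (case root_pair G n \<alpha> of (k, l) \<Rightarrow> \<phi> \<alpha> * form_sign G n (?m - 1 - l) *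
      ((if s = k \<and> t = l then 1 else 0) + (if s = l \<and> t = k \<and> k \<noteq> l then form_eps G else 0))) * X $$ (s, t))"
    by (rule sum.swap)
  finally show ?thesis by (simp only: pr cong: sum.cong)
qed

text \<open>Three changes of the coefficient matrix leave the sum unchanged: passing to its
  eps-symmetric part, acting by an element \<open>u\<close> that makes it monomial, and discarding
  what lies on or below the anti-diagonal. The result is a normal form.\<close>

lemma character_sum_eq_orbit_sum:
  fixes A :: "'a::{field,finite} mat"
  assumes two: "(2::'a) \<noteq> 0" and A: "A \<in> carrier_mat (dimn G n) (dimn G n)"
  obtains D \<phi> where "basic_pair G n D \<phi>"
    "\<And>\<theta> B. supported_form G n B \<Longrightarrow>
      (\<Sum>g\<in>unitriangular (dimn G n). \<theta> (mat_pairing (dimn G n) A (g * B * g\<^sup>T))) = orbit_sum G n \<theta> D \<phi> B"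
proof -
  let ?m = "dimn G n" and ?e = "form_eps G :: 'a" and ?T = "unitriangular (dimn G n) :: 'a mat set"
  have e2: "?e * ?e = 1" by (simp add: form_eps_def)
  \<comment> \<open>The eps-symmetric part of \<open>A\<close>; the complementary part pairs to zero
    with eps-symmetric matrices.\<close>
  define S where "S = mat ?m ?m (\<lambda>(i, j). (A $$ (i, j) + ?e * A $$ (j, i)) / 2)"
  have Sc: "S \<in> carrier_mat ?m ?m" by (simp add: S_def)
  have Ssym: "eps_symmetric ?m ?e S"
  proof -
    have "S $$ (j, i) = ?e * S $$ (i, j)" if "i < ?m" "j < ?m" for i j
    proof -
      have "?e * S $$ (i, j) = ?e * ((A $$ (i, j) + ?e * A $$ (j, i)) / 2)" using that by (simp add: S_def)
      also have "\<dots> = (?e * A $$ (i, j) + (?e * ?e) * A $$ (j, i)) / 2"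
        by (simp only: times_divide_eq_right distrib_left mult.assoc)
      also have "\<dots> = S $$ (j, i)" unfolding e2 using that by (simp add: S_def add.commute)
      finally show ?thesis ..
    qed
    thus ?thesis using Sc unfolding eps_symmetric_def by blast
  qed
  have AS: "mat_pairing ?m A X = mat_pairing ?m S X" if X: "eps_symmetric ?m ?e X" for X
  proof -
    have Xs: "X $$ (i, j) = ?e * X $$ (j, i)" if "i < ?m" "j < ?m" for i j using X that unfolding eps_symmetric_def by blast
    have "(\<Sum>i<?m. \<Sum>j<?m. ?e * A $$ (j, i) * X $$ (i, j)) = (\<Sum>i<?m. \<Sum>j<?m. A $$ (j, i) * X $$ (j, i))"
    proof (intro sum.cong refl)
      fix i j assume ij: "i \<in> {..<?m}" "j \<in> {..<?m}"
      have "?e * A $$ (j, i) * X $$ (i, j) = ?e * A $$ (j, i) * (?e * X $$ (j, i))" using Xs[of i j] ij by simp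
      also have "\<dots> = (?e * ?e) * (A $$ (j, i) * X $$ (j, i))" by (simp only: mult_ac)
      finally show "?e * A $$ (j, i) * X $$ (i, j) = A $$ (j, i) * X $$ (j, i)" unfolding e2 by simp
    qed
    also have "\<dots> = mat_pairing ?m A X" unfolding mat_pairing_def by (rule sum.swap)
    finally have 1: "(\<Sum>i<?m. \<Sum>j<?m. ?e * A $$ (j, i) * X $$ (i, j)) = mat_pairing ?m A X" .
    have "mat_pairing ?m S X = (\<Sum>i<?m. \<Sum>j<?m. (A $$ (i, j) * X $$ (i, j) + ?e * A $$ (j, i) * X $$ (i, j)) / 2)"
      unfolding mat_pairing_def by (intro sum.cong refl) (simp add: S_def distrib_right)
    also have "\<dots> = (mat_pairing ?m A X + mat_pairing ?m A X) / 2"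
      unfolding sum_divide_distrib[symmetric] sum.distrib 1 by (simp add: mat_pairing_def)
    also have "\<dots> = mat_pairing ?m A X" using two by (simp add: mult_2[symmetric])
    finally show ?thesis ..
  qed
  obtain u where u: "u \<in> ?T" "monomial ?m (u\<^sup>T * S * u)"
    using dual_congruent_to_monomial[OF two form_eps_cases Ssym] by blast
  note uc = unitriangularD(1)[OF u(1)]
  let ?M = "u\<^sup>T * S * u"
  have Msym: "eps_symmetric ?m ?e ?M"
    using eps_symmetric_congruence[of "u\<^sup>T" ?m ?e S] Ssym uc by simp
  \<comment> \<open>The truncation is invisible to supported forms, and it keeps both monomiality
    and eps-symmetry.\<close>
  define M where "M = mat ?m ?m (\<lambda>(i, j). if i + j + 1 < ?m then ?M $$ (i, j) else 0)"
  have Me: "M $$ (i, j) = (if i + j + 1 < ?m then ?M $$ (i, j) else 0)" if "i < ?m" "j < ?m" for i j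
    using that unfolding M_def by simp
  have "normal_form G n M"
    unfolding normal_form_def
  proof (intro conjI allI impI)
    have "M $$ (j, i) = ?e * M $$ (i, j)" if "i < ?m" "j < ?m" for i j
    proof -
      have s: "?M $$ (j, i) = ?e * ?M $$ (i, j)" using Msym that unfolding eps_symmetric_def by blast
      show ?thesis unfolding Me[OF that] Me[OF that(2,1)] s by (simp add: add.commute)
    qed
    thus "eps_symmetric ?m ?e M" unfolding eps_symmetric_def by (auto simp only: M_def mat_carrier)
    have nz: "?M $$ (i, j) \<noteq> 0" if "i < ?m" "j < ?m" "M $$ (i, j) \<noteq> 0" for i j
      using that(3) unfolding Me[OF that(1,2)] by presburger
    show "monomial ?m M"
      unfolding monomial_def
    proof (intro conjI allI impI)
      fix i j j' assume a: "i < ?m" "j < ?m" "j' < ?m" "M $$ (i, j) \<noteq> 0" "M $$ (i, j') \<noteq> 0"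
      show "j = j'"
        by (rule u(2)[unfolded monomial_def, THEN conjunct1, rule_format, OF a(1-3) nz[OF a(1,2,4)] nz[OF a(1,3,5)]])
    next
      fix j i i' assume a: "j < ?m" "i < ?m" "i' < ?m" "M $$ (i, j) \<noteq> 0" "M $$ (i', j) \<noteq> 0"
      show "i = i'"
        by (rule u(2)[unfolded monomial_def, THEN conjunct2, rule_format, OF a(1-3) nz[OF a(2,1,4)] nz[OF a(3,1,5)]])
    qed
    show "M $$ (i, j) = 0" if "i < ?m" "j < ?m" "?m \<le> i + j + 1" for i j
      using that by (simp add: M_def)
  qed
  then obtain D \<psi> where D: "basic_pair G n D \<psi>" "superform G n D \<psi> = M"
    using normal_form_superform[OF two] by blast
  have Dr: "D \<subseteq> roots G n" using D(1) by (simp add: basic_pair_def basic_def)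
  \<comment> \<open>Absorbs the factor 2 of \<open>mat_pairing_superform\<close>; as 2 is
    invertible, the values stay non-zero.\<close>
  define \<phi> where "\<phi> = restrict (\<lambda>\<alpha>. (if fst (root_pair G n \<alpha>) = snd (root_pair G n \<alpha>) then 1 else 2) * \<psi> \<alpha>) D"
  have bp: "basic_pair G n D \<phi>"
  proof -
    have "\<psi> \<alpha> \<noteq> 0" if "\<alpha> \<in> D" for \<alpha> using D(1) that by (auto simp: basic_pair_def PiE_iff)
    hence "\<phi> \<in> D \<rightarrow>\<^sub>E (UNIV - {0})" unfolding \<phi>_def using two by (simp add: PiE_iff)
    thus ?thesis using D(1) by (simp add: basic_pair_def)
  qed
  have "(\<Sum>g\<in>?T. \<theta> (mat_pairing ?m A (g * B * g\<^sup>T))) = orbit_sum G n \<theta> D \<phi> B"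
    if B: "supported_form G n B" for \<theta> :: "'a \<Rightarrow> complex" and B
  proof -
    have Bc: "B \<in> carrier_mat ?m ?m" using B by (simp add: supported_form_def eps_symmetric_def)
    have sf: "supported_form G n (g * B * g\<^sup>T)" if "g \<in> ?T" for g
      by (rule supported_form_congruence[OF that B])
    have sfs: "eps_symmetric ?m ?e (g * B * g\<^sup>T)" if "g \<in> ?T" for g
      using sf[OF that] by (simp add: supported_form_def)
    have "(\<Sum>g\<in>?T. \<theta> (mat_pairing ?m A (g * B * g\<^sup>T))) = (\<Sum>g\<in>?T. \<theta> (mat_pairing ?m S (g * B * g\<^sup>T)))"
      by (intro sum.cong refl) (simp only: AS[OF sfs])
    \<comment> \<open>Translating the summation variable inserts \<open>u\<close>, which
      \<open>mat_pairing_congruence\<close> then moves onto \<open>S\<close>.\<close>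
    also have "\<dots> = (\<Sum>g\<in>?T. \<theta> (mat_pairing ?m S ((u * g) * B * (u * g)\<^sup>T)))"
      by (rule sum_unitriangular_left_shift[OF u(1), symmetric])
    also have "\<dots> = (\<Sum>g\<in>?T. \<theta> (\<Sum>\<alpha>\<in>D. \<phi> \<alpha> * form_sign G n (?m - 1 - snd (root_pair G n \<alpha>)) *
       (g * B * g\<^sup>T) $$ root_pair G n \<alpha>))"
    proof (rule sum.cong[OF refl])
      fix g assume g: "g \<in> ?T"
      note gc = unitriangularD(1)[OF g]
      let ?X = "g * B * g\<^sup>T"
      have Xc: "?X \<in> carrier_mat ?m ?m" using sfs[OF g] by (simp add: eps_symmetric_def)
      have "(u * g) * B * (u * g)\<^sup>T = u * ?X * u\<^sup>T"
        using gc uc Bc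
        by (simp add: square_mat_simps[where m = ?m])
      hence "mat_pairing ?m S ((u * g) * B * (u * g)\<^sup>T) = mat_pairing ?m ?M ?X"
        using mat_pairing_congruence[OF Sc Xc uc] by simp
      also have "\<dots> = mat_pairing ?m M ?X"
        unfolding mat_pairing_def
      proof (intro sum.cong refl)
        fix i j assume "i \<in> {..<?m}" "j \<in> {..<?m}"
        hence ij: "i < ?m" "j < ?m" by auto
        show "?M $$ (i, j) * ?X $$ (i, j) = M $$ (i, j) * ?X $$ (i, j)"
        proof (cases "i + j + 1 < ?m")
          case True
          show ?thesis unfolding Me[OF ij] if_P[OF True] ..
        next
          case False
          hence "?X $$ (i, j) = 0" using sf[OF g] ij unfolding supported_form_def by (meson not_less)
          thus ?thesis by (simp only: mult_zero_right)
        qed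
      qed
      also have "\<dots> = (\<Sum>\<alpha>\<in>D. \<phi> \<alpha> * form_sign G n (?m - 1 - snd (root_pair G n \<alpha>)) * ?X $$ root_pair G n \<alpha>)"
        unfolding D(2)[symmetric] mat_pairing_superform[OF Dr sfs[OF g]]
        by (intro sum.cong refl) (simp only: \<phi>_def restrict_apply if_True)
      finally show "\<theta> (mat_pairing ?m S ((u * g) * B * (u * g)\<^sup>T)) =
        \<theta> (\<Sum>\<alpha>\<in>D. \<phi> \<alpha> * form_sign G n (?m - 1 - snd (root_pair G n \<alpha>)) * ?X $$ root_pair G n \<alpha>)" by simp
    qed
    finally show ?thesis unfolding orbit_sum_def .
  qed
  thus ?thesis using that[OF bp] by blast
qed

section \<open>The space of superclass functions\<close>

lemma fun_sum_apply: "(\<Sum>i\<in>A. f i) x = (\<Sum>i\<in>A. f i x :: complex)"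
  by (induction A rule: infinite_finite_induct) simp_all

definition superclass_indicator :: "group_type \<Rightarrow> nat \<Rightarrow> root set \<times> (root \<Rightarrow> 'a::field) \<Rightarrow> 'a mat \<Rightarrow> complex" where
  "superclass_indicator G n p x = (if x \<in> superclass G n (fst p) (snd p) then 1 else 0)"

lemma character_sum_in_span:
  fixes A :: "'a::{field,finite} mat"
  assumes two: "(2::'a) \<noteq> 0" and \<theta>: "nontrivial_additive_character \<theta>" and A: "A \<in> carrier_mat (dimn G n) (dimn G n)"
  shows "\<exists>h\<in>cfun.span (supercharacters G n \<theta>). (\<forall>x\<in>U_set G n. h x =
      (\<Sum>g\<in>unitriangular (dimn G n). \<theta> (mat_pairing (dimn G n) A (g * cayley G n x * g\<^sup>T)))) \<and>
    (\<forall>x. x \<notin> U_set G n \<longrightarrow> h x = 0)"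
proof -
  obtain D \<phi> where B: "basic_pair G n D \<phi>" and
    S: "\<And>\<theta> B. supported_form G n B \<Longrightarrow>
      (\<Sum>g\<in>unitriangular (dimn G n). \<theta> (mat_pairing (dimn G n) A (g * B * g\<^sup>T))) = orbit_sum G n \<theta> D \<phi> B"
    using character_sum_eq_orbit_sum[OF two A] by metis
  obtain c where c: "c \<noteq> 0"
    "\<And>x. x \<in> U_set G n \<Longrightarrow> supercharacter G n \<theta> D \<phi> x = c * orbit_sum G n \<theta> D \<phi> (cayley G n x)"
    using supercharacter_eq_orbit_sum[OF two \<theta> B] by metis
  let ?h = "\<lambda>x. (1 / c) * supercharacter G n \<theta> D \<phi> x"
  have "supercharacter G n \<theta> D \<phi> \<in> supercharacters G n \<theta>" using B by (auto simp: supercharacters_def)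
  hence "?h \<in> cfun.span (supercharacters G n \<theta>)" by (intro cfun.span_scale cfun.span_base)
  moreover have "?h x = (\<Sum>g\<in>unitriangular (dimn G n). \<theta> (mat_pairing (dimn G n) A (g * cayley G n x * g\<^sup>T)))"
    if x: "x \<in> U_set G n" for x
    unfolding S[OF cayley_supported_form[OF two x]] c(2)[OF x] using c(1) by simp
  moreover have "?h x = 0" if "x \<notin> U_set G n" for x using that by (simp add: supercharacter_def)
  ultimately show ?thesis by (intro bexI[of _ ?h] conjI ballI allI impI) assumption+
qed

text \<open>The Fourier inversion runs over all m x m matrices rather than over the dual of the
  eps-symmetric ones. Averaged over the group, every frequency gives a function in the span by
  \<open>character_sum_in_span\<close>.\<close>

lemma superclass_indicator_in_span:
  fixes \<phi> :: "root \<Rightarrow> 'a::{field,finite}"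
  assumes two: "(2::'a) \<noteq> 0" and \<theta>: "nontrivial_additive_character \<theta>" and B: "basic_pair G n D \<phi>"
  shows "superclass_indicator G n (D, \<phi>) \<in> cfun.span (supercharacters G n \<theta>)"
proof -
  let ?m = "dimn G n" and ?T = "unitriangular (dimn G n) :: 'a mat set" and ?E = "superform G n D \<phi>"
  let ?M = "carrier_mat ?m ?m :: 'a mat set"
  have "\<forall>A\<in>?M. \<exists>h. h \<in> cfun.span (supercharacters G n \<theta>) \<and> (\<forall>x\<in>U_set G n. h x =
      (\<Sum>g\<in>?T. \<theta> (mat_pairing ?m A (g * cayley G n x * g\<^sup>T)))) \<and> (\<forall>x. x \<notin> U_set G n \<longrightarrow> h x = 0)"
    using character_sum_in_span[OF two \<theta>] by blast
  from bchoice[OF this] obtain h where h0: "\<forall>A\<in>?M. h A \<in> cfun.span (supercharacters G n \<theta>) \<and> (\<forall>x\<in>U_set G n. h A x =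
      (\<Sum>g\<in>?T. \<theta> (mat_pairing ?m A (g * cayley G n x * g\<^sup>T)))) \<and> (\<forall>x. x \<notin> U_set G n \<longrightarrow> h A x = 0)"
    by (elim exE)
  have h: "\<And>A. A \<in> ?M \<Longrightarrow> h A \<in> cfun.span (supercharacters G n \<theta>)"
    "\<And>A x. A \<in> ?M \<Longrightarrow> x \<in> U_set G n \<Longrightarrow> h A x = (\<Sum>g\<in>?T. \<theta> (mat_pairing ?m A (g * cayley G n x * g\<^sup>T)))"
    "\<And>A x. A \<in> ?M \<Longrightarrow> x \<notin> U_set G n \<Longrightarrow> h A x = 0"
    using h0 by blast+
  \<comment> \<open>Counts the ways of carrying \<open>B\<close> to the normal form. On Cayley
    transforms of the superclass this is the order of the stabiliser of \<open>?E\<close>, on all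
    other Cayley transforms it is zero.\<close>
  define N where "N B = (\<Sum>g\<in>?T. if g * B * g\<^sup>T = ?E then 1 else (0::complex))" for B
  have N0: "N ?E \<noteq> 0"
  proof -
    have "N ?E = of_nat (card {g \<in> ?T. g * ?E * g\<^sup>T = ?E})"
      unfolding N_def by (simp add: sum.inter_filter[OF finite_unitriangular, symmetric])
    moreover have "1\<^sub>m ?m \<in> {g \<in> ?T. g * ?E * g\<^sup>T = ?E}"
      using left_mult_one_mat[OF superform_carrier[of G n D \<phi>]] right_mult_one_mat[OF superform_carrier[of G n D \<phi>]]
      by (simp add: one_unitriangular)
    ultimately show ?thesis using finite_unitriangular[of ?m, where ?'a = 'a] by auto
  qed
  have NK: "N (cayley G n x) = (if x \<in> superclass G n D \<phi> then N ?E else 0)" if x: "x \<in> U_set G n" for x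
  proof (cases "x \<in> superclass G n D \<phi>")
    case True
    then obtain u where u: "u \<in> ?T" "u * cayley G n x * u\<^sup>T = ?E" using superclass_iff[OF two B] by blast
    note uc = unitriangularD(1)[OF u(1)]
    have Bc: "cayley G n x \<in> ?M" by (rule cayley_props(1)[OF refl two U_set_unitriangular[OF x]])
    have e: "(g * u) * cayley G n x * (g * u)\<^sup>T = g * ?E * g\<^sup>T" if "g \<in> ?T" for g
      unfolding u(2)[symmetric] using unitriangularD(1)[OF that] uc Bc
      by (simp add: square_mat_simps[where m = ?m])
    have "N (cayley G n x) = (\<Sum>g\<in>?T. if (g * u) * cayley G n x * (g * u)\<^sup>T = ?E then 1 else 0)"
      unfolding N_def by (rule sum_unitriangular_shift[OF u(1), symmetric])
    also have "\<dots> = N ?E" unfolding N_def by (rule sum.cong[OF refl]) (simp only: e)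
    finally show ?thesis using True by simp
  next
    case False
    hence "g * cayley G n x * g\<^sup>T \<noteq> ?E" if "g \<in> ?T" for g
      using superclass_iff[OF two B] x that by blast
    thus ?thesis using False unfolding N_def by (simp add: sum.neutral)
  qed
  define q where "q = complex_of_nat (card ?M)"
  have q0: "q \<noteq> 0"
    using finite_carrier_mat[of ?m ?m, where ?'a = 'a] one_carrier_mat[of ?m, where ?'a = 'a] by (auto simp: q_def)
  have fourier: "(\<Sum>A\<in>?M. \<theta> (- mat_pairing ?m A ?E) * h A x) = q * N (cayley G n x)" if x: "x \<in> U_set G n" for x
  proof -
    have Bc: "cayley G n x \<in> ?M" by (rule cayley_props(1)[OF refl two U_set_unitriangular[OF x]])
    have Xc: "g * cayley G n x * g\<^sup>T \<in> ?M" if "g \<in> ?T" for g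
      using unitriangularD(1)[OF that] Bc by (simp add: mult_carrier_mat[of _ ?m ?m _ ?m])
    have "(\<Sum>A\<in>?M. \<theta> (- mat_pairing ?m A ?E) * h A x) =
      (\<Sum>A\<in>?M. \<Sum>g\<in>?T. \<theta> (mat_pairing ?m A (g * cayley G n x * g\<^sup>T - ?E)))"
    proof (rule sum.cong[OF refl])
      fix A assume A: "A \<in> ?M"
      have "\<theta> (- mat_pairing ?m A ?E) * h A x =
        (\<Sum>g\<in>?T. \<theta> (- mat_pairing ?m A ?E) * \<theta> (mat_pairing ?m A (g * cayley G n x * g\<^sup>T)))"
        unfolding h(2)[OF A x] by (rule sum_distrib_left)
      also have "\<dots> = (\<Sum>g\<in>?T. \<theta> (mat_pairing ?m A (g * cayley G n x * g\<^sup>T - ?E)))"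
      proof (rule sum.cong[OF refl])
        fix g assume g: "g \<in> ?T"
        show "\<theta> (- mat_pairing ?m A ?E) * \<theta> (mat_pairing ?m A (g * cayley G n x * g\<^sup>T)) =
          \<theta> (mat_pairing ?m A (g * cayley G n x * g\<^sup>T - ?E))"
          unfolding mat_pairing_diff[OF Xc[OF g] superform_carrier] nontrivial_additive_characterD(1)[OF \<theta>]
          by (rule mult.commute)
      qed
      finally show "\<theta> (- mat_pairing ?m A ?E) * h A x =
        (\<Sum>g\<in>?T. \<theta> (mat_pairing ?m A (g * cayley G n x * g\<^sup>T - ?E)))" .
    qed
    also have "\<dots> = (\<Sum>g\<in>?T. \<Sum>A\<in>?M. \<theta> (mat_pairing ?m A (g * cayley G n x * g\<^sup>T - ?E)))"
      by (rule sum.swap)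
    also have "\<dots> = (\<Sum>g\<in>?T. q * (if g * cayley G n x * g\<^sup>T = ?E then 1 else 0))"
    proof (rule sum.cong[OF refl])
      fix g assume g: "g \<in> ?T"
      let ?X = "g * cayley G n x * g\<^sup>T"
      have XE: "?X - ?E \<in> ?M" by (rule minus_carrier_mat[OF superform_carrier])
      have Edim: "dim_row ?E = ?m" "dim_col ?E = ?m" using carrier_matD[OF superform_carrier[of G n D \<phi>]] by auto
      have "?X - ?E = 0\<^sub>m ?m ?m \<longleftrightarrow> ?X = ?E"
      proof
        assume z: "?X - ?E = 0\<^sub>m ?m ?m"
        show "?X = ?E"
        proof (rule eq_matI)
          fix i j assume ij: "i < dim_row ?E" "j < dim_col ?E"
          have "(?X - ?E) $$ (i, j) = 0" unfolding z using ij Edim by simp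
          thus "?X $$ (i, j) = ?E $$ (i, j)" using ij by (simp del: index_mult_mat(1))
        qed (use Xc[OF g] Edim in auto)
      next
        assume "?X = ?E"
        thus "?X - ?E = 0\<^sub>m ?m ?m" using minus_r_inv_mat[OF superform_carrier[of G n D \<phi>]] by simp
      qed
      thus "(\<Sum>A\<in>?M. \<theta> (mat_pairing ?m A (?X - ?E))) = q * (if ?X = ?E then 1 else 0)"
        unfolding mat_pairing_orthogonality[OF \<theta> XE] q_def by simp
    qed
    also have "\<dots> = q * N (cayley G n x)" unfolding N_def by (rule sum_distrib_left[symmetric])
    finally show ?thesis .
  qed
  \<comment> \<open>\<open>q\<close> comes from the orthogonality relation, \<open>N ?E\<close> from
    the stabiliser.\<close>
  let ?c = "1 / (q * N ?E)"
  have "superclass_indicator G n (D, \<phi>) = (\<Sum>A\<in>?M. (\<lambda>x. (?c * \<theta> (- mat_pairing ?m A ?E)) * h A x))"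
  proof
    fix x
    have r: "(\<Sum>A\<in>?M. (\<lambda>x. (?c * \<theta> (- mat_pairing ?m A ?E)) * h A x)) x =
      ?c * (\<Sum>A\<in>?M. \<theta> (- mat_pairing ?m A ?E) * h A x)"
      unfolding fun_sum_apply sum_distrib_left by (simp only: mult.assoc)
    show "superclass_indicator G n (D, \<phi>) x = (\<Sum>A\<in>?M. (\<lambda>x. (?c * \<theta> (- mat_pairing ?m A ?E)) * h A x)) x"
    proof (cases "x \<in> U_set G n")
      case True
      show ?thesis unfolding r fourier[OF True] NK[OF True] superclass_indicator_def using q0 N0 by simp
    next
      case False
      hence "x \<notin> superclass G n D \<phi>" by (simp add: superclass_def)
      thus ?thesis unfolding r superclass_indicator_def using h(3)[OF _ False] by (simp add: sum.neutral)
    qed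
  qed
  also have "\<dots> \<in> cfun.span (supercharacters G n \<theta>)"
    by (intro cfun.span_sum cfun.span_scale h(1))
  finally show ?thesis .
qed

section \<open>Indicator functions and counting\<close>

definition basic_pairs :: "group_type \<Rightarrow> nat \<Rightarrow> (root set \<times> (root \<Rightarrow> 'a::field)) set" where
  "basic_pairs G n = {(D, \<phi>). basic_pair G n D \<phi>}"

text \<open>The normal form determines the basic pair, which embeds the basic pairs into a finite
  set of matrices.\<close>

lemma finite_basic_pairs: "finite (basic_pairs G n :: (root set \<times> (root \<Rightarrow> 'a::{field,finite})) set)"
proof (rule finite_imageD)
  show "finite ((\<lambda>(D, \<phi>). superform G n D \<phi>) ` (basic_pairs G n :: (root set \<times> (root \<Rightarrow> 'a)) set))"
    by (rule finite_subset[OF _ finite_carrier_mat[of "dimn G n" "dimn G n"]]) auto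
  show "inj_on (\<lambda>(D, \<phi>). superform G n D \<phi>) (basic_pairs G n :: (root set \<times> (root \<Rightarrow> 'a)) set)"
  proof (rule inj_onI, clarify)
    fix D D' :: "root set" and \<phi> \<phi>' :: "root \<Rightarrow> 'a"
    assume "(D, \<phi>) \<in> basic_pairs G n" "(D', \<phi>') \<in> basic_pairs G n"
      and eq: "superform G n D \<phi> = superform G n D' \<phi>'"
    hence B: "basic_pair G n D \<phi>" "basic_pair G n D' \<phi>'" by (simp_all add: basic_pairs_def)
    show "D = D' \<and> \<phi> = \<phi>'" using superform_inj[OF B eq] by blast
  qed
qed

lemma superclass_indicator_in_scf:
  fixes p :: "root set \<times> (root \<Rightarrow> 'a::{field,finite})"
  assumes two: "(2::'a) \<noteq> 0" and p: "p \<in> basic_pairs G n"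
  shows "superclass_indicator G n p \<in> scf G n"
proof -
  obtain D \<phi> where p': "p = (D, \<phi>)" "basic_pair G n D \<phi>" using p by (auto simp: basic_pairs_def)
  have e: "x \<in> superclass G n D \<phi> \<longleftrightarrow> (D = D' \<and> \<phi> = \<phi>')"
    if "basic_pair G n D' \<phi>'" "x \<in> superclass G n D' \<phi>'" for D' \<phi>' x
    using superclass_disjoint[OF two p'(2) that(1) _ that(2)] that(2) by blast
  show ?thesis unfolding scf_def
  proof (intro CollectI conjI allI impI ballI)
    show "superclass_indicator G n p x = 0" if "x \<notin> U_set G n" for x
      using that by (simp add: superclass_indicator_def superclass_def)
    fix D' \<phi>' and x y :: "'a mat"
    assume a: "basic_pair G n D' \<phi>'" "x \<in> superclass G n D' \<phi>'" "y \<in> superclass G n D' \<phi>'"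
    show "superclass_indicator G n p x = superclass_indicator G n p y"
      unfolding superclass_indicator_def p'(1) fst_conv snd_conv e[OF a(1,2)] e[OF a(1,3)] ..
  qed
qed

lemma subspace_scf: "cfun.subspace (scf G n :: ('a::field mat \<Rightarrow> complex) set)"
proof (rule cfun.subspaceI)
  have D: "f x = f y" if "f \<in> scf G n" "basic_pair G n D \<phi>" "x \<in> superclass G n D \<phi>" "y \<in> superclass G n D \<phi>"
    for f :: "'a mat \<Rightarrow> complex" and D \<phi> x y
    using that unfolding scf_def by blast
  have Z: "f x = 0" if "f \<in> scf G n" "x \<notin> U_set G n" for f :: "'a mat \<Rightarrow> complex" and x
    using that unfolding scf_def by blast
  show "(0 :: 'a mat \<Rightarrow> complex) \<in> scf G n" by (simp add: scf_def)
  fix f g :: "'a mat \<Rightarrow> complex" and c :: complex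
  assume f: "f \<in> scf G n"
  show "(\<lambda>x. c * f x) \<in> scf G n"
    unfolding scf_def
  proof (intro CollectI conjI allI impI ballI)
    show "c * f x = 0" if "x \<notin> U_set G n" for x using Z[OF f that] by simp
    show "c * f x = c * f y" if "basic_pair G n D \<phi>" "x \<in> superclass G n D \<phi>" "y \<in> superclass G n D \<phi>" for D \<phi> x y
      using D[OF f that] by simp
  qed
  assume g: "g \<in> scf G n"
  show "f + g \<in> scf G n"
    unfolding scf_def
  proof (intro CollectI conjI allI impI ballI)
    show "(f + g) x = 0" if "x \<notin> U_set G n" for x using Z[OF f that] Z[OF g that] by simp
    show "(f + g) x = (f + g) y" if "basic_pair G n D \<phi>" "x \<in> superclass G n D \<phi>" "y \<in> superclass G n D \<phi>" for D \<phi> x y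
      using D[OF f that] D[OF g that] by simp
  qed
qed

lemma superclass_indicator_at:
  fixes p :: "root set \<times> (root \<Rightarrow> 'a::{field,finite})"
  assumes two: "(2::'a) \<noteq> 0" and p: "p \<in> basic_pairs G n" "p' \<in> basic_pairs G n"
    and x: "x \<in> superclass G n (fst p) (snd p)"
  shows "superclass_indicator G n p' x = (if p' = p then 1 else 0)"
proof (cases "p' = p")
  case False
  obtain D \<phi> D' \<phi>' where pp: "p = (D, \<phi>)" "p' = (D', \<phi>')" by fastforce
  hence "x \<notin> superclass G n D' \<phi>'"
    using superclass_disjoint[OF two, of G n D \<phi> D' \<phi>' x] p x False by (auto simp: basic_pairs_def)
  thus ?thesis using False by (simp add: superclass_indicator_def pp(2))
qed (use x in \<open>simp add: superclass_indicator_def\<close>)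

lemma scf_eq_span_supercharacters:
  fixes \<theta> :: "'a::{field,finite} \<Rightarrow> complex"
  assumes two: "(2::'a) \<noteq> 0" and \<theta>: "nontrivial_additive_character \<theta>"
  shows "cfun.span (supercharacters G n \<theta>) = scf G n"
proof
  have "supercharacters G n \<theta> \<subseteq> scf G n"
    using supercharacter_in_scf[OF two \<theta>] by (auto simp: supercharacters_def)
  thus "cfun.span (supercharacters G n \<theta>) \<subseteq> scf G n" by (rule cfun.span_minimal[OF _ subspace_scf])
  show "scf G n \<subseteq> cfun.span (supercharacters G n \<theta>)"
  proof
    fix \<eta> :: "'a mat \<Rightarrow> complex" assume \<eta>: "\<eta> \<in> scf G n"
    let ?BP = "basic_pairs G n :: (root set \<times> (root \<Rightarrow> 'a)) set"
    define r where "r p = (SOME x. x \<in> superclass G n (fst p) (snd p))" for p :: "root set \<times> (root \<Rightarrow> 'a)"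
    have r: "r p \<in> superclass G n (fst p) (snd p)" if "p \<in> ?BP" for p
    proof -
      have "superclass G n (fst p) (snd p) \<noteq> {}"
        using superclass_nonempty[OF two, of G n "fst p" "snd p"] that by (auto simp: basic_pairs_def)
      thus ?thesis unfolding r_def by (meson ex_in_conv someI_ex)
    qed
    have "\<eta> = (\<Sum>p\<in>?BP. (\<lambda>x. \<eta> (r p) * superclass_indicator G n p x))"
    proof
      fix x
      show "\<eta> x = (\<Sum>p\<in>?BP. (\<lambda>x. \<eta> (r p) * superclass_indicator G n p x)) x"
      proof (cases "x \<in> U_set G n")
        case True
        obtain D \<phi> where D: "basic_pair G n D \<phi>" "x \<in> superclass G n D \<phi>" using superclass_cover[OF two True] by blast
        let ?p = "(D, \<phi>)"
        have p: "?p \<in> ?BP" using D by (simp add: basic_pairs_def)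
        have "(\<Sum>p\<in>?BP. (\<lambda>x. \<eta> (r p) * superclass_indicator G n p x)) x = (\<Sum>p\<in>?BP. if p = ?p then \<eta> (r p) else 0)"
          unfolding fun_sum_apply
          by (intro sum.cong refl) (simp add: superclass_indicator_at[OF two p _, of _ x] D(2))
        also have "\<dots> = \<eta> (r ?p)" using p finite_basic_pairs[of G n, where ?'a = 'a] by (simp add: sum.delta)
        also have "\<dots> = \<eta> x"
        proof -
          have "r ?p \<in> superclass G n D \<phi>" using r[OF p] by simp
          thus ?thesis using \<eta> D unfolding scf_def by blast
        qed
        finally show ?thesis ..
      next
        case False
        hence "superclass_indicator G n p x = 0" for p by (simp add: superclass_indicator_def superclass_def)
        moreover have "\<eta> x = 0" using \<eta> False unfolding scf_def by blast
        ultimately show ?thesis by (simp add: fun_sum_apply)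
      qed
    qed
    also have "\<dots> \<in> cfun.span (supercharacters G n \<theta>)"
    proof (rule cfun.span_sum)
      fix p assume "p \<in> ?BP"
      hence "superclass_indicator G n p \<in> cfun.span (supercharacters G n \<theta>)"
        using superclass_indicator_in_span[OF two \<theta>, of G n "fst p" "snd p"] by (auto simp: basic_pairs_def)
      thus "(\<lambda>x. \<eta> (r p) * superclass_indicator G n p x) \<in> cfun.span (supercharacters G n \<theta>)"
        by (rule cfun.span_scale)
    qed
    finally show "\<eta> \<in> cfun.span (supercharacters G n \<theta>)" .
  qed
qed

text \<open>The supercharacters span \<open>scf\<close>, and there are at most as many of them as there are
  superclasses, whose indicator functions are linearly independent.\<close>

lemma independent_supercharacters:
  fixes \<theta> :: "'a::{field,finite} \<Rightarrow> complex"
  assumes two: "(2::'a) \<noteq> 0" and \<theta>: "nontrivial_additive_character \<theta>"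
  shows "cfun.independent (supercharacters G n \<theta>)"
proof
  let ?S = "supercharacters G n \<theta>" and ?BP = "basic_pairs G n :: (root set \<times> (root \<Rightarrow> 'a)) set"
  let ?I = "superclass_indicator G n ` ?BP"
  have S: "?S = (\<lambda>(D, \<phi>). supercharacter G n \<theta> D \<phi>) ` ?BP"
    by (auto simp: supercharacters_def basic_pairs_def)
  have finS: "finite ?S" and cardS: "card ?S \<le> card ?BP"
    unfolding S using finite_basic_pairs by (auto intro: card_image_le)
  have ne: "\<exists>x. x \<in> superclass G n (fst p) (snd p)" if "p \<in> ?BP" for p
    using superclass_nonempty[OF two, of G n "fst p" "snd p"] that by (auto simp: basic_pairs_def)
  have inj: "inj_on (superclass_indicator G n) ?BP"
  proof (rule inj_onI)
    fix p p' assume p: "p \<in> ?BP" "p' \<in> ?BP" "superclass_indicator G n p = superclass_indicator G n p'"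
    obtain x where x: "x \<in> superclass G n (fst p) (snd p)" using ne[OF p(1)] by blast
    have "superclass_indicator G n p' x = 1"
      unfolding p(3)[symmetric] superclass_indicator_at[OF two p(1) p(1) x] by simp
    thus "p = p'"
      unfolding superclass_indicator_at[OF two p(1,2) x] by (cases "p' = p") simp_all
  qed
  have indI: "cfun.independent ?I"
  proof (rule cfun.independent_if_scalars_zero)
    show "finite ?I" using finite_basic_pairs by blast
    fix c and v :: "'a mat \<Rightarrow> complex"
    assume s: "(\<Sum>v\<in>?I. (\<lambda>x. c v * v x)) = 0" and v: "v \<in> ?I"
    then obtain p where p: "p \<in> ?BP" "v = superclass_indicator G n p" by blast
    obtain x where x: "x \<in> superclass G n (fst p) (snd p)" using ne[OF p(1)] by blast
    have "0 = (\<Sum>v\<in>?I. (\<lambda>x. c v * v x)) x" using s by simp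
    also have "\<dots> = (\<Sum>v\<in>?I. c v * v x)" by (rule fun_sum_apply)
    also have "\<dots> = (\<Sum>p'\<in>?BP. c (superclass_indicator G n p') * superclass_indicator G n p' x)"
      by (rule sum.reindex[OF inj, unfolded o_def])
    also have "\<dots> = (\<Sum>p'\<in>?BP. if p' = p then c (superclass_indicator G n p') else 0)"
      by (intro sum.cong refl) (simp add: superclass_indicator_at[OF two p(1) _ x])
    also have "\<dots> = c v" using p finite_basic_pairs[of G n, where ?'a = 'a] by (simp add: sum.delta)
    finally show "c v = 0" ..
  qed
  assume "cfun.dependent ?S"
  then obtain a where a: "a \<in> ?S" "a \<in> cfun.span (?S - {a})" unfolding cfun.dependent_def by blast
  \<comment> \<open>Dropping the redundant \<open>a\<close> leaves a spanning set with fewer than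
    \<open>card ?BP\<close> elements, too small for the \<open>card ?BP\<close> independent
    indicators.\<close>
  have "cfun.span (?S - {a}) = scf G n"
    using cfun.span_redundant[OF a(2)] a(1) scf_eq_span_supercharacters[OF two \<theta>, of G n] by (simp add: insert_absorb)
  hence "?I \<subseteq> cfun.span (?S - {a})" using superclass_indicator_in_scf[OF two] by blast
  hence "card ?I \<le> card (?S - {a})"
    using cfun.independent_span_bound[OF _ indI] finS by blast
  moreover have "card ?I = card ?BP" by (rule card_image[OF inj])
  moreover have "card (?S - {a}) < card ?S" using finS a(1) by (rule card_Diff1_less)
  ultimately show False using cardS by simp
qed

text \<open>Translation by 1 permutes the field, so comparing the sum of all elements before and
  after shows that the number of elements is zero in the field. With 2 = 0 an odd number would be 1
  there.\<close>

lemma two_nonzero_if_odd_card: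
  assumes "odd (card (UNIV :: 'a set))"
  shows "(2::'a::{field,finite}) \<noteq> 0"
proof
  assume two: "(2::'a) = 0"
  have "(\<Sum>x\<in>(UNIV::'a set). x + 1) = (\<Sum>x\<in>UNIV. x)"
    by (rule sum.reindex_bij_betw) (rule bij_betwI[where g = "\<lambda>x. x - 1"], auto)
  hence "of_nat (card (UNIV :: 'a set)) = (0::'a)" by (simp add: sum.distrib)
  moreover obtain j where "card (UNIV :: 'a set) = 2 * j + 1" using assms by (rule oddE)
  ultimately have "1 + 2 * of_nat j = (0::'a)" by simp
  thus False unfolding two by simp
qed

theorem theorem4p1:
  fixes G :: group_type
    and n p e :: nat
    and \<theta> :: "'a::{field,finite} \<Rightarrow> complex"
  assumes "prime p" and "odd p" and "e \<ge> 1" and "card (UNIV :: 'a set) = p ^ e"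
    and "n \<ge> 1"
    and "nontrivial_additive_character \<theta>"
  shows "(\<forall>D \<phi>. basic_pair G n D \<phi> \<longrightarrow> supercharacter G n \<theta> D \<phi> \<in> scf G n) \<and>
         (\<forall>\<eta> \<in> scf G n. \<eta> \<in> cfun.span (supercharacters G n \<theta>)) \<and>
         cfun.subspace (scf G n :: ('a mat \<Rightarrow> complex) set) \<and>
         cfun_basis (supercharacters G n \<theta>) (scf G n)"
proof -
  have two: "(2::'a) \<noteq> 0"
    by (rule two_nonzero_if_odd_card) (use assms(2,4) in simp)
  show ?thesis
    unfolding cfun_basis_def
    using supercharacter_in_scf[OF two assms(6)] scf_eq_span_supercharacters[OF two assms(6), of G n]
      independent_supercharacters[OF two assms(6), of G n] subspace_scf
    by blast
qed

end
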